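(* For all $\tilde\alpha,\tilde\beta\in\widetilde{PSL_2\mathbb R}$, with images $\alpha,\beta\in PSL_2\mathbb R=\mathrm{Isom}^+\mathbb H^2$, and all $p\in\overline{\mathbb H}^2=\mathbb H^2\cup S^1_\infty$, $$\mathrm{Tw}(\tilde\beta\tilde\alpha,p)=\mathrm{Tw}(\tilde\beta,p)+\mathrm{Tw}(\tilde\alpha,p)-\Delta[p,\beta p,\beta\alpha p].$$
   Context: $\mathbb H^2$ is the oriented hyperbolic plane (curvature $-1$), $S^1_\infty$ its circle at infinity. $PSL_2\mathbb R$ is identified with $\mathrm{Isom}^+\mathbb H^2$ (acting on the left), and $\widetilde{PSL_2\mathbb R}$ is its universal covering group, whose elements are homotopy classes rel endpoints of paths $(g_t)_{t\in[0,1]}$ in $PSL_2\mathbb R$ with $g_0=1$; the image of such a class in $PSL_2\mathbb R$ is $g_1$. Twist at $y\in\mathbb H^2$: let $\tilde\alpha\in\widetilde{PSL_2\mathbb R}$ be represented by $(g_t)$, with image $\alpha=g_1$. Let $c:[0,1]\to\mathbb H^2$ be the constant speed (possibly constant) geodesic from $y$ to $\alpha(y)$. For a unit tangent vector $u$ at $y$, choose a path $\mathcal V:[0,1]\to UT\mathbb H^2$ of unit tangent vectors along $c$ (that is, $\mathcal V(t)$ is based at $c(t)$) which is homotopic rel endpoints in $UT\mathbb H^2$ to $t\mapsto Dg_t(u)$. Then $\mathrm{Tw}(\tilde\alpha,y)\in\mathbb R$ is the total change $\theta(1)-\theta(0)$ of a continuous determination $\theta(t)$ of the anticlockwise angle from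 the unit velocity vector of $c$ (if $c$ is constant: from a fixed unit tangent vector at $y$) to $\mathcal V(t)$. This is independent of choices. For $p\in S^1_\infty$, $\mathrm{Tw}(\tilde\alpha,p)$ is the limit of $\mathrm{Tw}(\tilde\alpha,x)$ as $x\to p$ along any geodesic with endpoint $p$ (the limit exists and is independent of the geodesic). $\Delta[A,B,C]$ is the signed area of the geodesic triangle with ordered vertices $A,B,C\in\overline{\mathbb H}^2$: positive if $A\to B\to C$ is anticlockwise, negative if clockwise, $0$ if degenerate (collinear or coincident vertices). *)

theory Defs
  imports "HOL-Analysis.Analysis"
begin

text \<open>
  The hyperbolic plane is the upper half-plane with the metric
  $(dx^2 + dy^2)/y^2$ (curvature $-1$) and the standard orientation of the complex plane.
  The model is conformal, so hyperbolic angles are Euclidean angles.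
\<close>

section \<open>The topological group PSL(2,R)\<close>

definition SL2R :: "(real^2^2) set" where
  "SL2R = {A. det A = 1}"

quotient_type psl2r = "real^2^2" / partial: "\<lambda>A B. A \<in> SL2R \<and> B \<in> SL2R \<and> (A = B \<or> A = - B)"
proof (rule part_equivpI)
  have "mat 1 \<in> SL2R"
    by (simp add: SL2R_def)
  then show "\<exists>A::real^2^2. A \<in> SL2R \<and> A \<in> SL2R \<and> (A = A \<or> A = - A)"
    by blast
qed (auto simp: symp_def transp_def)

lemma SL2R_mult: "A \<in> SL2R \<Longrightarrow> B \<in> SL2R \<Longrightarrow> A ** B \<in> SL2R"
  by (simp add: SL2R_def det_mul)

lemma SL2R_uminus: "A \<in> SL2R \<Longrightarrow> - A \<in> SL2R"
  by (simp add: SL2R_def det_2)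

lemma matrix_mult_uminus:
  fixes A B :: "real^2^2"
  shows "(- A) ** B = - (A ** B)" "A ** (- B) = - (A ** B)"
  by (simp_all add: matrix_matrix_mult_def vec_eq_iff sum_negf)

instantiation psl2r :: monoid_mult
begin

lift_definition one_psl2r :: psl2r is "mat 1"
  by (simp add: SL2R_def)

lift_definition times_psl2r :: "psl2r \<Rightarrow> psl2r \<Rightarrow> psl2r" is "(**)"
  by (auto simp: SL2R_mult matrix_mult_uminus)

instance
proof
  fix a b c :: psl2r
  show "a * b * c = a * (b * c)"
    by transfer (auto simp: SL2R_mult matrix_mul_assoc)
  show "1 * a = a"
    by transfer auto
  show "a * 1 = a"
    by transfer auto
qed

end

text \<open>The quotient topology inherited from the subspace topology of \<open>SL2R\<close>.\<close>

instantiation psl2r :: topological_space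
begin

definition open_psl2r :: "psl2r set \<Rightarrow> bool" where
  "open_psl2r U \<longleftrightarrow> openin (top_of_set SL2R) {A \<in> SL2R. abs_psl2r A \<in> U}"

instance
proof
  show "open (UNIV :: psl2r set)"
    by (simp add: open_psl2r_def)
next
  fix S T :: "psl2r set"
  assume "open S" "open T"
  then have "openin (top_of_set SL2R)
      ({A \<in> SL2R. abs_psl2r A \<in> S} \<inter> {A \<in> SL2R. abs_psl2r A \<in> T})"
    unfolding open_psl2r_def by (rule openin_Int)
  moreover have "{A \<in> SL2R. abs_psl2r A \<in> S \<inter> T} =
      {A \<in> SL2R. abs_psl2r A \<in> S} \<inter> {A \<in> SL2R. abs_psl2r A \<in> T}"
    by blast
  ultimately show "open (S \<inter> T)"
    by (simp only: open_psl2r_def)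
next
  fix K :: "psl2r set set"
  assume K: "\<forall>S\<in>K. open S"
  have "{A \<in> SL2R. abs_psl2r A \<in> \<Union>K} = (\<Union>S\<in>K. {A \<in> SL2R. abs_psl2r A \<in> S})"
    by blast
  moreover have "openin (top_of_set SL2R) (\<Union>S\<in>K. {A \<in> SL2R. abs_psl2r A \<in> S})"
    by (rule openin_Union) (use K in \<open>auto simp: open_psl2r_def\<close>)
  ultimately show "open (\<Union>K)"
    by (simp only: open_psl2r_def)
qed

end

lemma abs_psl2r_eq_iff:
  assumes "A \<in> SL2R" "B \<in> SL2R"
  shows "abs_psl2r A = abs_psl2r B \<longleftrightarrow> A = B \<or> A = - B"
  using Quotient_rel[OF Quotient_psl2r, of A B] assms by blast

lemma psl2r_obtain_rep:
  obtains A where "A \<in> SL2R" "abs_psl2r A = a"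
  by (metis Quotient_abs_rep[OF Quotient_psl2r] Quotient_rep_reflp[OF Quotient_psl2r])

lemma times_psl2r_abs:
  assumes "A \<in> SL2R" "B \<in> SL2R"
  shows "abs_psl2r A * abs_psl2r B = abs_psl2r (A ** B)"
  using assms by (simp add: times_psl2r.abs_eq)

lemma open_abs_psl2r_image:
  assumes "open W"
  shows "open (abs_psl2r ` (W \<inter> SL2R))"
proof -
  have opn: "open (uminus ` W)"
    using assms by (simp add: open_negations)
  have "{A \<in> SL2R. abs_psl2r A \<in> abs_psl2r ` (W \<inter> SL2R)} = SL2R \<inter> (W \<union> uminus ` W)"
  proof (intro equalityI subsetI)
    fix A assume "A \<in> {A \<in> SL2R. abs_psl2r A \<in> abs_psl2r ` (W \<inter> SL2R)}"
    then obtain B where "A \<in> SL2R" "B \<in> W" "B \<in> SL2R" "A = B \<or> A = - B"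
      by (auto simp: abs_psl2r_eq_iff)
    then show "A \<in> SL2R \<inter> (W \<union> uminus ` W)"
      by auto
  next
    fix A assume A: "A \<in> SL2R \<inter> (W \<union> uminus ` W)"
    then obtain B where "B \<in> W" "A = B \<or> A = - B"
      by auto
    moreover from this A have "B \<in> SL2R"
      using SL2R_uminus by fastforce
    ultimately show "A \<in> {A \<in> SL2R. abs_psl2r A \<in> abs_psl2r ` (W \<inter> SL2R)}"
      using A by (auto simp: abs_psl2r_eq_iff intro!: image_eqI[of _ _ B])
  qed
  then show ?thesis
    using assms opn by (auto simp: open_psl2r_def openin_open intro!: exI[of _ "W \<union> uminus ` W"])
qed

lemma open_matrix_mult_nhds:
  fixes A B :: "real^2^2"
  assumes "open W" "A ** B \<in> W"
  obtains U V where "open U" "open V" "A \<in> U" "B \<in> V" "\<And>X Y. X \<in> U \<Longrightarrow> Y \<in> V \<Longrightarrow> X ** Y \<in> W"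
proof -
  have "continuous_on UNIV (\<lambda>p. fst p ** snd p :: real^2^2)"
    unfolding matrix_matrix_mult_def
    by (intro continuous_intros)
  then have "open ((\<lambda>p. fst p ** snd p :: real^2^2) -` W)"
    using assms(1) open_vimage by blast
  moreover have "(A, B) \<in> (\<lambda>p. fst p ** snd p) -` W"
    using assms(2) by simp
  ultimately obtain U V where "open U" "open V" "(A, B) \<in> U \<times> V"
      "U \<times> V \<subseteq> (\<lambda>p. fst p ** snd p) -` W"
    by (rule open_prod_elim)
  then show ?thesis
    by (intro that[of U V]) auto
qed

instance psl2r :: topological_monoid_mult
proof
  fix a b :: psl2r
  show "LIM x (nhds a \<times>\<^sub>F nhds b). fst x * snd x :> nhds (a * b)"
    unfolding nhds_prod[symmetric]
  proof (rule topological_tendstoI)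
    fix S assume S: "open S" "a * b \<in> S"
    obtain A B where A: "A \<in> SL2R" "abs_psl2r A = a" and B: "B \<in> SL2R" "abs_psl2r B = b"
      using psl2r_obtain_rep by metis
    from S(1) obtain W where W: "open W" "{A \<in> SL2R. abs_psl2r A \<in> S} = SL2R \<inter> W"
      by (auto simp: open_psl2r_def openin_open)
    have "A ** B \<in> SL2R" "abs_psl2r (A ** B) \<in> S"
      using S(2) A B SL2R_mult times_psl2r_abs[OF A(1) B(1)] by auto
    then have "A ** B \<in> W"
      using W(2) by blast
    from open_matrix_mult_nhds[OF W(1) this]
    obtain U V where UV: "open U" "open V" "A \<in> U" "B \<in> V"
      "\<And>X Y. X \<in> U \<Longrightarrow> Y \<in> V \<Longrightarrow> X ** Y \<in> W"
      by blast
    let ?U = "abs_psl2r ` (U \<inter> SL2R)" and ?V = "abs_psl2r ` (V \<inter> SL2R)"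
    have "open (?U \<times> ?V)"
      using UV open_abs_psl2r_image by (intro open_Times) auto
    moreover have "(a, b) \<in> ?U \<times> ?V"
      using A B UV by auto
    moreover have "fst x * snd x \<in> S" if "x \<in> ?U \<times> ?V" for x
    proof -
      from that obtain X Y where "X \<in> U" "X \<in> SL2R" "Y \<in> V" "Y \<in> SL2R"
        "x = (abs_psl2r X, abs_psl2r Y)"
        by auto
      then have "X ** Y \<in> SL2R \<inter> W" "fst x * snd x = abs_psl2r (X ** Y)"
        using UV(5) SL2R_mult times_psl2r_abs by auto
      then show ?thesis
        using W(2) by auto
    qed
    ultimately show "\<forall>\<^sub>F x in nhds (a, b). fst x * snd x \<in> S"
      unfolding eventually_nhds by blast
  qed
qed

section \<open>The hyperbolic plane, its compactification and its isometries\<close>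

definition hplane :: "complex set" where
  "hplane = {z. Im z > 0}"

text \<open>The distance function of the Riemannian metric $(dx^2 + dy^2)/y^2$.\<close>

definition hdist :: "complex \<Rightarrow> complex \<Rightarrow> real" where
  "hdist z w = arcosh (1 + (cmod (z - w))\<^sup>2 / (2 * Im z * Im w))"

text \<open>Points of the Riemann sphere; the compactified plane is \<open>hplane\<close> together
  with its circle at infinity, the real line and the point \<open>Infty\<close>.\<close>

datatype sphere_pt = Pt complex | Infty

definition hbar :: "sphere_pt set" where
  "hbar = Pt ` {z. Im z \<ge> 0} \<union> {Infty}"

definition circle_inf :: "sphere_pt set" where
  "circle_inf = Pt ` {z. Im z = 0} \<union> {Infty}"

definition tends_to_pt :: "('a \<Rightarrow> complex) \<Rightarrow> sphere_pt \<Rightarrow> 'a filter \<Rightarrow> bool" where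
  "tends_to_pt f P F \<longleftrightarrow>
    (case P of Pt z \<Rightarrow> (f \<longlongrightarrow> z) F | Infty \<Rightarrow> filterlim f at_infinity F)"

lift_definition act :: "psl2r \<Rightarrow> complex \<Rightarrow> complex" is
  "\<lambda>A z. (of_real (A$1$1) * z + of_real (A$1$2)) / (of_real (A$2$1) * z + of_real (A$2$2))"
proof (rule ext)
  fix A B :: "real^2^2" and z :: complex
  have *: "(- a * z + - b) / (- c * z + - d) = (a * z + b) / (c * z + d)" for a b c d :: complex
  proof -
    have "- a * z + - b = - (a * z + b)" "- c * z + - d = - (c * z + d)"
      by auto
    then show ?thesis
      by (simp only: minus_divide_divide)
  qed
  assume "A \<in> SL2R \<and> B \<in> SL2R \<and> (A = B \<or> A = - B)"
  then show "(of_real (A$1$1) * z + of_real (A$1$2)) / (of_real (A$2$1) * z + of_real (A$2$2)) =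
      (of_real (B$1$1) * z + of_real (B$1$2)) / (of_real (B$2$1) * z + of_real (B$2$2))"
    using * by auto
qed

lift_definition pole :: "psl2r \<Rightarrow> complex \<Rightarrow> bool" is
  "\<lambda>A z. of_real (A$2$1) * z + of_real (A$2$2) = 0"
proof (rule ext)
  fix A B :: "real^2^2" and z :: complex
  have *: "- c * z + - d = 0 \<longleftrightarrow> c * z + d = 0" for c d :: complex
    by (metis add.inverse_distrib_swap add.commute mult_minus_left neg_equal_0_iff_equal)
  assume "A \<in> SL2R \<and> B \<in> SL2R \<and> (A = B \<or> A = - B)"
  then show "(of_real (A$2$1) * z + of_real (A$2$2) = 0) \<longleftrightarrow>
      (of_real (B$2$1) * z + of_real (B$2$2) = 0)"
    using * by auto
qed

lift_definition act_Infty :: "psl2r \<Rightarrow> sphere_pt" is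
  "\<lambda>A. if A$2$1 = 0 then Infty else Pt (of_real (A$1$1 / A$2$1))"
  by auto

definition act_bar :: "psl2r \<Rightarrow> sphere_pt \<Rightarrow> sphere_pt" where
  "act_bar a P =
    (case P of Pt z \<Rightarrow> if pole a z then Infty else Pt (act a z) | Infty \<Rightarrow> act_Infty a)"

section \<open>The universal covering group\<close>

text \<open>Otherwise the lifting of functions on paths would unfold \<open>psl2r\<close> to matrices as well.\<close>

lifting_forget psl2r.lifting

quotient_type upsl2r = "real \<Rightarrow> psl2r" /
  partial: "\<lambda>g h. path g \<and> pathstart g = 1 \<and> homotopic_paths UNIV g h"
proof (rule part_equivpI)
  show "\<exists>g::real \<Rightarrow> psl2r. path g \<and> pathstart g = 1 \<and> homotopic_paths UNIV g g"
    by (intro exI[of _ "\<lambda>_. 1"]) (auto simp: path_def pathstart_def homotopic_paths_refl)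
  show "symp (\<lambda>g h::real \<Rightarrow> psl2r. path g \<and> pathstart g = 1 \<and> homotopic_paths UNIV g h)"
    unfolding symp_def
    by (metis homotopic_paths_sym homotopic_paths_imp_path homotopic_paths_imp_pathstart)
  show "transp (\<lambda>g h::real \<Rightarrow> psl2r. path g \<and> pathstart g = 1 \<and> homotopic_paths UNIV g h)"
    unfolding transp_def
    by (blast intro: homotopic_paths_trans)
qed

lemma homotopic_paths_mult:
  fixes g g' h h' :: "real \<Rightarrow> 'a::topological_monoid_mult"
  assumes "homotopic_paths UNIV g g'" "homotopic_paths UNIV h h'"
  shows "homotopic_paths UNIV (\<lambda>t. g t * h t) (\<lambda>t. g' t * h' t)"
proof -
  obtain k where "continuous_on ({0..1} \<times> {0..1}) k"
    "\<forall>x\<in>{0..1}. k (0,x) = g x" "\<forall>x\<in>{0..1}. k (1,x) = g' x"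
    "\<forall>t\<in>{0..1::real}. pathstart (k \<circ> Pair t) = pathstart g \<and> pathfinish (k \<circ> Pair t) = pathfinish g"
    using assms(1) unfolding homotopic_paths by blast
  moreover obtain l where "continuous_on ({0..1} \<times> {0..1}) l"
    "\<forall>x\<in>{0..1}. l (0,x) = h x" "\<forall>x\<in>{0..1}. l (1,x) = h' x"
    "\<forall>t\<in>{0..1::real}. pathstart (l \<circ> Pair t) = pathstart h \<and> pathfinish (l \<circ> Pair t) = pathfinish h"
    using assms(2) unfolding homotopic_paths by blast
  ultimately show ?thesis
    unfolding homotopic_paths
    by (intro exI[of _ "\<lambda>x. k x * l x"])
      (auto intro!: continuous_on_mult' simp: pathstart_def pathfinish_def)
qed

instantiation upsl2r :: times
begin

lift_definition times_upsl2r :: "upsl2r \<Rightarrow> upsl2r \<Rightarrow> upsl2r" is "\<lambda>g h t. g t * h t"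
proof -
  fix g g' h h' :: "real \<Rightarrow> psl2r"
  assume "path g \<and> pathstart g = 1 \<and> homotopic_paths UNIV g g'"
    and "path h \<and> pathstart h = 1 \<and> homotopic_paths UNIV h h'"
  then show "path (\<lambda>t. g t * h t) \<and> pathstart (\<lambda>t. g t * h t) = 1 \<and>
      homotopic_paths UNIV (\<lambda>t. g t * h t) (\<lambda>t. g' t * h' t)"
    using homotopic_paths_mult by (auto simp: path_def pathstart_def intro!: continuous_on_mult')
qed

instance ..

end

definition represents :: "(real \<Rightarrow> psl2r) \<Rightarrow> upsl2r \<Rightarrow> bool" where
  "represents g a \<longleftrightarrow> path g \<and> pathstart g = 1 \<and> abs_upsl2r g = a"

lift_definition proj :: "upsl2r \<Rightarrow> psl2r" is pathfinish
  by (blast dest: homotopic_paths_imp_pathfinish)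

section \<open>Geodesics\<close>

text \<open>Geodesics are described metrically: a geodesic segment from \<open>y\<close> to \<open>z\<close> parametrised
  on the unit interval with constant speed \<open>hdist y z\<close>, and complete geodesics parametrised
  by arc length.\<close>

definition geodesic_seg :: "complex \<Rightarrow> complex \<Rightarrow> (real \<Rightarrow> complex) \<Rightarrow> bool" where
  "geodesic_seg y z c \<longleftrightarrow> c ` {0..1} \<subseteq> hplane \<and> c 0 = y \<and> c 1 = z \<and>
    (\<forall>s\<in>{0..1}. \<forall>t\<in>{0..1}. hdist (c s) (c t) = \<bar>s - t\<bar> * hdist y z)"

definition geodesic_line :: "(real \<Rightarrow> complex) \<Rightarrow> bool" where
  "geodesic_line \<gamma> \<longleftrightarrow> range \<gamma> \<subseteq> hplane \<and> (\<forall>s t. hdist (\<gamma> s) (\<gamma> t) = \<bar>s - t\<bar>)"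

text \<open>\<open>passes \<gamma> s P\<close>: the geodesic \<open>\<gamma>\<close> is at \<open>P\<close> at time \<open>s\<close>; at the times
  \<open>\<infinity>\<close> and \<open>-\<infinity>\<close> it is at its endpoints on the circle at infinity.\<close>

definition passes :: "(real \<Rightarrow> complex) \<Rightarrow> ereal \<Rightarrow> sphere_pt \<Rightarrow> bool" where
  "passes \<gamma> s P \<longleftrightarrow>
    (if s = \<infinity> then tends_to_pt \<gamma> P at_top
     else if s = -\<infinity> then tends_to_pt \<gamma> P at_bot
     else P = Pt (\<gamma> (real_of_ereal s)))"

section \<open>The twist\<close>

text \<open>The unit tangent bundle as pairs of a base point and a tangent vector, where the
  hyperbolic norm of \<open>v\<close> at \<open>z\<close> is \<open>cmod v / Im z\<close>.\<close>

definition UT :: "(complex \<times> complex) set" where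
  "UT = {(z, v). z \<in> hplane \<and> cmod v / Im z = 1}"

definition act_UT :: "psl2r \<Rightarrow> complex \<times> complex \<Rightarrow> complex \<times> complex" where
  "act_UT a = (\<lambda>(z, v). (act a z, deriv (act a) z * v))"

definition unit_velocity :: "(real \<Rightarrow> complex) \<Rightarrow> real \<Rightarrow> complex" where
  "unit_velocity c t = (let v = vector_derivative c (at t within {0..1})
    in of_real (Im (c t) / cmod v) * v)"

definition angle_determination ::
  "(real \<Rightarrow> complex) \<Rightarrow> (real \<Rightarrow> complex) \<Rightarrow> (real \<Rightarrow> real) \<Rightarrow> bool" where
  "angle_determination e v \<theta> \<longleftrightarrow>
    continuous_on {0..1} \<theta> \<and> (\<forall>t\<in>{0..1}. v t = cis (\<theta> t) * e t)"

text \<open>\<open>is_twist a y r\<close>: the number \<open>r\<close> is obtained from some choice of representative \<open>g\<close>,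
  unit vector \<open>u\<close>, path \<open>\<V>\<close>, reference field \<open>e\<close> along \<open>c\<close> and angle \<open>\<theta>\<close>.\<close>

definition is_twist :: "upsl2r \<Rightarrow> complex \<Rightarrow> real \<Rightarrow> bool" where
  "is_twist a y r \<longleftrightarrow> (\<exists>g c u \<V> e \<theta>.
    represents g a \<and>
    geodesic_seg y (act (proj a) y) c \<and>
    (y, u) \<in> UT \<and>
    (\<forall>t\<in>{0..1}. fst (\<V> t) = c t) \<and>
    homotopic_paths UT \<V> (\<lambda>t. act_UT (g t) (y, u)) \<and>
    (if act (proj a) y = y then \<exists>w. (y, w) \<in> UT \<and> (\<forall>t\<in>{0..1}. e t = w)
     else \<forall>t\<in>{0..1}. e t = unit_velocity c t) \<and>
    angle_determination e (\<lambda>t. snd (\<V> t)) \<theta> \<and>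
    r = \<theta> 1 - \<theta> 0)"

definition twist :: "upsl2r \<Rightarrow> complex \<Rightarrow> real" where
  "twist a y = (THE r. is_twist a y r)"

definition twist_inf :: "upsl2r \<Rightarrow> sphere_pt \<Rightarrow> real" where
  "twist_inf a P = (THE r. \<forall>\<gamma>. geodesic_line \<gamma> \<and> passes \<gamma> \<infinity> P \<longrightarrow>
    ((\<lambda>s. twist a (\<gamma> s)) \<longlongrightarrow> r) at_top)"

definition Tw :: "upsl2r \<Rightarrow> sphere_pt \<Rightarrow> real" where
  "Tw a P = (if P \<in> circle_inf then twist_inf a P else case P of Pt z \<Rightarrow> twist a z)"

section \<open>Signed area of geodesic triangles\<close>

text \<open>The closed geodesic segment between two points of the compactified plane.\<close>

definition hsegment :: "sphere_pt \<Rightarrow> sphere_pt \<Rightarrow> sphere_pt set" where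
  "hsegment A B = {P. \<exists>\<gamma> s r t. geodesic_line \<gamma> \<and> s \<le> r \<and> r \<le> t \<and>
    passes \<gamma> s A \<and> passes \<gamma> r P \<and> passes \<gamma> t B}"

text \<open>The solid triangle, as the join of \<open>A\<close> with the opposite side.\<close>

definition htriangle :: "sphere_pt \<Rightarrow> sphere_pt \<Rightarrow> sphere_pt \<Rightarrow> complex set" where
  "htriangle A B C = {z \<in> hplane. \<exists>Q \<in> hsegment B C. Pt z \<in> hsegment A Q}"

definition harea :: "complex set \<Rightarrow> real" where
  "harea S = (LINT z:S|lborel. 1 / (Im z)\<^sup>2)"

text \<open>\<open>A \<rightarrow> B \<rightarrow> C\<close> is anticlockwise (and the triangle nondegenerate): \<open>C\<close> lies
  strictly to the left of the geodesic \<open>\<gamma>\<close> through \<open>A\<close> and then \<open>B\<close>, in the sense that some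
  geodesic \<open>\<delta>\<close> leaves \<open>\<gamma>\<close> towards the left and arrives at \<open>C\<close>.\<close>

definition anticlockwise :: "sphere_pt \<Rightarrow> sphere_pt \<Rightarrow> sphere_pt \<Rightarrow> bool" where
  "anticlockwise A B C \<longleftrightarrow> (\<exists>\<gamma> s t \<delta> r l.
    geodesic_line \<gamma> \<and> s < t \<and> passes \<gamma> s A \<and> passes \<gamma> t B \<and>
    geodesic_line \<delta> \<and> \<delta> 0 = \<gamma> r \<and> 0 < l \<and> passes \<delta> l C \<and>
    0 < Im (cnj (vector_derivative \<gamma> (at r)) * vector_derivative \<delta> (at 0)))"

definition signed_area :: "sphere_pt \<Rightarrow> sphere_pt \<Rightarrow> sphere_pt \<Rightarrow> real" where
  "signed_area A B C =
    (if anticlockwise A B C then harea (htriangle A B C)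
     else if anticlockwise A C B then - harea (htriangle A B C)
     else 0)"

end

theory Submission
  imports Defs "HOL-Complex_Analysis.Winding_Numbers"
begin

text \<open>
  In the upper half-plane every tangent vector has a Euclidean direction, so both angles in the
  definition of the twist can be measured against the horizontal. The path of vectors
  $Dg_t(u)$ contributes the change of the argument of $Dg_t$ at \<open>y\<close>, called \<open>rotation\<close>; the
  velocity of the geodesic from \<open>y\<close> to $\alpha y$ contributes the Euclidean angle \<open>turning\<close>
  by which that geodesic bends. Hence the twist at a point \<open>y\<close> of the plane is
  $\mathrm{rotation}(\alpha, y) - \mathrm{turning}(y, \alpha y)$ (\<open>twist_eq\<close>).

  By the chain rule the rotation of $\beta\alpha$ at \<open>y\<close> is the rotation of $\alpha$ at
  \<open>y\<close> plus the rotation of $\beta$ at $\alpha y$ (\<open>rotation_mult\<close>). Moving the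
  base point of the latter from $\alpha y$ back to \<open>y\<close> costs the difference between the turnings of
  the geodesic joining these points and of its image, because an isometry takes geodesics to
  geodesics (\<open>rotation_diff\<close>). All rotations cancel, and the defect of additivity is
  the sum of the turnings around the triangle $y, \beta y, \beta\alpha y$ (\<open>twist_mult\<close>).
  By Gauss--Bonnet this sum is minus the signed area. That instance of Gauss--Bonnet is proved by
  integration: along a geodesic $dx/y$ is minus the differential of the direction, and
  $\int dx\,dy/y^2$ over the region between two graphs is the difference of the integrals of $dx/y$
  (\<open>signed_area_hplane\<close>).

  For \<open>p\<close> on the circle at infinity the identity at points of a geodesic ending at \<open>p\<close> is
  passed to the limit (\<open>Tw_mult_ideal\<close>). After moving \<open>p\<close> to \<open>Infty\<close> by an isometry the turnings
  converge, the limit of their sum being $0$ or $\pm\pi$, and it is compared with the area of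
  an ideal triangle (\<open>signed_area_Infty\<close>). The move is possible because the sum of
  turnings, the area, and the orientation are invariant under isometries.
\<close>

section \<open>Matrices and Moebius maps\<close>

definition psl :: "real \<Rightarrow> real \<Rightarrow> real \<Rightarrow> real \<Rightarrow> psl2r" where
  "psl a b c d = abs_psl2r (vector [vector [a, b], vector [c, d]])"

lemma SL2R_vector_iff: "(vector [vector [a, b], vector [c, d]] :: real^2^2) \<in> SL2R \<longleftrightarrow> a * d - b * c = 1"
  by (simp add: SL2R_def det_2 algebra_simps)

lemma psl_cases:
  obtains a b c d where "a * d - b * c = 1" "g = psl a b c d"
proof -
  obtain A where A: "A \<in> SL2R" "abs_psl2r A = g"
    by (rule psl2r_obtain_rep)
  have *: "A = vector [vector [A$1$1, A$1$2], vector [A$2$1, A$2$2]]"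
    by (simp add: vec_eq_iff forall_2)
  show ?thesis
    by (rule that[of "A$1$1" "A$2$2" "A$1$2" "A$2$1"])
      (use A * in \<open>auto simp: psl_def SL2R_def det_2\<close>)
qed

lemma psl_mult:
  assumes "a * d - b * c = 1" "a' * d' - b' * c' = 1"
  shows "psl a b c d * psl a' b' c' d' =
    psl (a * a' + b * c') (a * b' + b * d') (c * a' + d * c') (c * b' + d * d')"
proof -
  have "(vector [vector [a, b], vector [c, d]] :: real^2^2) **
    (vector [vector [a', b'], vector [c', d']] :: real^2^2)
    = vector [vector [a * a' + b * c', a * b' + b * d'], vector [c * a' + d * c', c * b' + d * d']]"
    by (simp add: vec_eq_iff forall_2 matrix_matrix_mult_def sum_2)
  then show ?thesis
    unfolding psl_def using assms by (simp add: times_psl2r_abs SL2R_vector_iff)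
qed

lemma psl_one: "1 = psl 1 0 0 1"
proof -
  have "(mat 1 :: real^2^2) = vector [vector [1, 0], vector [0, 1]]"
    by (simp add: vec_eq_iff forall_2 mat_def)
  then show ?thesis
    by (simp add: psl_def one_psl2r_def)
qed

lemma psl_inverse:
  assumes "a * d - b * c = 1"
  shows "psl d (- b) (- c) a * psl a b c d = 1" "psl a b c d * psl d (- b) (- c) a = 1"
  using assms by (simp_all add: psl_mult psl_one algebra_simps)

lemma psl2r_inverse:
  fixes g :: psl2r
  obtains h where "h * g = 1" "g * h = 1"
  using psl_cases[of g] psl_inverse by metis

lemma act_psl:
  assumes "a * d - b * c = 1"
  shows "act (psl a b c d) z = (of_real a * z + of_real b) / (of_real c * z + of_real d)"
  using assms by (simp add: psl_def act.abs_eq SL2R_vector_iff)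

lemma pole_psl:
  assumes "a * d - b * c = 1"
  shows "pole (psl a b c d) z \<longleftrightarrow> of_real c * z + of_real d = 0"
  using assms by (simp add: psl_def pole.abs_eq SL2R_vector_iff)

lemma act_Infty_psl:
  assumes "a * d - b * c = 1"
  shows "act_Infty (psl a b c d) = (if c = 0 then Infty else Pt (of_real (a / c)))"
  using assms by (simp add: psl_def act_Infty.abs_eq SL2R_vector_iff)

lemma linear_form_nz:
  assumes "a * d - b * c = 1" "Im z > 0"
  shows "of_real c * z + of_real d \<noteq> (0::complex)"
proof
  assume "of_real c * z + of_real d = (0::complex)"
  then have "c * Im z = 0" "c * Re z + d = 0"
    by (auto simp: complex_eq_iff)
  then show False
    using assms by auto
qed

lemma Im_act_psl:
  assumes "a * d - b * c = 1" "Im z > 0"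
  shows "Im (act (psl a b c d) z) = Im z / (cmod (of_real c * z + of_real d))\<^sup>2"
proof -
  have "Im (act (psl a b c d) z) = (a * d - b * c) * Im z / (cmod (of_real c * z + of_real d))\<^sup>2"
    unfolding act_psl[OF assms(1)] Im_divide cmod_power2
    by (simp add: algebra_simps)
  then show ?thesis
    using assms by simp
qed

lemma act_in_hplane [simp]: "z \<in> hplane \<Longrightarrow> act g z \<in> hplane"
  by (rule psl_cases[of g]) (auto simp: hplane_def Im_act_psl linear_form_nz)

lemma act_mult:
  assumes "z \<in> hplane"
  shows "act (g * h) z = act g (act h z)"
proof -
  obtain a b c d where g: "a * d - b * c = 1" "g = psl a b c d" by (rule psl_cases)
  obtain a' b' c' d' where h: "a' * d' - b' * c' = 1" "h = psl a' b' c' d'" by (rule psl_cases)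
  have det: "(a * a' + b * c') * (c * b' + d * d') - (a * b' + b * d') * (c * a' + d * c') = 1"
    using g(1) h(1) by algebra
  have nz: "of_real c' * z + of_real d' \<noteq> 0"
    "of_real (c * a' + d * c') * z + of_real (c * b' + d * d') \<noteq> 0"
    using linear_form_nz[OF h(1)] linear_form_nz[OF det] assms unfolding hplane_def by blast+
  have "of_real c * act h z + of_real d \<noteq> 0"
    using linear_form_nz[OF g(1), of "act h z"] act_in_hplane[OF assms] by (simp add: hplane_def)
  with nz show ?thesis
    unfolding g(2) h(2) psl_mult[OF g(1) h(1)] act_psl[OF g(1)] act_psl[OF h(1)] act_psl[OF det]
    by (simp add: divide_simps) (simp add: algebra_simps)
qed

lemma act_one [simp]: "act 1 z = z"
  by (simp add: psl_one act_psl)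

lemma act_eq_iff [simp]:
  assumes "z \<in> hplane" "w \<in> hplane"
  shows "act g z = act g w \<longleftrightarrow> z = w"
  by (metis psl2r_inverse act_mult act_one assms)

lemma act_inverse:
  assumes "h * g = 1" "z \<in> hplane"
  shows "act h (act g z) = z"
  using act_mult[OF assms(2), of h g] assms(1) by simp

lemma act_surj:
  assumes "w \<in> hplane"
  obtains z where "z \<in> hplane" "act g z = w"
  by (metis psl2r_inverse act_mult act_one act_in_hplane assms)

text \<open>
  A real Moebius map commutes with conjugation, so putting a conjugate point for \<open>z\<close> in this
  identity shows how \<open>w - cnj z\<close> changes under an isometry; the turning of geodesics depends on
  that quantity.
\<close>

lemma act_diff:
  assumes "a * d - b * c = 1" "of_real c * z + of_real d \<noteq> (0::complex)"
    "of_real c * w + of_real d \<noteq> (0::complex)"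
  shows "act (psl a b c d) w - act (psl a b c d) z =
    (w - z) / ((of_real c * w + of_real d) * (of_real c * z + of_real d))"
proof -
  have "complex_of_real a * of_real d - of_real b * of_real c = 1"
    using assms(1) by (metis of_real_diff of_real_mult of_real_1)
  then show ?thesis
    unfolding act_psl[OF assms(1)] using assms(2,3) by (simp add: divide_simps) algebra
qed

lemma cnj_act: "cnj (act g z) = act g (cnj z)"
  by (rule psl_cases[of g]) (simp add: act_psl)

lemma has_field_derivative_act:
  assumes "a * d - b * c = 1" "z \<in> hplane"
  shows "(act (psl a b c d) has_field_derivative 1 / (of_real c * z + of_real d)\<^sup>2) (at z)"
proof -
  have nz: "of_real c * z + of_real d \<noteq> (0::complex)"
    using linear_form_nz[OF assms(1)] assms(2) by (simp add: hplane_def)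
  have e: "complex_of_real a * of_real d - of_real b * of_real c = 1"
    using assms(1) by (metis of_real_diff of_real_mult of_real_1)
  have "act (psl a b c d) = (\<lambda>z. (of_real a * z + of_real b) / (of_real c * z + of_real d))"
    using act_psl[OF assms(1)] by auto
  moreover have "((\<lambda>z. (of_real a * z + of_real b) / (of_real c * z + of_real d)) has_field_derivative
      (of_real a * (of_real c * z + of_real d) - (of_real a * z + of_real b) * of_real c) /
        (of_real c * z + of_real d)\<^sup>2) (at z)"
    using nz by (auto intro!: derivative_eq_intros simp: power2_eq_square)
  moreover have "of_real a * (of_real c * z + of_real d) - (of_real a * z + of_real b) * of_real c
    = (1::complex)"
    using e by algebra
  ultimately show ?thesis
    by simp
qed

lemma deriv_act_psl:
  assumes "a * d - b * c = 1" "z \<in> hplane"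
  shows "deriv (act (psl a b c d)) z = 1 / (of_real c * z + of_real d)\<^sup>2"
  by (rule DERIV_imp_deriv[OF has_field_derivative_act[OF assms]])

lemma has_field_derivative_deriv_act:
  assumes "z \<in> hplane"
  shows "(act g has_field_derivative deriv (act g) z) (at z)"
  by (rule psl_cases[of g]) (use assms has_field_derivative_act deriv_act_psl in metis)

lemma deriv_act_nz:
  assumes "z \<in> hplane"
  shows "deriv (act g) z \<noteq> 0"
  by (rule psl_cases[of g]) (use assms linear_form_nz in \<open>auto simp: deriv_act_psl hplane_def\<close>)

lemma cmod_deriv_act:
  assumes "z \<in> hplane"
  shows "cmod (deriv (act g) z) = Im (act g z) / Im z"
  by (rule psl_cases[of g])
    (use assms in \<open>auto simp: deriv_act_psl Im_act_psl norm_divide norm_power hplane_def\<close>)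

lemma deriv_act_one [simp]: "deriv (act 1) z = 1"
proof -
  have "act 1 = (\<lambda>z. z)" by auto
  then show ?thesis by simp
qed

lemma deriv_act_mult:
  assumes "z \<in> hplane"
  shows "deriv (act (g * h)) z = deriv (act g) (act h z) * deriv (act h) z"
proof -
  have "((\<lambda>z. act g (act h z)) has_field_derivative deriv (act g) (act h z) * deriv (act h) z) (at z)"
    using DERIV_chain2 has_field_derivative_deriv_act act_in_hplane assms by blast
  then have "(act (g * h) has_field_derivative deriv (act g) (act h z) * deriv (act h) z) (at z)"
    by (rule has_field_derivative_transform_within_open[where S = hplane])
      (use assms in \<open>auto simp: act_mult hplane_def open_halfspace_Im_gt\<close>)
  then show ?thesis by (rule DERIV_imp_deriv)
qed

text \<open>
  The universal property of the quotient topology.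
\<close>

lemma continuous_on_psl2r:
  fixes f :: "psl2r \<Rightarrow> 'b::topological_space"
  assumes "continuous_on SL2R (\<lambda>A. f (abs_psl2r A))"
  shows "continuous_on UNIV f"
proof (subst continuous_on_open_vimage[OF open_UNIV], safe)
  fix B :: "'b set" assume "open B"
  then have "openin (top_of_set SL2R) (SL2R \<inter> (\<lambda>A. f (abs_psl2r A)) -` B)"
    using assms continuous_openin_preimage_gen by blast
  moreover have "SL2R \<inter> (\<lambda>A. f (abs_psl2r A)) -` B = {A \<in> SL2R. abs_psl2r A \<in> f -` B}"
    by auto
  ultimately show "open (f -` B \<inter> UNIV)"
    by (simp add: open_psl2r_def)
qed

lemma SL2R_psl:
  assumes "A \<in> SL2R"
  shows "A$1$1 * A$2$2 - A$1$2 * A$2$1 = 1" "abs_psl2r A = psl (A$1$1) (A$1$2) (A$2$1) (A$2$2)"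
proof -
  have "A = vector [vector [A$1$1, A$1$2], vector [A$2$1, A$2$2]]"
    by (simp add: vec_eq_iff forall_2)
  then show "abs_psl2r A = psl (A$1$1) (A$1$2) (A$2$1) (A$2$2)"
    by (simp add: psl_def)
qed (use assms in \<open>auto simp: SL2R_def det_2\<close>)

lemma continuous_on_act:
  assumes "z \<in> hplane"
  shows "continuous_on UNIV (\<lambda>g. act g z)"
proof (rule continuous_on_psl2r)
  have "continuous_on SL2R (\<lambda>A. (of_real (A$1$1) * z + of_real (A$1$2))
    / (of_real (A$2$1) * z + of_real (A$2$2)))"
    using linear_form_nz[OF SL2R_psl(1)] assms
    by (intro continuous_intros) (auto simp: hplane_def)
  then show "continuous_on SL2R (\<lambda>A. act (abs_psl2r A) z)"
    by (rule continuous_on_eq) (simp add: SL2R_psl act_psl)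
qed

lemma continuous_on_deriv_act:
  assumes "z \<in> hplane"
  shows "continuous_on UNIV (\<lambda>g. deriv (act g) z)"
proof (rule continuous_on_psl2r)
  have "continuous_on SL2R (\<lambda>A. 1 / (of_real (A$2$1) * z + of_real (A$2$2))\<^sup>2)"
    using linear_form_nz[OF SL2R_psl(1)] assms
    by (intro continuous_intros) (auto simp: hplane_def)
  then show "continuous_on SL2R (\<lambda>A. deriv (act (abs_psl2r A)) z)"
    by (rule continuous_on_eq) (simp add: SL2R_psl deriv_act_psl assms)
qed

section \<open>Turning of geodesics and its cyclic sums\<close>

text \<open>
  The Euclidean angle by which the direction of the geodesic from \<open>z\<close> to \<open>w\<close> turns: if the points
  are $m + R e^{i\varphi}$ and $m + R e^{i\psi}$ with \<open>m\<close> real, then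
  $w - \bar z = 2 i R \sin((\varphi+\psi)/2)\, e^{i(\psi-\varphi)/2}$, so that
  $\psi - \varphi$ is twice the argument of $(w - \bar z)/i$, a number with positive real part.
  The formula also covers vertical geodesics and \<open>z = w\<close>, where it gives \<open>0\<close>.
\<close>

definition turning :: "complex \<Rightarrow> complex \<Rightarrow> real" where
  "turning z w = 2 * arctan ((Re z - Re w) / (Im z + Im w))"

lemma turning_same [simp]: "turning z z = 0"
  by (simp add: turning_def)

lemma turning_swap: "turning w z = - turning z w"
proof -
  have "(Re w - Re z) / (Im w + Im z) = - ((Re z - Re w) / (Im z + Im w))"
    by (simp add: minus_divide_left add.commute)
  then show ?thesis
    by (simp only: turning_def arctan_minus)
qed

lemma hplane_cnj_diff_nz:
  assumes "z \<in> hplane" "w \<in> hplane"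
  shows "w - cnj z \<noteq> 0"
  using assms by (auto simp: hplane_def complex_eq_iff)

lemma cis_2_arctan: "cis (2 * arctan t) = (sgn (Complex 1 t))\<^sup>2"
proof -
  have "cis (arctan t) = sgn (Complex 1 t)"
    by (simp add: complex_eq_iff cos_arctan sin_arctan sgn_eq cmod_def)
  then show ?thesis
    by (metis Complex.DeMoivre of_nat_numeral)
qed

lemma cis_turning:
  assumes "z \<in> hplane" "w \<in> hplane"
  shows "cis (turning z w) = - (sgn (w - cnj z))\<^sup>2"
proof -
  have pos: "Im z + Im w > 0"
    using assms by (auto simp: hplane_def)
  have "w - cnj z = \<i> * of_real (Im z + Im w) * Complex 1 ((Re z - Re w) / (Im z + Im w))"
    using pos by (simp add: complex_eq_iff)
  then have
    "sgn (w - cnj z) = sgn \<i> * sgn (of_real (Im z + Im w)) * sgn (Complex 1 ((Re z - Re w) / (Im z + Im w)))"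
    by (simp only: sgn_mult)
  also have "sgn (of_real (Im z + Im w)) = (1 :: complex)"
    using pos by (simp only: sgn_of_real sgn_pos of_real_1)
  also have "sgn \<i> = \<i>"
    by (simp add: sgn_eq)
  finally have "sgn (w - cnj z) = \<i> * sgn (Complex 1 ((Re z - Re w) / (Im z + Im w)))"
    by simp
  then show ?thesis
    by (simp add: turning_def cis_2_arctan power_mult_distrib)
qed

lemma continuous_on_turning [continuous_intros]:
  assumes "continuous_on S f" "continuous_on S g" "\<And>x. x \<in> S \<Longrightarrow> f x \<in> hplane" "\<And>x. x \<in> S \<Longrightarrow> g x \<in> hplane"
  shows "continuous_on S (\<lambda>x. turning (f x) (g x))"
  unfolding turning_def
  by (intro continuous_intros assms(1,2)) (use assms(3,4) in \<open>fastforce simp: hplane_def\<close>)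

text \<open>
  The directions of the derivative at two points differ by the change of turning, because the isometry
  takes the geodesic from \<open>z\<close> to \<open>w\<close> to the one between the images. Algebraically: the derivative is
  $(cz+d)^{-2}$, and \<open>w - cnj z\<close> is divided by $(cw+d)\overline{(cz+d)}$.
\<close>

lemma sgn_deriv_act_turning:
  assumes z: "z \<in> hplane" and w: "w \<in> hplane"
  shows "sgn (deriv (act g) w) = sgn (deriv (act g) z) * cis (turning (act g z) (act g w) - turning z w)"
proof -
  obtain a b c d where g: "a * d - b * c = 1" "g = psl a b c d" by (rule psl_cases)
  define J where "J z = of_real c * z + of_real d" for z :: complex
  have nz: "J z \<noteq> 0" "J w \<noteq> 0" "J (cnj z) \<noteq> 0" "w - cnj z \<noteq> 0"
  proof -
    show "J z \<noteq> 0" "J w \<noteq> 0"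
      using linear_form_nz[OF g(1)] z w by (auto simp: J_def hplane_def)
    moreover have "J (cnj z) = cnj (J z)" by (simp add: J_def)
    ultimately show "J (cnj z) \<noteq> 0" by simp
  qed (rule hplane_cnj_diff_nz[OF z w])
  have "act g w - cnj (act g z) = (w - cnj z) / (J w * cnj (J z))"
    using act_diff[OF g(1), of "cnj z" w] nz unfolding cnj_act g(2) by (simp add: J_def)
  then have "cis (turning (act g z) (act g w)) = - (sgn (w - cnj z) / (sgn (J w) * cnj (sgn (J z))))\<^sup>2"
    using z w by (simp add: cis_turning sgn_divide sgn_mult) (simp add: sgn_eq)
  moreover have "cnj (sgn (J z)) = 1 / sgn (J z)"
  proof -
    have "sgn (J z) * cnj (sgn (J z)) = 1"
      using nz(1) complex_norm_square[of "sgn (J z)"] by (simp add: norm_sgn)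
    then show ?thesis
      by (metis mult_zero_left nonzero_mult_div_cancel_left zero_neq_one)
  qed
  ultimately have T: "cis (turning (act g z) (act g w)) = - (sgn (w - cnj z) * sgn (J z) / sgn (J w))\<^sup>2"
    by simp
  have D: "sgn (deriv (act g) v) = 1 / (sgn (J v))\<^sup>2" if "v \<in> hplane" for v
    using that by (simp add: g deriv_act_psl[OF g(1)] J_def sgn_divide power2_eq_square sgn_mult)
  have nz': "sgn (J z) \<noteq> 0" "sgn (J w) \<noteq> 0" "sgn (w - cnj z) \<noteq> 0"
    using nz by (simp_all add: sgn_zero_iff)
  show ?thesis
    unfolding cis_divide[symmetric] T D[OF z] D[OF w] cis_turning[OF z w]
    using nz' by (simp add: power_divide power_mult_distrib)
qed

text \<open>
  The total turning around a geodesic triangle, corners not included. By Gauss--Bonnet it is minus the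
  signed area.
\<close>

definition turning_sum :: "complex \<Rightarrow> complex \<Rightarrow> complex \<Rightarrow> real" where
  "turning_sum x y z = turning x y + turning y z + turning z x"

lemma turning_sum_rotate: "turning_sum y z x = turning_sum x y z"
  by (simp add: turning_sum_def)

lemma turning_sum_swap: "turning_sum x z y = - turning_sum x y z"
  by (simp add: turning_sum_def turning_swap[of y x] turning_swap[of z x] turning_swap[of z y])

lemma abs_less_pi_half_if_cos_pos:
  assumes "cos x > 0" "\<bar>x\<bar> < 3 * pi / 2"
  shows "\<bar>x\<bar> < pi / 2"
proof (rule ccontr)
  assume "\<not> ?thesis"
  then have "0 \<le> cos (pi - \<bar>x\<bar>)"
    using assms(2) by (intro cos_ge_zero) auto
  then show False
    using assms(1) by simp
qed

text \<open>
  Half the sum is a sum of three arc tangents, hence less than $3\pi/2$ in absolute value. Its cosine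
  is positive because $1 - pq - qr - rp$ is, where \<open>p\<close>, \<open>q\<close>, \<open>r\<close> are the tangents: their
  numerators add up to \<open>0\<close>, and this makes the expression, multiplied by the denominators, a positive
  term plus a sum of squares. The bound makes an equality modulo $2\pi$ an equality.
\<close>

lemma abs_turning_sum_less_pi:
  assumes "x \<in> hplane" "y \<in> hplane" "z \<in> hplane"
  shows "\<bar>turning_sum x y z\<bar> < pi"
proof -
  define P Q R where "P = Im x + Im y" and "Q = Im y + Im z" and "R = Im z + Im x"
  define p q r where "p = (Re x - Re y) / P" and "q = (Re y - Re z) / Q" and "r = (Re z - Re x) / R"
  have im: "Im x > 0" "Im y > 0" "Im z > 0"
    using assms by (auto simp: hplane_def)
  then have pos: "P > 0" "Q > 0" "R > 0"
    by (auto simp: P_def Q_def R_def)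
  define p' q' where "p' = Re x - Re y" and "q' = Re y - Re z"
  \<comment> \<open>The numerators of the tangents sum to \<open>0\<close>, so two of them, \<open>p'\<close> and \<open>q'\<close>, suffice.\<close>
  have "P * Q * R * (1 - p * q - q * r - r * p) = P * Q * R + Im y * (p' + q')\<^sup>2 + Im z * p'\<^sup>2 + Im x * q'\<^sup>2"
  proof -
    have e: "p * P = p'" "q * Q = q'" "r * R = - p' - q'"
      using pos by (auto simp: p_def q_def r_def p'_def q'_def)
    have "P * Q * R * (1 - p * q - q * r - r * p)
        = P * Q * R - (p * P) * (q * Q) * R - (q * Q) * (r * R) * P - (r * R) * (p * P) * Q"
      by algebra
    also have "\<dots> = P * Q * R + Im y * (p' + q')\<^sup>2 + Im z * p'\<^sup>2 + Im x * q'\<^sup>2"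
      unfolding e by (simp add: P_def Q_def R_def power2_eq_square algebra_simps)
    finally show ?thesis .
  qed
  also have "\<dots> > 0"
    using im pos by (intro add_pos_nonneg) auto
  finally have *: "1 - p * q - q * r - r * p > 0"
    by (rule zero_less_mult_pos) (use pos in simp)
  have sin: "sin (arctan t) = t * cos (arctan t)" for t
    by (simp add: sin_arctan cos_arctan)
  have "cos (arctan p + arctan q + arctan r)
      = cos (arctan p) * cos (arctan q) * cos (arctan r) * (1 - p * q - q * r - r * p)"
    unfolding cos_add sin_add sin by algebra
  also have "\<dots> > 0"
    using * by (intro mult_pos_pos) (auto simp: cos_arctan add_pos_nonneg)
  finally have "\<bar>arctan p + arctan q + arctan r\<bar> < pi / 2"
    by (rule abs_less_pi_half_if_cos_pos)
      (use arctan_bounded[of p] arctan_bounded[of q] arctan_bounded[of r] in linarith)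
  moreover have "turning_sum x y z = 2 * (arctan p + arctan q + arctan r)"
    by (simp add: turning_sum_def turning_def p_def q_def r_def P_def Q_def R_def)
  then have "\<bar>turning_sum x y z\<bar> = 2 * \<bar>arctan p + arctan q + arctan r\<bar>"
    by (simp only: abs_mult abs_numeral)
  ultimately show ?thesis
    by simp
qed

lemma cis_eq_imp_eq:
  assumes "cis a = cis b" "\<bar>a - b\<bar> < 2 * pi"
  shows "a = b"
proof -
  have "cis (a - b) = 1"
    using assms(1) by (simp flip: cis_divide)
  then have "cos (a - b) = 1"
    by (simp add: complex_eq_iff)
  then obtain n :: int where n: "a - b = n * (2 * pi)"
    by (auto simp: cos_one_2pi_int)
  then have "\<bar>real_of_int n\<bar> < 1"
    using assms(2) by (simp add: abs_mult)
  then have "n = 0"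
    by linarith
  then show ?thesis
    using n by simp
qed

text \<open>
  Modulo $2\pi$ the changes of the three turnings are the differences of the direction of the derivative
  at the vertices, which cancel around the triangle.
\<close>

lemma turning_sum_act:
  assumes "x \<in> hplane" "y \<in> hplane" "z \<in> hplane"
  shows "turning_sum (act g x) (act g y) (act g z) = turning_sum x y z"
proof (rule cis_eq_imp_eq)
  have nz: "sgn (deriv (act g) z) \<noteq> 0" if "z \<in> hplane" for z
    using deriv_act_nz[OF that] by (simp add: sgn_zero_iff)
  define T where "T u v = turning (act g u) (act g v) - turning u v" for u v
  have *: "cis (T u v) = sgn (deriv (act g) v) / sgn (deriv (act g) u)"
    if "u \<in> hplane" "v \<in> hplane" for u v
    using sgn_deriv_act_turning[OF that, of g] nz[OF that(1)] by (simp add: T_def)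
  have "cis (T x y + T y z + T z x) = 1"
    unfolding cis_mult[symmetric] using * nz assms by simp
  moreover have "turning_sum (act g x) (act g y) (act g z) = turning_sum x y z + (T x y + T y z + T z x)"
    by (simp add: turning_sum_def T_def)
  ultimately show "cis (turning_sum (act g x) (act g y) (act g z)) = cis (turning_sum x y z)"
    by (simp flip: cis_mult)
  show "\<bar>turning_sum (act g x) (act g y) (act g z) - turning_sum x y z\<bar> < 2 * pi"
    using abs_turning_sum_less_pi[OF assms] abs_turning_sum_less_pi[of "act g x" "act g y" "act g z"] assms
      by auto
qed

section \<open>Classification of geodesics\<close>

lemma hdist_nonneg:
  assumes "z \<in> hplane" "w \<in> hplane"
  shows "hdist z w \<ge> 0"
  using assms unfolding hdist_def hplane_def by (intro arcosh_nonneg_real) auto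

lemma cosh_hdist:
  assumes "z \<in> hplane" "w \<in> hplane"
  shows "cosh (hdist z w) = 1 + (cmod (z - w))\<^sup>2 / (2 * Im z * Im w)"
  using assms unfolding hdist_def hplane_def by (intro cosh_arcosh_real) auto

lemma hdist_eqI:
  assumes "1 + (cmod (z - w))\<^sup>2 / (2 * Im z * Im w) = cosh x"
  shows "hdist z w = \<bar>x\<bar>"
proof -
  have "hdist z w = arcosh (cosh \<bar>x\<bar>)"
    unfolding hdist_def assms by simp
  then show ?thesis
    by (simp only: arcosh_cosh_real abs_ge_zero)
qed

lemma hdist_act:
  assumes "z \<in> hplane" "w \<in> hplane"
  shows "hdist (act g z) (act g w) = hdist z w"
proof -
  obtain a b c d where g: "a * d - b * c = 1" "g = psl a b c d" by (rule psl_cases)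
  have nz: "of_real c * z + of_real d \<noteq> 0" "of_real c * w + of_real d \<noteq> 0" "Im z > 0" "Im w > 0"
    using linear_form_nz[OF g(1)] assms by (auto simp: hplane_def)
  have "act g z - act g w = (z - w) / ((of_real c * z + of_real d) * (of_real c * w + of_real d))"
    unfolding g(2) by (rule act_diff[OF g(1) nz(2,1)])
  then have "(cmod (act g z - act g w))\<^sup>2 / (2 * Im (act g z) * Im (act g w)) =
      (cmod (z - w))\<^sup>2 / (2 * Im z * Im w)"
    unfolding g(2) using nz Im_act_psl[OF g(1)]
    by (simp add: norm_divide norm_mult power_divide power_mult_distrib)
  then show ?thesis
    by (simp add: hdist_def)
qed

text \<open>
  The image of the upward unit speed geodesic through \<open>\<i>\<close>. All complete geodesics are of this form
  (\<open>geodesic_line_iff\<close>), so statements about geodesics become statements about matrices.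
\<close>

definition gline :: "psl2r \<Rightarrow> real \<Rightarrow> complex" where
  "gline g s = act g (Complex 0 (exp s))"

lemma Complex_0_in_hplane [simp]: "Complex 0 a \<in> hplane \<longleftrightarrow> a > 0"
  by (simp add: hplane_def)

lemma gline_in_hplane [simp]: "gline g s \<in> hplane"
  by (simp add: gline_def)

lemma gline_mult: "gline (g * h) s = act g (gline h s)"
  by (simp add: gline_def act_mult)

lemma cosh_diff_exp: "cosh (s - t) = (exp s * exp s + exp t * exp t) / (2 * exp s * exp t)" for s t :: real
  by (simp add: cosh_def exp_diff exp_minus field_simps)

lemma hdist_gline: "hdist (gline g s) (gline g t) = \<bar>s - t\<bar>"
proof -
  have "hdist (Complex 0 (exp s)) (Complex 0 (exp t)) = \<bar>s - t\<bar>"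
    by (rule hdist_eqI)
      (simp_all add: cosh_diff_exp cmod_power2 del: of_real_exp, simp add: field_simps power2_eq_square)
  then show ?thesis
    by (simp add: gline_def hdist_act)
qed

lemma geodesic_line_gline: "geodesic_line (gline g)"
  by (auto simp: geodesic_line_def hdist_gline)

lemma moebius_from_i:
  assumes "y \<in> hplane"
  obtains g where "act g \<i> = y"
proof -
  define r where "r = sqrt (Im y)"
  have r: "r > 0" "r * r = Im y"
    using assms by (auto simp: r_def hplane_def)
  have "act (psl r (Re y / r) 0 (1 / r)) \<i> = y"
    using r by (subst act_psl) (auto simp: complex_eq_iff)
  then show ?thesis by (rule that)
qed

text \<open>
  Rotating about \<open>\<i>\<close> by a half turn negates a suitable multiple of the real part, so some rotation
  in between makes it vanish.
\<close>

lemma moebius_to_imaginary_axis: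
  assumes "z \<in> hplane"
  obtains g k where "act g \<i> = \<i>" "act g z = Complex 0 k" "k > 0"
proof -
  \<comment> \<open>The numerator of the real part of the image of \<open>z\<close> under the rotation with parameter \<open>t\<close>.\<close>
  define f where "f t = cos t * sin t * (1 - (cmod z)\<^sup>2) + ((cos t)\<^sup>2 - (sin t)\<^sup>2) * Re z" for t
  have cont: "continuous_on {0..pi/2} f"
    unfolding f_def by (intro continuous_intros)
  have ends: "f 0 = Re z" "f (pi/2) = - Re z"
    by (auto simp: f_def)
  have "\<exists>t. 0 \<le> t \<and> t \<le> pi/2 \<and> f t = 0"
  proof (cases "Re z \<le> 0")
    case True
    then show ?thesis by (intro IVT'[OF _ _ _ cont]) (auto simp: ends)
  next
    case False
    then show ?thesis by (intro IVT2'[OF _ _ _ cont]) (auto simp: ends)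
  qed
  then obtain t where t: "f t = 0" by blast
  define g where "g = psl (cos t) (sin t) (- sin t) (cos t)"
  have det: "cos t * cos t - sin t * (- sin t) = 1"
    using sin_cos_squared_add[of t] by (simp add: power2_eq_square)
  have "act g \<i> = \<i>"
    unfolding g_def act_psl[OF det]
    using linear_form_nz[OF det, of \<i>]
    by (simp add: divide_eq_eq) (simp add: algebra_simps)
  moreover have "Re (act g z) = 0"
  proof -
    have "(cos t * Re z + sin t) * (cos t - sin t * Re z) - cos t * Im z * (sin t * Im z) = f t"
      unfolding f_def cmod_power2 by algebra
    then show ?thesis
      unfolding g_def act_psl[OF det] Re_divide using t by simp
  qed
  then have "act g z = Complex 0 (Im (act g z))"
    by (simp add: complex_eq_iff)
  moreover have "Im (act g z) > 0"
    using act_in_hplane[OF assms, of g] by (simp add: hplane_def)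
  ultimately show ?thesis
    by (rule that)
qed

lemma act_inversion: "act (psl 0 (- 1) 1 0) z = - 1 / z"
  by (subst act_psl) auto

lemma gline_through:
  assumes y: "y \<in> hplane" and z: "z \<in> hplane"
  obtains g where "gline g 0 = y" "gline g (hdist y z) = z"
proof -
  obtain g1 where g1: "act g1 \<i> = y"
    using moebius_from_i[OF y] .
  obtain z1 where z1: "z1 \<in> hplane" "act g1 z1 = z"
    using act_surj[OF z] .
  obtain g2 k where g2: "act g2 \<i> = \<i>" "act g2 z1 = Complex 0 k" "k > 0"
    using moebius_to_imaginary_axis[OF z1(1)] .
  have i: "\<i> = Complex 0 1" "\<i> \<in> hplane"
    by (auto simp: complex_eq_iff hplane_def)
  have "\<exists>g3. act g3 \<i> = \<i> \<and> (\<exists>l\<ge>0. act g3 z1 = Complex 0 (exp l))"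
  proof (cases "k \<ge> 1")
    case True
    then show ?thesis
      using g2 by (intro exI[of _ g2] conjI exI[of _ "ln k"]) auto
  next
    case False
    have "act (psl 0 (- 1) 1 0 * g2) \<i> = \<i>"
      using i by (simp add: act_mult g2 act_inversion)
    moreover have "act (psl 0 (- 1) 1 0 * g2) z1 = Complex 0 (exp (- ln k))"
      using z1 g2(3)
        by (simp add: act_mult g2 act_inversion complex_eq_iff exp_minus Re_divide Im_divide
          power2_eq_square field_simps)
    moreover have "- ln k \<ge> 0"
      using False g2(3) by simp
    ultimately show ?thesis by blast
  qed
  then obtain g3 l where g3: "act g3 \<i> = \<i>" "l \<ge> 0" "act g3 z1 = Complex 0 (exp l)"
    by blast
  obtain h where h: "h * g3 = 1" "g3 * h = 1"
    by (rule psl2r_inverse)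
  note inv = act_inverse[OF h(1)]
  have 0: "gline (g1 * h) 0 = y"
    using inv[OF i(2)] g1 i by (simp add: gline_mult) (simp add: gline_def g3)
  moreover have l: "gline (g1 * h) l = z"
    using inv[OF z1(1)] z1(2) by (simp add: gline_mult) (simp add: gline_def g3)
  moreover have "hdist y z = l"
    using hdist_gline[of "g1 * h" 0 l] g3(2) 0 l by simp
  ultimately show ?thesis
    using that by blast
qed

text \<open>
  Two distances determine a point already when the reference points and the candidate lie on one
  geodesic. On the imaginary axis each distance condition is linear in $x^2+y^2$ and $y$, and the two
  conditions are independent.
\<close>

lemma hplane_point_determined:
  assumes "w \<in> hplane" "L \<noteq> 0" "hdist (gline g 0) w = \<bar>s\<bar>" "hdist (gline g L) w = \<bar>L - s\<bar>"
  shows "w = gline g s"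
proof -
  obtain v where v: "v \<in> hplane" "act g v = w"
    using act_surj[OF assms(1)] .
  define x y where "x = Re v" and "y = Im v"
  have y: "y > 0"
    using v(1) by (simp add: y_def hplane_def)
  have *: "x * x + y * y + e * e = 2 * e * y * cosh (r - s)"
    if "hdist (gline g r) w = \<bar>r - s\<bar>" "e = exp r" for r e
  proof -
    have e: "e > 0"
      using that(2) by simp
    have "hdist (Complex 0 e) v = \<bar>r - s\<bar>"
      using that v(1) e by (simp add: gline_def hdist_act flip: v(2))
    then have "cosh (r - s) = 1 + (x\<^sup>2 + (e - y)\<^sup>2) / (2 * e * y)"
      using cosh_hdist[of "Complex 0 e" v] v(1) e by (simp add: cmod_power2 x_def y_def)
    then have "2 * e * y * cosh (r - s) = 2 * e * y + (x\<^sup>2 + (e - y)\<^sup>2)"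
      using e y by (simp add: field_simps)
    then show ?thesis
      by (simp add: power2_eq_square algebra_simps)
  qed
  define E S where "E = exp L" and "S = exp s"
  have S: "S > 0" by (simp add: S_def)
  have 0: "x * x + y * y + 1 = y * (S + 1 / S)"
    using *[of 0 1] assms(3) by (simp add: cosh_def exp_minus S_def inverse_eq_divide algebra_simps)
  have "E * y * cosh (L - s) * 2 = y * (E * E / S + S)"
    using S by (simp add: cosh_diff_exp flip: E_def S_def) (simp add: E_def field_simps)
  then have L: "x * x + y * y + E * E = y * (E * E / S + S)"
    using *[of L E] assms(4) by (simp add: E_def mult_ac)
  have "E * E - 1 = y * ((E * E / S + S) - (S + 1 / S))"
    using 0 L by (simp only: right_diff_distrib)
  also have "(E * E / S + S) - (S + 1 / S) = (E * E - 1) / S"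
    by (simp add: diff_divide_distrib)
  finally have "(E * E - 1) * S = y * (E * E - 1)"
    using S by (simp add: field_simps)
  moreover have "E * E \<noteq> 1"
    using assms(2) unfolding E_def by (simp flip: exp_add)
  ultimately have Im: "y = S"
    by simp
  then have "x * x = 0"
    using 0 S by (simp add: distrib_left)
  then have "v = Complex 0 (exp s)"
    using Im by (simp add: complex_eq_iff x_def y_def S_def)
  then show ?thesis
    using v(2) by (simp add: gline_def)
qed

lemma geodesic_line_iff: "geodesic_line \<gamma> \<longleftrightarrow> (\<exists>g. \<gamma> = gline g)"
proof
  assume \<gamma>: "geodesic_line \<gamma>"
  then have H: "\<gamma> s \<in> hplane" and d: "hdist (\<gamma> s) (\<gamma> t) = \<bar>s - t\<bar>" for s t
    by (auto simp: geodesic_line_def)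
  obtain g where g: "gline g 0 = \<gamma> 0" "gline g 1 = \<gamma> 1"
    using gline_through[OF H H, of 0 1] d[of 0 1] by auto
  have "\<gamma> s = gline g s" for s
    by (rule hplane_point_determined[OF H, of 1]) (simp_all add: g d)
  then show "\<exists>g. \<gamma> = gline g" by blast
qed (auto simp: geodesic_line_gline)

lemma geodesic_seg_iff:
  assumes "y \<in> hplane" "z \<in> hplane"
  shows "geodesic_seg y z c \<longleftrightarrow> (\<exists>g. gline g 0 = y \<and> gline g (hdist y z) = z \<and>
    (\<forall>t\<in>{0..1}. c t = gline g (t * hdist y z)))"
proof
  assume c: "geodesic_seg y z c"
  then have H: "c t \<in> hplane" if "t \<in> {0..1}" for t
    using that by (auto simp: geodesic_seg_def)
  have d: "hdist (c s) (c t) = \<bar>s - t\<bar> * hdist y z" if "s \<in> {0..1}" "t \<in> {0..1}" for s t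
    using that c by (auto simp: geodesic_seg_def)
  have e: "c 0 = y" "c 1 = z"
    using c by (auto simp: geodesic_seg_def)
  obtain g where g: "gline g 0 = y" "gline g (hdist y z) = z"
    using gline_through[OF assms] .
  have "c t = gline g (t * hdist y z)" if t: "t \<in> {0..1}" for t
  proof (cases "hdist y z = 0")
    case True
    then have "hdist (c 0) (c t) = 0"
      using d[of 0 t] t by simp
    then have "cmod (c 0 - c t) = 0"
      using cosh_hdist[OF H H, of 0 t] H[OF t] assms(1) t e by (auto simp: hplane_def)
    then show ?thesis
      using True g e by simp
  next
    case False
    show ?thesis
    proof (rule hplane_point_determined[OF H[OF t] False])
      show "hdist (gline g 0) (c t) = \<bar>t * hdist y z\<bar>"
        using d[of 0 t] t hdist_nonneg[OF assms] by (simp add: g e)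
      have "hdist (c 1) (c t) = \<bar>1 - t\<bar> * \<bar>hdist y z\<bar>"
        using d[of 1 t] t hdist_nonneg[OF assms] by simp
      then show "hdist (gline g (hdist y z)) (c t) = \<bar>hdist y z - t * hdist y z\<bar>"
        unfolding g e by (simp add: algebra_simps flip: abs_mult)
    qed
  qed
  then show "\<exists>g. gline g 0 = y \<and> gline g (hdist y z) = z \<and>
    (\<forall>t\<in>{0..1}. c t = gline g (t * hdist y z))"
    using g by blast
next
  assume "\<exists>g. gline g 0 = y \<and> gline g (hdist y z) = z \<and>
    (\<forall>t\<in>{0..1}. c t = gline g (t * hdist y z))"
  then show "geodesic_seg y z c"
    using hdist_nonneg[OF assms]
    by (auto simp: geodesic_seg_def hdist_gline simp flip: abs_mult left_diff_distrib)
      (simp add: abs_mult)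
qed

section \<open>Angle changes along paths of nonzero complex numbers\<close>

text \<open>
  The real part of the winding number measures the change of the argument also along paths that are
  not closed, and its homotopy invariance is known.
\<close>

definition angle_change :: "(real \<Rightarrow> complex) \<Rightarrow> real" where
  "angle_change f = 2 * pi * Re (winding_number f 0)"

lemma angle_changeI:
  assumes f: "path f" "\<And>t. t \<in> {0..1} \<Longrightarrow> f t \<noteq> 0"
    and \<theta>: "continuous_on {0..1} \<theta>" "\<And>t. t \<in> {0..1} \<Longrightarrow> sgn (f t) = cis (\<theta> t)"
  shows "angle_change f = \<theta> 1 - \<theta> 0"
proof -
  define q where "q t = Complex (ln (cmod (f t))) (\<theta> t)" for t
  have q: "path q"
    unfolding path_def q_def Complex_eq
    using f \<theta>(1) by (intro continuous_intros) (auto simp: path_def)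
  have eq: "f t = (exp \<circ> q) t" if "t \<in> {0..1}" for t
  proof -
    have "f t = of_real (cmod (f t)) * cis (\<theta> t)"
      using f(2)[OF that] by (simp add: sgn_eq flip: \<theta>(2)[OF that])
    then show ?thesis
      using f(2)[OF that] by (simp add: q_def exp_eq_polar)
  qed
  have "homotopic_paths (- {0}) f (exp \<circ> q)"
    by (rule homotopic_paths_eq) (use f eq in \<open>auto simp: path_image_def\<close>)
  then have "winding_number f 0 = (pathfinish q - pathstart q) / (2 * of_real pi * \<i>)"
    using winding_number_homotopic_paths winding_number_compose_exp[OF q] by metis
  then show ?thesis
    by (simp add: angle_change_def q_def pathfinish_def pathstart_def Re_divide power2_eq_square)
qed

lemma angle_lift:
  assumes "path f" "\<And>t. t \<in> {0..1} \<Longrightarrow> f t \<noteq> 0"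
  obtains \<theta> where "continuous_on {0..1} \<theta>" "\<And>t. t \<in> {0..1} \<Longrightarrow> sgn (f t) = cis (\<theta> t)"
proof -
  obtain q where q: "continuous_on {0..1} q" "\<And>t. t \<in> {0..1} \<Longrightarrow> f t = exp (q t)"
    using continuous_logarithm_on_contractible[of "{0..1}" f, OF _ convex_imp_contractible] assms
    unfolding path_def by (metis convex_real_interval(5))
  show ?thesis
  proof (rule that)
    show "continuous_on {0..1} (\<lambda>t. Im (q t))"
      using q(1) by (intro continuous_intros)
    show "sgn (f t) = cis (Im (q t))" if "t \<in> {0..1}" for t
      using q(2)[OF that] by (simp add: sgn_eq exp_eq_polar norm_mult)
  qed
qed

lemma angle_change_homotopic:
  assumes "homotopic_paths (- {0}) f f'"
  shows "angle_change f = angle_change f'"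
  using winding_number_homotopic_paths[OF assms] by (simp add: angle_change_def)

section \<open>The rotation of a tangent vector under a path of isometries\<close>

lemma represents_rep: "represents (rep_upsl2r a) a"
  using Quotient_rep_reflp[OF Quotient_upsl2r, of a] Quotient_abs_rep[OF Quotient_upsl2r, of a]
  by (auto simp: represents_def)

lemma represents_refl:
  assumes "represents g a"
  shows "path g \<and> pathstart g = 1 \<and> homotopic_paths UNIV g g"
  using assms by (auto simp: represents_def homotopic_paths_refl)

lemma represents_homotopic:
  assumes "represents g a" "represents g' a"
  shows "homotopic_paths UNIV g g'"
  using Quotient_rel[OF Quotient_upsl2r, of g g'] represents_refl[OF assms(1)] represents_refl[OF assms(2)]
    assms
  by (auto simp: represents_def)

lemma represents_path: "represents g a \<Longrightarrow> path g"
  by (simp add: represents_def)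

lemma represents_0: "represents g a \<Longrightarrow> g 0 = 1"
  by (simp add: represents_def pathstart_def)

lemma represents_1: "represents g a \<Longrightarrow> g 1 = proj a"
  using proj.abs_eq[OF represents_refl] by (auto simp: represents_def pathfinish_def)

lemma represents_mult:
  assumes "represents g a" "represents h b"
  shows "represents (\<lambda>t. g t * h t) (a * b)"
  using times_upsl2r.abs_eq[OF represents_refl[OF assms(1)] represents_refl[OF assms(2)]] assms
  by (auto simp: represents_def path_def pathstart_def intro!: continuous_on_mult')

lemma proj_mult: "proj (a * b) = proj a * proj b"
  using represents_1[OF represents_mult[OF represents_rep[of a] represents_rep[of b]]]
    represents_1[OF represents_rep[of a]] represents_1[OF represents_rep[of b]] by simp

lemma path_act:
  assumes "path g" "y \<in> hplane"
  shows "path (\<lambda>t. act (g t) y)" "path (\<lambda>t. deriv (act (g t)) y)"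
  using continuous_on_compose2[OF continuous_on_act[OF assms(2)], of "{0..1}" g]
    continuous_on_compose2[OF continuous_on_deriv_act[OF assms(2)], of "{0..1}" g] assms(1)
  by (auto simp: path_def)

text \<open>
  The choice of the representing path does not matter, by \<open>rotation_eq\<close>.
\<close>

definition rotation :: "upsl2r \<Rightarrow> complex \<Rightarrow> real" where
  "rotation a y = angle_change (\<lambda>t. deriv (act (rep_upsl2r a t)) y)"

lemma rotation_eq:
  assumes "represents g a" "y \<in> hplane"
  shows "rotation a y = angle_change (\<lambda>t. deriv (act (g t)) y)"
proof -
  have "homotopic_paths (- {0}) ((\<lambda>g. deriv (act g) y) \<circ> rep_upsl2r a) ((\<lambda>g. deriv (act g) y) \<circ> g)"
    by (rule homotopic_paths_continuous_image
        [OF represents_homotopic[OF represents_rep assms(1)] continuous_on_deriv_act])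
      (use assms deriv_act_nz in auto)
  then show ?thesis
    unfolding rotation_def by (auto dest: angle_change_homotopic simp: o_def)
qed

lemma rotation_lift:
  assumes "represents g a" "y \<in> hplane"
  obtains \<theta> where "continuous_on {0..1} \<theta>" "\<And>t. t \<in> {0..1} \<Longrightarrow> sgn (deriv (act (g t)) y) = cis (\<theta> t)"
    "rotation a y = \<theta> 1 - \<theta> 0"
proof -
  have p: "path (\<lambda>t. deriv (act (g t)) y)"
    using path_act(2) represents_path assms by blast
  obtain \<theta> where \<theta>: "continuous_on {0..1} \<theta>" "\<And>t. t \<in> {0..1} \<Longrightarrow> sgn (deriv (act (g t)) y) = cis (\<theta> t)"
    using angle_lift[OF p deriv_act_nz[OF assms(2)]] by blast
  then show ?thesis
    using that angle_changeI[OF p deriv_act_nz[OF assms(2)]] rotation_eq[OF assms] by metis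
qed

text \<open>
  By the chain rule the derivative of $g_t h_t$ at \<open>y\<close> is the product of the derivatives of $g_t$ at
  $h_t y$ and of $h_t$ at \<open>y\<close>. The first factor is taken at a moving point; comparing it with the
  derivative at the fixed endpoint $h_1 y$ introduces a turning term that vanishes at both ends.
\<close>

lemma rotation_mult:
  assumes y: "y \<in> hplane"
  shows "rotation (b * a) y = rotation b (act (proj a) y) + rotation a y"
proof -
  define g h where "g = rep_upsl2r b" and "h = rep_upsl2r a"
  have g: "represents g b" and h: "represents h a"
    by (simp_all add: g_def h_def represents_rep)
  define z where "z = act (proj a) y"
  have z: "z \<in> hplane"
    using y by (simp add: z_def)
  obtain \<phi> where \<phi>: "continuous_on {0..1} \<phi>" "\<And>t. t \<in> {0..1} \<Longrightarrow> sgn (deriv (act (g t)) z) = cis (\<phi> t)"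
    "rotation b z = \<phi> 1 - \<phi> 0"
    using rotation_lift[OF g z] by blast
  obtain \<psi> where \<psi>: "continuous_on {0..1} \<psi>" "\<And>t. t \<in> {0..1} \<Longrightarrow> sgn (deriv (act (h t)) y) = cis (\<psi> t)"
    "rotation a y = \<psi> 1 - \<psi> 0"
    using rotation_lift[OF h y] by blast
  note gh = represents_mult[OF g h]
  define \<theta> where "\<theta> t = \<phi> t + (turning (act (g t) z) (act (g t * h t) y) - turning z (act (h t) y)) + \<psi> t"
    for t
  have "rotation (b * a) y = angle_change (\<lambda>t. deriv (act (g t * h t)) y)"
    by (rule rotation_eq[OF gh y])
  also have "\<dots> = \<theta> 1 - \<theta> 0"
  proof (rule angle_changeI)
    show "path (\<lambda>t. deriv (act (g t * h t)) y)"
      by (rule path_act(2)[OF represents_path[OF gh] y])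
    show "deriv (act (g t * h t)) y \<noteq> 0" for t
      by (rule deriv_act_nz[OF y])
    show "continuous_on {0..1} \<theta>"
      unfolding \<theta>_def using y z
        path_act(1)[OF represents_path[OF gh] y] path_act(1)[OF represents_path[OF h] y]
        path_act(1)[OF represents_path[OF g] z]
      by (intro continuous_intros \<phi>(1) \<psi>(1)) (auto simp: path_def)
    show "sgn (deriv (act (g t * h t)) y) = cis (\<theta> t)" if "t \<in> {0..1}" for t
      using sgn_deriv_act_turning[OF z, of "act (h t) y" "g t"] y \<phi>(2)[OF that] \<psi>(2)[OF that]
      by (simp add: deriv_act_mult sgn_mult act_mult \<theta>_def cis_mult)
  qed
  also have "\<dots> = rotation b z + rotation a y"
    using y by (simp add: \<theta>_def \<phi>(3) \<psi>(3) represents_0[OF g] represents_0[OF h]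
      represents_1[OF g] represents_1[OF h] act_mult flip: z_def)
  finally show ?thesis
    by (simp add: z_def)
qed

text \<open>
  For each \<open>t\<close> the directions of the derivative at \<open>z\<close> and \<open>w\<close> differ by a change of turning. It depends
  continuously on \<open>t\<close> and is \<open>0\<close> at the start, so it is the difference of the lifted angles too.
\<close>

lemma rotation_diff:
  assumes z: "z \<in> hplane" and w: "w \<in> hplane"
  shows "rotation a w = rotation a z + turning (act (proj a) z) (act (proj a) w) - turning z w"
proof -
  define g where "g = rep_upsl2r a"
  have g: "represents g a"
    by (simp add: g_def represents_rep)
  obtain \<phi> where \<phi>: "continuous_on {0..1} \<phi>" "\<And>t. t \<in> {0..1} \<Longrightarrow> sgn (deriv (act (g t)) z) = cis (\<phi> t)"
    "rotation a z = \<phi> 1 - \<phi> 0"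
    using rotation_lift[OF g z] by blast
  define \<theta> where "\<theta> t = \<phi> t + (turning (act (g t) z) (act (g t) w) - turning z w)" for t
  have "rotation a w = angle_change (\<lambda>t. deriv (act (g t)) w)"
    by (rule rotation_eq[OF g w])
  also have "\<dots> = \<theta> 1 - \<theta> 0"
  proof (rule angle_changeI)
    show "path (\<lambda>t. deriv (act (g t)) w)"
      by (rule path_act(2)[OF represents_path[OF g] w])
    show "deriv (act (g t)) w \<noteq> 0" for t
      by (rule deriv_act_nz[OF w])
    show "continuous_on {0..1} \<theta>"
      unfolding \<theta>_def using z w
        path_act(1)[OF represents_path[OF g] w] path_act(1)[OF represents_path[OF g] z]
      by (intro continuous_intros \<phi>(1)) (auto simp: path_def)
    show "sgn (deriv (act (g t)) w) = cis (\<theta> t)" if "t \<in> {0..1}" for t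
      using sgn_deriv_act_turning[OF z w, of "g t"] \<phi>(2)[OF that]
      by (simp add: \<theta>_def cis_mult)
  qed
  also have "\<dots> = rotation a z + turning (act (proj a) z) (act (proj a) w) - turning z w"
    by (simp add: \<theta>_def \<phi>(3) represents_0[OF g] represents_1[OF g])
  finally show ?thesis .
qed

section \<open>The twist at a point of the plane\<close>

text \<open>
  The velocity of the image of the imaginary axis is the vertical velocity multiplied by the derivative,
  whose direction changes by the turning.
\<close>

lemma unit_velocity_gline:
  assumes t: "t \<in> {0..1}" and L: "L > 0" and c: "\<And>t. t \<in> {0..1} \<Longrightarrow> c t = gline g (t * L)"
  shows "unit_velocity c t = of_real (Im (c t)) * (\<i> * sgn (deriv (act g) \<i>)) * cis (turning (c 0) (c t))"
proof -
  define w where "w = Complex 0 (exp (t * L))"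
  have H: "w \<in> hplane" "\<i> \<in> hplane"
    by (simp_all add: w_def hplane_def)
  have i: "\<i> = Complex 0 1"
    by (simp add: complex_eq_iff)
  have "((\<lambda>t. Complex 0 (exp (t * L))) has_vector_derivative Complex 0 (exp (t * L) * L))
    (at t within {0..1})"
    unfolding Complex_eq by (auto intro!: derivative_eq_intros)
  then have
    "((\<lambda>t. gline g (t * L)) has_vector_derivative Complex 0 (exp (t * L) * L) * deriv (act g) w)
      (at t within {0..1})"
    unfolding gline_def
    using field_vector_diff_chain_within[of "\<lambda>t. Complex 0 (exp (t * L))" _ t "{0..1}" "act g" "deriv
      (act g) w"]
      has_field_derivative_at_within[OF has_field_derivative_deriv_act[OF H(1), of g]]
    by (simp add: o_def w_def)
  then have "(c has_vector_derivative Complex 0 (exp (t * L) * L) * deriv (act g) w) (at t within {0..1})"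
    using c t by (auto intro: has_vector_derivative_transform[where f = "\<lambda>t. gline g (t * L)"])
  then have v: "vector_derivative c (at t within {0..1}) = of_real (exp (t * L) * L) * \<i> * deriv (act g) w"
    using vector_derivative_within_cbox[of 0 1 t c] t by (simp add: complex_eq_iff)
  have "sgn (of_real (exp (t * L) * L) :: complex) = 1"
    using L by (simp only: sgn_of_real) (simp add: sgn_mult)
  then have "unit_velocity c t = of_real (Im (c t)) * (\<i> * sgn (deriv (act g) w))"
    unfolding unit_velocity_def v Let_def
    by (simp add: sgn_eq norm_mult)
  also have "sgn (deriv (act g) w) = sgn (deriv (act g) \<i>) * cis (turning (act g \<i>) (act g w) - turning \<i> w)"
    by (rule sgn_deriv_act_turning[OF H(2,1)])
  also have "turning \<i> w = 0"
    by (simp add: turning_def w_def)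
  also have "act g \<i> = c 0"
    using c[of 0] by (simp add: gline_def i)
  also have "act g w = c t"
    using c[OF t] by (simp add: gline_def w_def)
  finally show ?thesis
    by (simp add: mult_ac)
qed

abbreviation is_reference where
  "is_reference y z c e \<equiv> (if z = y then \<exists>w. (y, w) \<in> UT \<and> (\<forall>t\<in>{0..1}. e t = w) else \<forall>t\<in>{0..1}. e t
    = unit_velocity c t)"

text \<open>
  Both kinds of reference vector, the velocity and a constant vector, have the same form, so that the
  constant geodesic is no special case below.
\<close>

lemma reference_field:
  assumes y: "y \<in> hplane" and z: "z \<in> hplane" and c: "geodesic_seg y z c"
    and e: "is_reference y z c e"
  obtains \<kappa> where "\<And>t. t \<in> {0..1} \<Longrightarrow> e t = of_real (Im (c t)) * cis (\<kappa> + turning y (c t))"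
proof -
  obtain g where g: "gline g 0 = y" "gline g (hdist y z) = z"
    and cg: "\<And>t. t\<in>{0..1} \<Longrightarrow> c t = gline g (t * hdist y z)"
    using c unfolding geodesic_seg_iff[OF y z] by blast
  have "\<exists>u. cmod u = 1 \<and> (\<forall>t\<in>{0..1}. e t = of_real (Im (c t)) * u * cis (turning y (c t)))"
  proof (cases "z = y")
    case True
    then obtain w where w: "(y, w) \<in> UT" "\<forall>t\<in>{0..1}. e t = w"
      using e by auto
    have "hdist y y = 0"
      using y by (simp add: hdist_def)
    then have "c t = y" if "t \<in> {0..1}" for t
      using cg[OF that] g(1) True by simp
    then show ?thesis
      using w y by (intro exI[of _ "w / of_real (Im y)"]) (auto simp: UT_def hplane_def norm_divide)
  next
    case False
    then have L: "hdist y z > 0"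
      using g hdist_nonneg[OF y z] by (metis order_le_less)
    have "deriv (act g) \<i> \<noteq> 0"
      by (rule deriv_act_nz) (simp add: hplane_def)
    then show ?thesis
      using unit_velocity_gline[OF _ L cg] False e cg[of 0] g(1)
      by (intro exI[of _ "\<i> * sgn (deriv (act g) \<i>)"]) (auto simp: norm_mult norm_sgn)
  qed
  then obtain u where u: "cmod u = 1" "\<And>t. t\<in>{0..1} \<Longrightarrow> e t = of_real (Im (c t)) * u * cis (turning y (c t))"
    by blast
  have "u = cis (Arg u)"
    using u(1) by (metis cis_Arg norm_zero sgn_eq zero_neq_one div_by_1 of_real_1)
  then have "e t = of_real (Im (c t)) * cis (Arg u + turning y (c t))" if "t \<in> {0..1}" for t
    using u(2)[OF that] by (simp add: mult.assoc flip: cis_mult)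
  then show ?thesis
    by (rule that)
qed

text \<open>
  The angle of $\mathcal V$ against the reference field differs from its Euclidean angle by the turning of
  the geodesic. Projection to the vector component makes the Euclidean angle change of $\mathcal V$
  that of $Dg_t(u)$.
\<close>

lemma is_twist_imp_eq:
  assumes y: "y \<in> hplane" and tw: "is_twist a y r"
  shows "r = rotation a y - turning y (act (proj a) y)"
proof -
  define z where "z = act (proj a) y"
  have z: "z \<in> hplane"
    using y by (simp add: z_def)
  obtain g c u V e \<theta> where g: "represents g a" and c: "geodesic_seg y z c" and u: "(y, u) \<in> UT"
    and V: "\<And>t. t\<in>{0..1} \<Longrightarrow> fst (V t) = c t" "homotopic_paths UT V (\<lambda>t. act_UT (g t) (y, u))"
    and e: "is_reference y z c e"
    and \<theta>: "continuous_on {0..1} \<theta>" "\<And>t. t\<in>{0..1} \<Longrightarrow> snd (V t) = cis (\<theta> t) * e t"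
    and r: "r = \<theta> 1 - \<theta> 0"
    using tw unfolding is_twist_def angle_determination_def z_def[symmetric] by blast
  obtain \<kappa> where \<kappa>: "\<And>t. t \<in> {0..1} \<Longrightarrow> e t = of_real (Im (c t)) * cis (\<kappa> + turning y (c t))"
    using reference_field[OF y z c e] by blast
  have cH: "c t \<in> hplane" if "t \<in> {0..1}" for t
    using c that by (auto simp: geodesic_seg_def)
  have hom: "homotopic_paths (- {0}) (snd \<circ> V) (snd \<circ> (\<lambda>t. act_UT (g t) (y, u)))"
    by (rule homotopic_paths_continuous_image[OF V(2)])
      (auto simp: UT_def hplane_def intro: continuous_intros)
  have u0: "u \<noteq> 0"
    using u by (auto simp: UT_def)
  obtain \<psi> where \<psi>: "continuous_on {0..1} \<psi>" "\<And>t. t \<in> {0..1} \<Longrightarrow> sgn (deriv (act (g t)) y) = cis (\<psi> t)"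
    "rotation a y = \<psi> 1 - \<psi> 0"
    using rotation_lift[OF g y] by blast
  have "angle_change (snd \<circ> (\<lambda>t. act_UT (g t) (y, u))) = (\<psi> 1 + Arg u) - (\<psi> 0 + Arg u)"
  proof (rule angle_changeI)
    show "path (snd \<circ> (\<lambda>t. act_UT (g t) (y, u)))"
      using homotopic_paths_imp_path[OF hom] by blast
    show "sgn ((snd \<circ> (\<lambda>t. act_UT (g t) (y, u))) t) = cis (\<psi> t + Arg u)" if "t \<in> {0..1}" for t
      using \<psi>(2)[OF that] u0 by (simp add: act_UT_def sgn_mult cis_Arg flip: cis_mult)
    show "(snd \<circ> (\<lambda>t. act_UT (g t) (y, u))) t \<noteq> 0" for t
      using u0 deriv_act_nz[OF y] by (simp add: act_UT_def)
  qed (intro continuous_intros \<psi>(1))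
  moreover have "angle_change (snd \<circ> V) =
    (\<theta> 1 + (\<kappa> + turning y (c 1))) - (\<theta> 0 + (\<kappa> + turning y (c 0)))"
  proof (rule angle_changeI)
    show "path (snd \<circ> V)"
      using homotopic_paths_imp_path[OF hom] by blast
    have "path V"
      using homotopic_paths_imp_path[OF V(2)] by blast
    then have "continuous_on {0..1} (\<lambda>t. fst (V t))"
      unfolding path_def by (intro continuous_intros)
    then have "continuous_on {0..1} c"
      by (rule continuous_on_eq) (rule V(1))
    then show "continuous_on {0..1} (\<lambda>t. \<theta> t + (\<kappa> + turning y (c t)))"
      using y cH by (intro continuous_intros \<theta>(1)) auto
    show "sgn ((snd \<circ> V) t) = cis (\<theta> t + (\<kappa> + turning y (c t)))" if "t \<in> {0..1}" for t
      using \<theta>(2)[OF that] \<kappa>[OF that] cH[OF that]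
      by (simp add: sgn_mult sgn_of_real hplane_def flip: cis_mult)
    show "(snd \<circ> V) t \<noteq> 0" if "t \<in> {0..1}" for t
      using \<theta>(2)[OF that] \<kappa>[OF that] cH[OF that] by (auto simp: hplane_def)
  qed
  moreover have "c 0 = y" "c 1 = z"
    using c by (auto simp: geodesic_seg_def)
  ultimately show ?thesis
    using angle_change_homotopic[OF hom] by (simp add: r \<psi>(3) z_def)
qed

text \<open>
  Let $\mathcal V$ have the Euclidean direction of $Dg_t(u)$ but base points on the geodesic. The unit
  tangent bundle is the plane times a circle of directions, so moving the base points along Euclidean
  segments gives the required homotopy.
\<close>

lemma is_twist_exists:
  assumes y: "y \<in> hplane"
  shows "\<exists>r. is_twist a y r"
proof -
  define z where "z = act (proj a) y"
  have z: "z \<in> hplane"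
    using y by (simp add: z_def)
  define g where "g = rep_upsl2r a"
  have g: "represents g a"
    by (simp add: g_def represents_rep)
  obtain h where h: "gline h 0 = y" "gline h (hdist y z) = z"
    using gline_through[OF y z] .
  define c where "c t = gline h (t * hdist y z)" for t
  have c: "geodesic_seg y z c"
    unfolding geodesic_seg_iff[OF y z] c_def using h by blast
  have cont_c: "continuous_on {0..1} c"
  proof -
    have "continuous_on hplane (act h)"
      using has_field_derivative_deriv_act DERIV_isCont continuous_at_imp_continuous_on by blast
    then show ?thesis
      unfolding c_def gline_def
      by (rule continuous_on_compose2) (auto simp: Complex_eq intro!: continuous_intros simp: hplane_def)
  qed
  obtain e where e: "is_reference y z c e"
  proof (cases "z = y")
    case True
    show ?thesis
      by (rule that[of "\<lambda>_. of_real (Im y)"])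
        (use True y in \<open>auto simp: UT_def hplane_def intro!: exI[of _ "of_real (Im y)"]\<close>)
  next
    case False
    then show ?thesis by (intro that[of "unit_velocity c"]) auto
  qed
  obtain \<kappa> where \<kappa>: "\<And>t. t \<in> {0..1} \<Longrightarrow> e t = of_real (Im (c t)) * cis (\<kappa> + turning y (c t))"
    using reference_field[OF y z c e] by blast
  obtain \<psi> where \<psi>: "continuous_on {0..1} \<psi>" "\<And>t. t \<in> {0..1} \<Longrightarrow> sgn (deriv (act (g t)) y) = cis (\<psi> t)"
    "rotation a y = \<psi> 1 - \<psi> 0"
    using rotation_lift[OF g y] by blast
  define V where "V t = (c t, of_real (Im (c t)) * cis (\<psi> t))" for t
  define u where "u = complex_of_real (Im y)"
  have u: "(y, u) \<in> UT"
    using y by (auto simp: UT_def u_def hplane_def)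
  have act_UT: "act_UT (g t) (y, u) = (act (g t) y, of_real (Im (act (g t) y)) * cis (\<psi> t))" if "t \<in> {0..1}"
    for t
  proof -
    have "deriv (act (g t)) y = of_real (cmod (deriv (act (g t)) y)) * cis (\<psi> t)"
      using deriv_act_nz[OF y] by (simp add: sgn_eq flip: \<psi>(2)[OF that])
    then show ?thesis
      using y cmod_deriv_act[OF y, of "g t"] by (simp add: act_UT_def u_def hplane_def)
  qed
  have V: "homotopic_paths UT V (\<lambda>t. act_UT (g t) (y, u))"
  proof -
    define K where "K p = (1 - fst p) *\<^sub>R c (snd p) + fst p *\<^sub>R act (g (snd p)) y" for p :: "real \<times> real"
    \<comment> \<open>The base point moves along a segment while the Euclidean direction is kept.\<close>
    define F where "F p = (K p, of_real (Im (K p)) * cis (\<psi> (snd p)))" for p :: "real \<times> real"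
    have KH: "K p \<in> hplane" if "p \<in> {0..1} \<times> {0..1}" for p
    proof -
      have "convex hplane"
        unfolding hplane_def by (rule convex_halfspace_Im_gt)
      moreover have "c (snd p) \<in> hplane" "act (g (snd p)) y \<in> hplane"
        using y by (simp_all add: c_def)
      ultimately show ?thesis
        using that unfolding K_def by (intro convexD) auto
    qed
    have contK: "continuous_on ({0..1} \<times> {0..1}) K"
      unfolding K_def using path_act(1)[OF represents_path[OF g] y]
      by (intro continuous_intros continuous_on_compose2[OF cont_c, of _ snd]
          continuous_on_compose2[of "{0..1}" "\<lambda>t. act (g t) y" _ snd]) (auto simp: path_def)
    have contF: "continuous_on ({0..1} \<times> {0..1}) F"
      unfolding F_def
      by (intro continuous_intros contK continuous_on_compose2[OF \<psi>(1), of _ snd]) auto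
    have ends: "c 0 = act (g 0) y" "c 1 = act (g 1) y"
      using h by (simp_all add: c_def represents_0[OF g] represents_1[OF g] z_def)
    show ?thesis
      unfolding homotopic_paths
    proof (intro exI[of _ F] conjI ballI)
      show "F \<in> {0..1} \<times> {0..1} \<rightarrow> UT"
        using KH by (force simp: F_def UT_def hplane_def norm_mult)
      show "F (0, t) = V t" for t
        by (simp add: F_def K_def V_def)
      show "F (1, t) = act_UT (g t) (y, u)" if "t \<in> {0..1}" for t
        using act_UT[OF that] by (simp add: F_def K_def)
      show "pathstart (F \<circ> Pair s) = pathstart V" "pathfinish (F \<circ> Pair s) = pathfinish V" for s
        by (simp_all add: F_def K_def V_def pathstart_def pathfinish_def ends algebra_simps
          flip: scaleR_add_left)
    qed (rule contF)
  qed
  define \<theta> where "\<theta> t = \<psi> t - (\<kappa> + turning y (c t))" for t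
  have "angle_determination e (\<lambda>t. snd (V t)) \<theta>"
    unfolding angle_determination_def
  proof
    show "continuous_on {0..1} \<theta>"
      unfolding \<theta>_def using y by (intro continuous_intros cont_c \<psi>(1)) (auto simp: c_def)
    show "\<forall>t\<in>{0..1}. snd (V t) = cis (\<theta> t) * e t"
      by (simp add: V_def \<theta>_def \<kappa> mult.left_commute cis_mult)
  qed
  then have "is_twist a y (\<theta> 1 - \<theta> 0)"
    unfolding is_twist_def z_def[symmetric]
    using g c u V e by (intro exI[of _ g] exI[of _ c] exI[of _ u] exI[of _ V] exI[of _ e] exI[of _ \<theta>])
      (auto simp: V_def)
  then show ?thesis ..
qed

lemma twist_eq:
  assumes "y \<in> hplane"
  shows "twist a y = rotation a y - turning y (act (proj a) y)"
  unfolding twist_def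
proof (rule the_equality)
  show "is_twist a y (rotation a y - turning y (act (proj a) y))"
    using is_twist_exists[OF assms] is_twist_imp_eq[OF assms] by metis
qed (rule is_twist_imp_eq[OF assms])

text \<open>
  The additivity defect before it is identified with an area.
\<close>

lemma twist_mult:
  assumes y: "y \<in> hplane"
  shows "twist (b * a) y = twist b y + twist a y
    + turning_sum y (act (proj b) y) (act (proj b * proj a) y)"
proof -
  have "rotation b (act (proj a) y) = rotation b y +
      turning (act (proj b) y) (act (proj b * proj a) y) - turning y (act (proj a) y)"
    using rotation_diff[OF y, of "act (proj a) y" b] y by (simp add: act_mult)
  then show ?thesis
    using y turning_swap[of y "act (proj b * proj a) y"]
    by (simp add: twist_eq rotation_mult proj_mult turning_sum_def)
qed

text \<open>
  The variation of the twist along a geodesic consists of turnings, whose limits at infinity are known.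
\<close>

lemma twist_diff:
  assumes "y \<in> hplane" "z \<in> hplane"
  shows "twist a z = twist a y + turning y (act (proj a) y) + turning (act (proj a) y) (act (proj a) z)
    + turning (act (proj a) z) z + turning z y"
  using assms rotation_diff[OF assms, of a] turning_swap[of z "act (proj a) z"] turning_swap[of y z]
  by (simp add: twist_eq)

section \<open>Points at infinity\<close>

text \<open>
  Convergence to a point at infinity, perpendicularly to the circle. Two maps may converge to the same
  point, and then convergence alone would not determine the limit of the turning between them.
\<close>

definition approaches :: "('a \<Rightarrow> complex) \<Rightarrow> sphere_pt \<Rightarrow> 'a filter \<Rightarrow> bool" where
  "approaches f P F \<longleftrightarrow> (case P of
     Pt z \<Rightarrow> Im z = 0 \<and> ((\<lambda>x. Im (f x)) \<longlongrightarrow> 0) F \<and> ((\<lambda>x. (Re (f x) - Re z) / Im (f x)) \<longlongrightarrow> 0) F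
   | Infty \<Rightarrow> filterlim (\<lambda>x. Im (f x)) at_top F \<and> ((\<lambda>x. Re (f x) / Im (f x)) \<longlongrightarrow> 0) F)"

lemma approaches_imp_Re:
  assumes "approaches f (Pt z) F" "\<And>x. f x \<in> hplane"
  shows "((\<lambda>x. Re (f x)) \<longlongrightarrow> Re z) F"
proof -
  have "((\<lambda>x. (Re (f x) - Re z) / Im (f x) * Im (f x)) \<longlongrightarrow> 0 * 0) F"
    using assms(1) unfolding approaches_def by (intro tendsto_mult) auto
  moreover have "(Re (f x) - Re z) / Im (f x) * Im (f x) = Re (f x) - Re z" for x
    using assms(2)[of x] by (simp add: hplane_def)
  ultimately show ?thesis
    by (simp flip: LIM_zero_iff[of _ "Re z"])
qed

lemma approaches_imp_tends_to_pt:
  assumes "approaches f P F" "\<And>x. f x \<in> hplane"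
  shows "tends_to_pt f P F"
proof (cases P)
  case (Pt z)
  have "((\<lambda>x. Complex (Re (f x)) (Im (f x))) \<longlongrightarrow> Complex (Re z) (Im z)) F"
    using assms(1) approaches_imp_Re[OF assms(1)[unfolded Pt] assms(2)]
    by (intro tendsto_Complex) (auto simp: Pt approaches_def)
  then show ?thesis
    by (simp add: Pt tends_to_pt_def)
next
  case Infty
  have "filterlim (\<lambda>x. Im (f x)) at_top F"
    using assms(1) by (simp add: Infty approaches_def)
  moreover have "Im w \<le> norm w" for w :: complex
    using abs_Im_le_cmod[of w] by linarith
  ultimately have "filterlim (\<lambda>x. norm (f x)) at_top F"
    by (rule filterlim_at_top_mono[OF _ always_eventually[OF allI]])
  then show ?thesis
    by (simp add: Infty tends_to_pt_def filterlim_at_infinity_conv_norm_at_top)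
qed

lemma tends_to_pt_unique:
  assumes "tends_to_pt f P F" "tends_to_pt f Q F" "F \<noteq> bot"
  shows "P = Q"
  using assms not_tendsto_and_filterlim_at_infinity[OF assms(3)] tendsto_unique[OF assms(3)]
  unfolding tends_to_pt_def by (cases P; cases Q) auto

lemma tendsto_divide_at_top:
  fixes f :: "'a \<Rightarrow> real"
  assumes "filterlim f at_top F"
  shows "((\<lambda>x. k / f x) \<longlongrightarrow> 0) F"
  using tendsto_divide_0[OF tendsto_const filterlim_at_top_imp_at_infinity[OF assms]] .

text \<open>
  The points \<open>f x\<close> move up along a vertical geodesic, whose image ends perpendicularly at the image of
  \<open>Infty\<close>.
\<close>

lemma act_approaches:
  assumes H: "\<And>x. f x \<in> hplane" and Re: "\<And>x. Re (f x) = \<mu>" and Im: "filterlim (\<lambda>x. Im (f x)) at_top F"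
  shows "approaches (\<lambda>x. act g (f x)) (act_Infty g) F"
proof -
  obtain a b c d where g: "a * d - b * c = 1" "g = psl a b c d" by (rule psl_cases)
  have pos: "Im (f x) > 0" for x
    using H[of x] by (simp add: hplane_def)
  show ?thesis
  proof (cases "c = 0")
    case True
    have d: "a * d = 1" "a \<noteq> 0" "d \<noteq> 0"
      using g(1) True by auto
    have eq: "act g (f x) = Complex (a\<^sup>2 * \<mu> + a * b) (a\<^sup>2 * Im (f x))" for x
    proof -
      have "complex_of_real a * of_real d = 1"
        using d(1) by (metis of_real_1 of_real_mult)
      moreover have "act g (f x) = (of_real a * f x + of_real b) / of_real d"
        using act_psl[OF g(1), of "f x"] by (simp add: g(2) True)
      ultimately have "act g (f x) = (of_real a * f x + of_real b) * of_real a"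
        using d(3) by (simp add: divide_eq_eq mult.assoc)
      then show ?thesis
        by (simp add: complex_eq_iff Re power2_eq_square algebra_simps)
    qed
    have "filterlim (\<lambda>x. a\<^sup>2 * Im (f x)) at_top F"
      using d Im by (intro filterlim_tendsto_pos_mult_at_top[OF tendsto_const]) auto
    moreover from this have "((\<lambda>x. (a\<^sup>2 * \<mu> + a * b) / (a\<^sup>2 * Im (f x))) \<longlongrightarrow> 0) F"
      by (rule tendsto_divide_at_top)
    moreover have "act_Infty g = Infty"
      using act_Infty_psl[OF g(1)] by (simp add: g(2) True)
    ultimately show ?thesis
      by (simp add: approaches_def eq)
  next
    case False
    define J where "J x = of_real c * f x + of_real d" for x
    define k where "k = c * \<mu> + d"
    have J: "Re (J x) = k" "Im (J x) = c * Im (f x)" for x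
      by (simp_all add: J_def Re k_def)
    have Jnz: "J x \<noteq> 0" for x
      using J(2)[of x] pos[of x] False by auto
    have cJ: "(cmod (J x))\<^sup>2 > 0" for x
      using Jnz[of x] by simp
    have e: "complex_of_real a * of_real d - of_real b * of_real c = 1"
      using g(1) by (metis of_real_diff of_real_mult of_real_1)
    have "act g (f x) - of_real (a / c) = - of_real (1 / c) / J x" for x
    proof -
      have key: "(of_real a * f x + of_real b) * of_real c - of_real a * J x = - 1"
        unfolding J_def using e by algebra
      show ?thesis
        unfolding g(2) act_psl[OF g(1)] J_def[symmetric] of_real_divide
        using Jnz[of x] False by (simp add: diff_frac_eq key)
    qed
    moreover have "Re (- of_real (1 / c) / J x) = - k / c / (cmod (J x))\<^sup>2" for x
      unfolding Re_divide cmod_power2 using J[of x] by simp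
    ultimately have "Re (act g (f x) - of_real (a / c)) = - k / c / (cmod (J x))\<^sup>2" for x
      by (simp only:)
    then have eqRe: "Re (act g (f x)) - a / c = - k / c / (cmod (J x))\<^sup>2" for x
      by simp
    have eqIm: "Im (act g (f x)) = Im (f x) / (cmod (J x))\<^sup>2" for x
      unfolding g(2) J_def by (rule Im_act_psl[OF g(1) pos])
    have "((\<lambda>x. Im (act g (f x))) \<longlongrightarrow> 0) F"
    proof (rule tendsto_0_le[where K = 1])
      show "((\<lambda>x. 1 / c\<^sup>2 / Im (f x)) \<longlongrightarrow> 0) F"
        by (rule tendsto_divide_at_top[OF Im])
      have "norm (Im (act g (f x))) \<le> norm (1 / c\<^sup>2 / Im (f x)) * 1" for x
      proof -
        have "(c * Im (f x))\<^sup>2 \<le> (cmod (J x))\<^sup>2"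
          unfolding cmod_power2 J by simp
        then have "Im (f x) / (cmod (J x))\<^sup>2 \<le> Im (f x) / (c * Im (f x))\<^sup>2"
          using pos[of x] False by (intro divide_left_mono mult_pos_pos) (auto simp: Jnz)
        also have "\<dots> = 1 / c\<^sup>2 / Im (f x)"
          using pos[of x] by (simp add: power2_eq_square)
        finally show ?thesis
          using pos[of x] by (simp add: eqIm)
      qed
      then show "\<forall>\<^sub>F x in F. norm (Im (act g (f x))) \<le> norm (1 / c\<^sup>2 / Im (f x)) * 1"
        by (intro always_eventually) auto
    qed
    moreover have "(Re (act g (f x)) - a / c) / Im (act g (f x)) = (- k / c) / Im (f x)" for x
      unfolding eqRe eqIm using Jnz[of x] by simp
    then have "((\<lambda>x. (Re (act g (f x)) - a / c) / Im (act g (f x))) \<longlongrightarrow> 0) F"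
      using tendsto_divide_at_top[OF Im, of "- k / c"] by (simp only:)
    ultimately show ?thesis
      using False by (simp add: approaches_def g(2) act_Infty_psl[OF g(1)])
  qed
qed

text \<open>
  The rotation by $\pi$ about \<open>\<i>\<close>, which reverses the imaginary axis.
\<close>

definition half_turn :: psl2r where
  "half_turn = psl 0 (- 1) 1 0"

lemma half_turn_half_turn: "half_turn * half_turn = 1"
proof -
  have "psl (- 1) 0 0 (- 1) = psl 1 0 0 1"
    unfolding psl_def by (subst abs_psl2r_eq_iff) (auto simp: SL2R_vector_iff vec_eq_iff forall_2)
  then show ?thesis
    by (simp add: half_turn_def psl_mult psl_one)
qed

lemma gline_half_turn: "gline (g * half_turn) s = gline g (- s)"
proof -
  have "- 1 / Complex 0 (exp s) = Complex 0 (exp (- s))"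
    by (simp add: complex_eq_iff Re_divide Im_divide power2_eq_square exp_minus inverse_eq_divide)
  then show ?thesis
    by (simp add: gline_def act_mult half_turn_def act_inversion del: divide_minus_left)
qed

text \<open>
  The points of the geodesic \<open>gline g\<close> with its two endpoints included. Every point of the
  compactified plane is of this form, and isometries act by multiplication on \<open>g\<close>, so that invariance
  statements need no limits and no case distinction between points and points at infinity.
\<close>

definition line_point :: "psl2r \<Rightarrow> ereal \<Rightarrow> sphere_pt" where
  "line_point g s = (if s = \<infinity> then act_Infty g else if s = -\<infinity> then act_Infty (g * half_turn)
    else Pt (gline g (real_of_ereal s)))"

lemma line_point_simps [simp]:
  "line_point g \<infinity> = act_Infty g" "line_point g (-\<infinity>) = act_Infty (g * half_turn)"
    "line_point g (ereal r) = Pt (gline g r)"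
  by (auto simp: line_point_def)

lemma line_point_0 [simp]: "line_point g 0 = Pt (gline g 0)"
  by (simp add: line_point_def)

lemma line_point_half_turn: "line_point (g * half_turn) s = line_point g (- s)"
  by (cases s) (simp_all add: gline_half_turn mult.assoc half_turn_half_turn)

lemma gline_approaches: "approaches (gline g) (act_Infty g) at_top"
  unfolding gline_def by (rule act_approaches[where \<mu> = 0]) (auto intro: exp_at_top)

lemma passes_gline: "passes (gline g) s P \<longleftrightarrow> P = line_point g s"
proof -
  have 1: "tends_to_pt (gline g) (act_Infty g) at_top" for g
    using approaches_imp_tends_to_pt[OF gline_approaches] by simp
  have "tends_to_pt (\<lambda>s. gline (g * half_turn) (- s)) (act_Infty (g * half_turn)) at_bot"
    using 1[of "g * half_turn"] unfolding tends_to_pt_def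
    by (auto simp: filterlim_at_bot_mirror split: sphere_pt.splits)
  then have 2: "tends_to_pt (gline g) (act_Infty (g * half_turn)) at_bot"
    by (simp add: gline_half_turn)
  show ?thesis
    using 1[of g] 2 tends_to_pt_unique[of "gline g" P at_top] tends_to_pt_unique[of "gline g" P at_bot]
    unfolding passes_def line_point_def by auto
qed

lemma act_bar_act_Infty: "act_bar m (act_Infty g) = act_Infty (m * g)"
proof -
  obtain a b c d where m: "a * d - b * c = 1" "m = psl a b c d" by (rule psl_cases)
  obtain a' b' c' d' where g: "a' * d' - b' * c' = 1" "g = psl a' b' c' d'" by (rule psl_cases)
  have det: "(a * a' + b * c') * (c * b' + d * d') - (a * b' + b * d') * (c * a' + d * c') = 1"
    using g(1) m(1) by algebra
  show ?thesis
  proof (cases "c' = 0")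
    case True
    then show ?thesis
      unfolding act_bar_def m(2) g(2) psl_mult[OF m(1) g(1)] act_Infty_psl[OF g(1)] act_Infty_psl[OF det]
      using g(1) by (auto simp: act_Infty_psl[OF m(1)])
  next
    case False
    have "(complex_of_real c * of_real (a' / c') + of_real d) = of_real ((c * a' + d * c') / c')"
      using False by (simp add: field_simps)
    moreover have "(complex_of_real a * of_real (a' / c') + of_real b) = of_real ((a * a' + b * c') / c')"
      using False by (simp add: field_simps)
    ultimately show ?thesis
      using False
        unfolding act_bar_def m(2) g(2) psl_mult[OF m(1) g(1)] act_Infty_psl[OF g(1)] act_Infty_psl[OF det]
      by (simp add: pole_psl[OF m(1)] act_psl[OF m(1)] del: of_real_divide flip: of_real_divide)
  qed
qed

lemma act_bar_Pt:
  assumes "z \<in> hplane"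
  shows "act_bar g (Pt z) = Pt (act g z)"
proof -
  obtain a b c d where g: "a * d - b * c = 1" "g = psl a b c d" by (rule psl_cases)
  show ?thesis
    using assms linear_form_nz[OF g(1)] by (simp add: act_bar_def g(2) pole_psl[OF g(1)] hplane_def)
qed

lemma act_bar_line_point: "act_bar m (line_point g s) = line_point (m * g) s"
  by (cases s) (simp_all add: act_bar_act_Infty act_bar_Pt gline_mult mult.assoc)

lemma act_Infty_circle: "act_Infty g \<in> circle_inf"
proof -
  obtain a b c d where g: "a * d - b * c = 1" "g = psl a b c d" by (rule psl_cases)
  show ?thesis
    by (auto simp: g(2) act_Infty_psl[OF g(1)] circle_inf_def)
qed

lemma circle_inf_cases:
  assumes "P \<in> circle_inf"
  obtains g where "P = act_Infty g"
proof (cases P)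
  case (Pt z)
  then have "Im z = 0"
    using assms by (auto simp: circle_inf_def)
  then show ?thesis
    by (intro that[of "psl (Re z) (- 1) 1 0"]) (simp add: Pt act_Infty_psl complex_eq_iff)
next
  case Infty
  then show ?thesis
    by (intro that[of 1]) (simp add: psl_one act_Infty_psl)
qed

lemma circle_inf_not_hplane: "Pt z \<in> circle_inf \<Longrightarrow> z \<notin> hplane"
  by (auto simp: circle_inf_def hplane_def)

lemma hbar_eq: "hbar = Pt ` hplane \<union> circle_inf"
  by (force simp: hbar_def hplane_def circle_inf_def image_iff le_less)

lemma hbar_iff_line_point: "P \<in> hbar \<longleftrightarrow> (\<exists>g s. P = line_point g s)"
proof
  assume "P \<in> hbar"
  then consider z where "z \<in> hplane" "P = Pt z" | "P \<in> circle_inf"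
    by (auto simp: hbar_eq)
  then show "\<exists>g s. P = line_point g s"
  proof cases
    case 1
    obtain g where "gline g 0 = z"
      using gline_through[OF 1(1) 1(1)] .
    then show ?thesis
      using 1(2) by (intro exI[of _ g] exI[of _ 0]) simp
  next
    case 2
    then show ?thesis
      by (metis circle_inf_cases line_point_simps(1))
  qed
next
  assume "\<exists>g s. P = line_point g s"
  then obtain g s where "P = line_point g s" by blast
  then show "P \<in> hbar"
    by (cases s) (auto simp: hbar_eq act_Infty_circle)
qed

lemma line_point_hbar [simp]: "line_point g s \<in> hbar"
  by (auto simp: hbar_iff_line_point)

lemma act_bar_hbar [simp]: "P \<in> hbar \<Longrightarrow> act_bar g P \<in> hbar"
  by (metis hbar_iff_line_point act_bar_line_point)

lemma act_bar_mult: "P \<in> hbar \<Longrightarrow> act_bar (g * h) P = act_bar g (act_bar h P)"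
  by (auto simp: hbar_iff_line_point act_bar_line_point mult.assoc)

lemma act_bar_one: "P \<in> hbar \<Longrightarrow> act_bar 1 P = P"
  by (auto simp: hbar_iff_line_point act_bar_line_point)

lemma act_bar_circle: "P \<in> circle_inf \<Longrightarrow> act_bar g P \<in> circle_inf"
  by (metis circle_inf_cases act_bar_act_Infty act_Infty_circle)

lemma line_point_eq_Pt_hplane:
  assumes "line_point g s = Pt z" "z \<in> hplane"
  obtains r where "s = ereal r" "gline g r = z"
  using assms act_Infty_circle[of g] act_Infty_circle[of "g * half_turn"] circle_inf_not_hplane[of z]
  by (cases s) auto

section \<open>Segments and triangles\<close>

lemma hsegment_iff:
  "P \<in> hsegment A B \<longleftrightarrow> (\<exists>g s r t. s \<le> r \<and> r \<le> t \<and> A = line_point g s \<and> P = line_point g r \<and> B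
    = line_point g t)"
  unfolding hsegment_def mem_Collect_eq geodesic_line_iff passes_gline[symmetric] by blast

lemma hsegment_commute: "hsegment A B = hsegment B A"
proof -
  have "P \<in> hsegment B A" if PAB: "P \<in> hsegment A B" for P A B
  proof -
    obtain g s r t where *: "s \<le> r" "r \<le> t" "A = line_point g s" "P = line_point g r" "B = line_point g t"
      using PAB unfolding hsegment_iff by blast
    show ?thesis
      unfolding hsegment_iff
      by (intro exI[of _ "g * half_turn"] exI[of _ "- t"] exI[of _ "- r"] exI[of _ "- s"])
        (use * in \<open>simp add: line_point_half_turn\<close>)
  qed
  then show ?thesis by blast
qed

lemma hsegment_act: "P \<in> hsegment A B \<Longrightarrow> act_bar m P \<in> hsegment (act_bar m A) (act_bar m B)"
  unfolding hsegment_iff by (metis act_bar_line_point)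

lemma act_bar_inverse: "m' * m = 1 \<Longrightarrow> P \<in> hbar \<Longrightarrow> act_bar m' (act_bar m P) = P"
  by (metis act_bar_mult act_bar_one)

lemma htriangle_act:
  assumes "z \<in> htriangle A B C"
  shows "act m z \<in> htriangle (act_bar m A) (act_bar m B) (act_bar m C)"
  using assms hsegment_act unfolding htriangle_def
  by (auto simp: act_bar_Pt) (metis act_bar_Pt)

lemma htriangle_act_iff:
  assumes "z \<in> hplane" "A \<in> hbar" "B \<in> hbar" "C \<in> hbar"
  shows "act m z \<in> htriangle (act_bar m A) (act_bar m B) (act_bar m C) \<longleftrightarrow> z \<in> htriangle A B C"
proof
  obtain m' where m': "m' * m = 1"
    using psl2r_inverse[of m] by blast
  note act_inverse[OF m' assms(1)]
  moreover assume "act m z \<in> htriangle (act_bar m A) (act_bar m B) (act_bar m C)"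
  ultimately show "z \<in> htriangle A B C"
    using htriangle_act[of "act m z" "act_bar m A" "act_bar m B" "act_bar m C" m'] assms m'
    by (simp add: act_bar_inverse)
qed (rule htriangle_act)

lemma htriangle_subset: "htriangle A B C \<subseteq> hplane"
  by (auto simp: htriangle_def)

lemma htriangle_swap: "htriangle A C B = htriangle A B C"
  by (simp add: htriangle_def hsegment_commute)

section \<open>Orientation\<close>

lemma has_vector_derivative_gline:
  "(gline g has_vector_derivative deriv (act g) (Complex 0 (exp s)) * Complex 0 (exp s)) (at s)"
proof -
  have "((\<lambda>s. Complex 0 (exp s)) has_vector_derivative Complex 0 (exp s)) (at s)"
    unfolding Complex_eq by (auto intro!: derivative_eq_intros)
  then have "((act g \<circ> (\<lambda>s. Complex 0 (exp s))) has_vector_derivative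
      Complex 0 (exp s) * deriv (act g) (Complex 0 (exp s))) (at s)"
    by (rule field_vector_diff_chain_at) (rule has_field_derivative_deriv_act, simp)
  then show ?thesis
    by (simp add: gline_def[abs_def] o_def mult.commute)
qed

lemma vector_derivative_gline:
  "vector_derivative (gline g) (at s) = deriv (act g) (Complex 0 (exp s)) * Complex 0 (exp s)"
  by (rule vector_derivative_at[OF has_vector_derivative_gline])

lemma gline_psl_Re:
  assumes "a * d - b * c = 1"
  shows "Re (gline (psl a b c d) s) = (a * c * exp (2 * s) + b * d) / (c\<^sup>2 * exp (2 * s) + d\<^sup>2)"
proof -
  have "exp (2 * s) = exp s * exp s"
    by (simp flip: exp_add)
  then show ?thesis
    unfolding gline_def act_psl[OF assms] Re_divide
    by (simp only:) (simp add: power2_eq_square algebra_simps)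
qed

text \<open>
  For a geodesic that meets the imaginary axis at time \<open>0\<close>, the sign of \<open>c * d\<close> decides on which side it
  continues, both infinitesimally and for all later times. This holds because two geodesics cross
  at most once.
\<close>

lemma gline_crossing:
  assumes det: "a * d - b * c = 1" and 0: "Re (gline (psl a b c d) 0) = 0"
  shows "a * c = c * d / (c\<^sup>2 + d\<^sup>2)"
    "Re (vector_derivative (gline (psl a b c d)) (at 0)) = 2 * (c * d) / (c\<^sup>2 + d\<^sup>2)\<^sup>2"
    "Re (gline (psl a b c d) s) = c * d * ((exp (2 * s) - 1) / ((c\<^sup>2 + d\<^sup>2) * (c\<^sup>2 * exp (2 * s) + d\<^sup>2)))"
proof -
  have N: "c\<^sup>2 + d\<^sup>2 \<noteq> 0"
    using det by (auto simp: sum_power2_eq_zero_iff)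
  have *: "a * c + b * d = 0"
    using 0 N unfolding gline_psl_Re[OF det] by auto
  have "a * c * (c\<^sup>2 + d\<^sup>2) = c * d"
    using det * by algebra
  then show ac: "a * c = c * d / (c\<^sup>2 + d\<^sup>2)"
    using N by (simp add: field_simps)
  have "b * d = - (c * d / (c\<^sup>2 + d\<^sup>2))"
    using * ac by simp
  then show
    "Re (gline (psl a b c d) s) = c * d * ((exp (2 * s) - 1) / ((c\<^sup>2 + d\<^sup>2) * (c\<^sup>2 * exp (2 * s) + d\<^sup>2)))"
    unfolding gline_psl_Re[OF det] ac by (simp add: right_diff_distrib diff_divide_distrib)
  have i: "\<i> = Complex 0 1" by (simp add: complex_eq_iff)
  have "vector_derivative (gline (psl a b c d)) (at 0) = \<i> / (of_real c * \<i> + of_real d)\<^sup>2"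
    unfolding vector_derivative_gline by (simp add: deriv_act_psl[OF det] hplane_def flip: i)
  also have "\<dots> = \<i> * (of_real d - of_real c * \<i>)\<^sup>2 / (of_real (c\<^sup>2 + d\<^sup>2))\<^sup>2"
  proof -
    have "(of_real c * \<i> + of_real d) * (of_real d - of_real c * \<i>) = complex_of_real (c\<^sup>2 + d\<^sup>2)"
      by (simp add: complex_eq_iff power2_eq_square)
    then have
      "(of_real (c\<^sup>2 + d\<^sup>2))\<^sup>2 = (of_real c * \<i> + of_real d)\<^sup>2 * (of_real d - complex_of_real c * \<i>)\<^sup>2"
      by (metis power_mult_distrib)
    moreover have "complex_of_real (c\<^sup>2 + d\<^sup>2) \<noteq> 0"
      using N by (simp only: of_real_eq_0_iff) simp
    ultimately show ?thesis
      by (auto simp: field_simps)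
  qed
  finally show "Re (vector_derivative (gline (psl a b c d)) (at 0)) = 2 * (c * d) / (c\<^sup>2 + d\<^sup>2)\<^sup>2"
    by (simp add: power2_eq_square flip: of_real_power of_real_mult of_real_add)
qed

lemma line_point_left_iff:
  assumes h: "Re (gline h 0) = 0" and l: "0 < l"
  shows "Re (vector_derivative (gline h) (at 0)) < 0 \<longleftrightarrow> (\<exists>z. line_point h l = Pt z \<and> Re z < 0)"
proof -
  obtain a b c d where g: "a * d - b * c = 1" "h = psl a b c d" by (rule psl_cases)
  have N: "c\<^sup>2 + d\<^sup>2 > 0"
    using g(1) by (auto simp: sum_power2_gt_zero_iff)
  note cr = gline_crossing[OF g(1) h[unfolded g(2)], folded g(2)]
  have "Re (vector_derivative (gline h) (at 0)) < 0 \<longleftrightarrow> c * d < 0"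
    unfolding cr(2) using N by (auto simp: divide_less_0_iff)
  also have "\<dots> \<longleftrightarrow> (\<exists>z. line_point h l = Pt z \<and> Re z < 0)"
  proof (cases l)
    case (real r)
    then have r: "exp (2 * r) > 1"
      using l by simp
    have "c\<^sup>2 * exp (2 * r) + d\<^sup>2 > 0"
      using N by (cases "c = 0") (auto intro: add_pos_nonneg)
    then have "(exp (2 * r) - 1) / ((c\<^sup>2 + d\<^sup>2) * (c\<^sup>2 * exp (2 * r) + d\<^sup>2)) > 0"
      using r N by (intro divide_pos_pos mult_pos_pos) auto
    then obtain K where K: "K > 0" "Re (gline h r) = c * d * K"
      using cr(3)[of r] by metis
    then show ?thesis
      by (auto simp: real mult_less_0_iff)
  next
    case PInf
    have "a * c < 0 \<longleftrightarrow> c * d < 0"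
      unfolding cr(1) using N by (auto simp: divide_less_0_iff)
    then show ?thesis
      by (auto simp: PInf g(2) act_Infty_psl[OF g(1)] divide_less_0_iff mult_less_0_iff)
  qed (use l in auto)
  finally show ?thesis .
qed

text \<open>
  In the coordinates where the geodesic through \<open>A\<close> and \<open>B\<close> is the upward imaginary axis, the left side
  is the half-plane of negative real part.
\<close>

lemma anticlockwise_iff:
  "anticlockwise A B C \<longleftrightarrow> (\<exists>g s t z. s < t \<and> A = line_point g s \<and> B = line_point g t \<and>
    0 \<le> Im z \<and> Re z < 0 \<and> C = act_bar g (Pt z))" (is "_ \<longleftrightarrow> ?R")
proof -
  have left: "0 < Im (cnj (vector_derivative (gline g) (at r)) * vector_derivative (gline (g * h)) (at 0))
      \<longleftrightarrow> Re (vector_derivative (gline h) (at 0)) < 0" if "gline h 0 = Complex 0 (exp r)" for g h r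
  proof -
    define w where "w = Complex 0 (exp r)"
    have i: "\<i> = Complex 0 1" "\<i> \<in> hplane"
      by (simp_all add: complex_eq_iff hplane_def)
    have w: "w \<in> hplane" "act h \<i> = w"
      using that by (simp_all add: w_def gline_def flip: i(1))
    have "vector_derivative (gline (g * h)) (at 0) = deriv (act g) w * vector_derivative (gline h) (at 0)"
      unfolding vector_derivative_gline using i w by (simp add: deriv_act_mult flip: i(1))
    then have "cnj (vector_derivative (gline g) (at r)) * vector_derivative (gline (g * h)) (at 0)
        = (deriv (act g) w * cnj (deriv (act g) w)) * (cnj w * vector_derivative (gline h) (at 0))"
      unfolding vector_derivative_gline[of g r] by (simp add: w_def)
    also have "deriv (act g) w * cnj (deriv (act g) w) = of_real ((cmod (deriv (act g) w))\<^sup>2)"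
      by (rule complex_norm_square[symmetric])
    finally have "Im (cnj (vector_derivative (gline g) (at r)) * vector_derivative (gline (g * h)) (at 0))
        = - ((cmod (deriv (act g) w))\<^sup>2 * exp r * Re (vector_derivative (gline h) (at 0)))"
      by (simp add: w_def)
    moreover have "(cmod (deriv (act g) w))\<^sup>2 * exp r > 0"
      using deriv_act_nz[OF w(1)] by simp
    ultimately show ?thesis
      by (simp add: mult_less_0_iff)
  qed
  show ?thesis
  proof
    assume "anticlockwise A B C"
    then obtain g s t k r l where *: "s < t" "A = line_point g s" "B = line_point g t" "gline k 0 = gline g r"
      "0 < l" "C = line_point k l"
      "0 < Im (cnj (vector_derivative (gline g) (at r)) * vector_derivative (gline k) (at 0))"
      unfolding anticlockwise_def by (auto simp: geodesic_line_iff passes_gline)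
    obtain g' where g': "g' * g = 1" "g * g' = 1"
      by (rule psl2r_inverse)
    define h where "h = g' * k"
    have k: "k = g * h"
      by (simp add: h_def g'(2) flip: mult.assoc)
    have h0: "gline h 0 = Complex 0 (exp r)"
      using *(4) g'(1) unfolding h_def gline_mult by (simp add: gline_def flip: act_mult)
    then obtain z where z: "line_point h l = Pt z" "Re z < 0"
      using *(7) left[OF h0, of g] line_point_left_iff[OF _ *(5), of h] unfolding k by auto
    moreover have "Im z \<ge> 0"
      using line_point_hbar[of h l] z(1) by (auto simp: hbar_def)
    ultimately show ?R
      using * by (intro exI[of _ g] exI[of _ s] exI[of _ t] exI[of _ z])
        (simp add: k act_bar_line_point flip: z(1))
  next
    assume ?R
    then obtain g s t z where *: "s < t" "A = line_point g s" "B = line_point g t" "0 \<le> Im z" "Re z < 0"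
      "C = act_bar g (Pt z)"
      by blast
    have "\<exists>h r l. 0 < l \<and> gline h 0 = Complex 0 (exp r) \<and> line_point h l = Pt z"
    proof (cases "Im z > 0")
      case True
      then have z: "z \<in> hplane" "Complex 0 (exp 0) \<in> hplane"
        by (auto simp: hplane_def)
      obtain h where h: "gline h 0 = Complex 0 (exp 0)" "gline h (hdist (Complex 0 (exp 0)) z) = z"
        using gline_through[OF z(2,1)] .
      moreover have "hdist (Complex 0 (exp 0)) z \<noteq> 0"
      proof
        assume "hdist (Complex 0 (exp 0)) z = 0"
        then have "z = Complex 0 (exp 0)"
          using h by metis
        then show False
          using *(5) by simp
      qed
      ultimately show ?thesis
        using hdist_nonneg[OF z(2,1)]
        by (intro exI[of _ h] exI[of _ 0] exI[of _ "ereal (hdist (Complex 0 (exp 0)) z)"]) auto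
    next
      case False
      \<comment> \<open>A point at infinity on the left is reached along the half circle around \<open>0\<close>, from \<open>\<rho>\<close> to \<open>- \<rho>\<close>.\<close>
      define \<rho> \<kappa> where "\<rho> = - Re z" and "\<kappa> = 1 / sqrt (2 * \<rho>)"
      have \<rho>: "\<rho> > 0" "\<kappa> > 0" "2 * \<rho> * \<kappa> * \<kappa> = 1"
        using *(5) by (auto simp: \<rho>_def \<kappa>_def field_simps)
      have det: "(- \<rho> * \<kappa>) * (- \<kappa>) - (- \<rho> * \<kappa>) * \<kappa> = 1"
        using \<rho>(3) by (simp add: mult_ac)
      define h where "h = psl (- \<rho> * \<kappa>) (- \<rho> * \<kappa>) \<kappa> (- \<kappa>)"
      have "gline h 0 = Complex 0 (exp (ln \<rho>))"
        unfolding h_def gline_def act_psl[OF det] using \<rho>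
        by (simp add: complex_eq_iff Re_divide Im_divide power2_eq_square field_simps)
      moreover have "line_point h \<infinity> = Pt (of_real (- \<rho>))"
        using \<rho> unfolding h_def line_point_simps act_Infty_psl[OF det] by simp
      moreover have "of_real (- \<rho>) = z"
        using *(4) False by (simp add: complex_eq_iff \<rho>_def)
      ultimately show ?thesis
        by (intro exI[of _ h] exI[of _ "ln \<rho>"] exI[of _ \<infinity>]) simp
    qed
    then obtain h r l where h: "0 < l" "gline h 0 = Complex 0 (exp r)" "line_point h l = Pt z"
      by blast
    have "0 < Im (cnj (vector_derivative (gline g) (at r)) * vector_derivative (gline (g * h)) (at 0))"
      unfolding left[OF h(2)] using line_point_left_iff[OF _ h(1), of h] h *(5) by simp
    moreover have "gline (g * h) 0 = gline g r"
      unfolding gline_mult h(2) by (simp add: gline_def)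
    moreover have "C = line_point (g * h) l"
      by (simp add: * h(3) flip: act_bar_line_point)
    ultimately show "anticlockwise A B C"
      unfolding anticlockwise_def using * h(1)
      by (intro exI[of _ "gline g"] exI[of _ s] exI[of _ t] exI[of _ "gline (g * h)"] exI[of _ r] exI[of _ l])
        (simp add: geodesic_line_gline passes_gline)
  qed
qed

lemma anticlockwise_act:
  assumes "anticlockwise A B C"
  shows "anticlockwise (act_bar m A) (act_bar m B) (act_bar m C)"
proof -
  obtain g s t z where *: "s < t" "A = line_point g s" "B = line_point g t" "0 \<le> Im z" "Re z < 0"
    "C = act_bar g (Pt z)"
    using assms unfolding anticlockwise_iff by blast
  then have "Pt z \<in> hbar"
    by (simp add: hbar_def)
  then show ?thesis
    unfolding anticlockwise_iff using *
    by (intro exI[of _ "m * g"] exI[of _ s] exI[of _ t] exI[of _ z])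
      (simp add: act_bar_line_point act_bar_mult)
qed

lemma anticlockwise_act_iff:
  assumes "A \<in> hbar" "B \<in> hbar" "C \<in> hbar"
  shows "anticlockwise (act_bar m A) (act_bar m B) (act_bar m C) \<longleftrightarrow> anticlockwise A B C"
proof -
  obtain m' where "m' * m = 1"
    using psl2r_inverse[of m] by blast
  then show ?thesis
    using anticlockwise_act[of A B C m] anticlockwise_act[of "act_bar m A" "act_bar m B" "act_bar m C" m']
      assms
    by (auto simp: act_bar_inverse)
qed

text \<open>
  Two of the vertices have the same real part, so only two arc tangents remain, with equal numerators
  and different denominators.
\<close>

lemma turning_sum_imaginary_axis:
  assumes "0 < a" "a < b" "z \<in> hplane"
  shows "turning_sum (Complex 0 a) (Complex 0 b) z < 0 \<longleftrightarrow> Re z < 0"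
proof -
  have z: "Im z > 0"
    using assms(3) by (simp add: hplane_def)
  have "turning_sum (Complex 0 a) (Complex 0 b) z
    = 2 * arctan (Re z / (Im z + a)) - 2 * arctan (Re z / (b + Im z))"
    by (simp add: turning_sum_def turning_def arctan_minus)
  also have "\<dots> < 0 \<longleftrightarrow> Re z / (Im z + a) < Re z / (b + Im z)"
    by (simp add: arctan_less_iff)
  also have "\<dots> \<longleftrightarrow> Re z * (b - a) < 0"
    using assms z by (simp add: divide_less_eq field_simps)
  also have "\<dots> \<longleftrightarrow> Re z < 0"
    using assms by (simp add: mult_less_0_iff)
  finally show ?thesis .
qed

text \<open>
  The sign of the turning sum is invariant, so the claim reduces to a side on the imaginary axis.
\<close>

lemma anticlockwise_iff_turning_sum:
  assumes "A \<in> hplane" "B \<in> hplane" "C \<in> hplane"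
  shows "anticlockwise (Pt A) (Pt B) (Pt C) \<longleftrightarrow> turning_sum A B C < 0"
proof
  assume "anticlockwise (Pt A) (Pt B) (Pt C)"
  then obtain g s t z where *: "s < t" "line_point g s = Pt A" "line_point g t = Pt B" "0 \<le> Im z" "Re z < 0"
    "Pt C = act_bar g (Pt z)"
    unfolding anticlockwise_iff by metis
  obtain s' where s: "s = ereal s'" "gline g s' = A"
    using line_point_eq_Pt_hplane[OF *(2) assms(1)] .
  obtain t' where t: "t = ereal t'" "gline g t' = B"
    using line_point_eq_Pt_hplane[OF *(3) assms(2)] .
  have z: "z \<in> hplane"
  proof (rule ccontr)
    assume "z \<notin> hplane"
    then have "Pt z \<in> circle_inf"
      using *(4) by (simp add: circle_inf_def hplane_def)
    then show False
      using *(6) act_bar_circle circle_inf_not_hplane assms(3) by metis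
  qed
  then have "C = act g z"
    using *(6) by (simp add: act_bar_Pt)
  then have "turning_sum A B C = turning_sum (Complex 0 (exp s')) (Complex 0 (exp t')) z"
    using z unfolding s(2)[symmetric] t(2)[symmetric] gline_def by (simp add: turning_sum_act)
  then show "turning_sum A B C < 0"
    using *(1,5) s t z by (simp add: turning_sum_imaginary_axis)
next
  assume neg: "turning_sum A B C < 0"
  obtain g where g: "gline g 0 = A" "gline g (hdist A B) = B"
    using gline_through[OF assms(1,2)] .
  obtain z where z: "z \<in> hplane" "act g z = C"
    using act_surj[OF assms(3)] .
  have "A \<noteq> B"
    using neg turning_swap[of A C] by (auto simp: turning_sum_def)
  then have L: "hdist A B > 0"
    using g hdist_nonneg[OF assms(1,2)] by (metis order_le_less)
  have "turning_sum A B C = turning_sum (Complex 0 (exp 0)) (Complex 0 (exp (hdist A B))) z"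
    unfolding z(2)[symmetric] using g z(1) turning_sum_act
      by (metis Complex_0_in_hplane exp_gt_zero gline_def)
  then have "Re z < 0"
    using neg L z(1) by (simp add: turning_sum_imaginary_axis del: exp_zero)
  then show "anticlockwise (Pt A) (Pt B) (Pt C)"
    unfolding anticlockwise_iff using g z L
    by (intro exI[of _ g] exI[of _ 0] exI[of _ "ereal (hdist A B)"] exI[of _ z])
      (auto simp: act_bar_Pt, simp add: hplane_def)
qed

section \<open>The hyperbolic measure and its invariance\<close>

lemma lborel_complex_eq:
  "(lborel :: complex measure) = distr (lborel \<Otimes>\<^sub>M lborel) borel (\<lambda>(x, y). Complex x y)"
  (is "_ = ?M")
proof (rule lborel_eqI)
  fix l u :: complex
  assume le: "\<And>b. b \<in> Basis \<Longrightarrow> l \<bullet> b \<le> u \<bullet> b"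
  have le': "Re l \<le> Re u" "Im l \<le> Im u"
    using le[of 1] le[of \<i>] by (auto simp: Basis_complex_def)
  have [measurable]: "(\<lambda>(x, y). Complex x y) \<in> lborel \<Otimes>\<^sub>M lborel \<rightarrow>\<^sub>M borel"
    unfolding Complex_eq by measurable
  have "(\<lambda>(x, y). Complex x y) -` box l u \<inter> space (lborel \<Otimes>\<^sub>M lborel) = {Re l<..<Re u} \<times> {Im l<..<Im u}"
    by (auto simp: box_def Basis_complex_def space_pair_measure)
  then have "emeasure ?M (box l u)
      = emeasure (lborel \<Otimes>\<^sub>M lborel) ({Re l<..<Re u} \<times> {Im l<..<Im u})"
    by (subst emeasure_distr) auto
  also have "\<dots> = ennreal (Re u - Re l) * ennreal (Im u - Im l)"
    using le' by (subst lborel.emeasure_pair_measure_Times) auto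
  also have "\<dots> = (\<Prod>b\<in>Basis. (u - l) \<bullet> b)"
    using le' by (simp add: Basis_complex_def ennreal_mult)
  finally show "emeasure ?M (box l u)
      = (\<Prod>b\<in>Basis. (u - l) \<bullet> b)" .
qed simp

lemma measurable_Complex [measurable (raw)]:
  assumes "f \<in> borel_measurable M" "g \<in> borel_measurable M"
  shows "(\<lambda>x. Complex (f x) (g x)) \<in> borel_measurable M"
  unfolding Complex_eq using assms by measurable

lemma nn_integral_complex:
  assumes [measurable]: "f \<in> borel_measurable borel"
  shows "(\<integral>\<^sup>+z. f z \<partial>lborel) = (\<integral>\<^sup>+x. \<integral>\<^sup>+y. f (Complex x y) \<partial>lborel \<partial>lborel)"
    "(\<integral>\<^sup>+z. f z \<partial>lborel) = (\<integral>\<^sup>+y. \<integral>\<^sup>+x. f (Complex x y) \<partial>lborel \<partial>lborel)"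
proof -
  have "(\<integral>\<^sup>+z. f z \<partial>lborel) = (\<integral>\<^sup>+p. f (case p of (x, y) \<Rightarrow> Complex x y) \<partial>(lborel \<Otimes>\<^sub>M lborel))"
    by (subst lborel_complex_eq, subst nn_integral_distr) measurable
  also have "\<dots> = (\<integral>\<^sup>+x. \<integral>\<^sup>+y. f (Complex x y) \<partial>lborel \<partial>lborel)"
    by (subst lborel.nn_integral_fst[symmetric]) auto
  finally show 1: "(\<integral>\<^sup>+z. f z \<partial>lborel) = (\<integral>\<^sup>+x. \<integral>\<^sup>+y. f (Complex x y) \<partial>lborel \<partial>lborel)" .
  also have "\<dots> = (\<integral>\<^sup>+y. \<integral>\<^sup>+x. f (Complex x y) \<partial>lborel \<partial>lborel)"
    by (rule lborel_pair.Fubini'[symmetric]) measurable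
  finally show "(\<integral>\<^sup>+z. f z \<partial>lborel) = (\<integral>\<^sup>+y. \<integral>\<^sup>+x. f (Complex x y) \<partial>lborel \<partial>lborel)" .
qed

text \<open>
  The measure $dy/y$ on the positive axis is Lebesgue measure in the coordinate $\ln y$.
\<close>

lemma lborel_eq_distr_ln:
  "lborel = distr (density lborel (\<lambda>y. indicator {0<..} y * ennreal (1 / y))) borel ln"
  (is "_ = ?M")
proof (rule lborel_eqI)
  fix l u :: real
  assume "\<And>b. b \<in> Basis \<Longrightarrow> l \<bullet> b \<le> u \<bullet> b"
  then have le: "l \<le> u" by simp
  have [measurable]: "ln -` {l<..<u} \<in> sets borel"
    using measurable_sets_borel[of ln borel "{l<..<u}"] by simp
  have "emeasure ?M (box l u)
    = (\<integral>\<^sup>+y. indicator {0<..} y * ennreal (1 / y) * indicator (ln -` {l<..<u}) y \<partial>lborel)"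
    by (simp add: emeasure_distr) (subst emeasure_density, auto)
  also have "\<dots> = (\<integral>\<^sup>+y. ennreal (1 / y) * indicator {exp l..exp u} y \<partial>lborel)"
  proof (rule nn_integral_cong_AE)
    have eq: "indicator {0<..} y * ennreal (1 / y) * indicator (ln -` {l<..<u}) y
      = ennreal (1 / y) * indicator {exp l..exp u} y"
      if "y \<noteq> exp l" "y \<noteq> exp u" for y :: real
    proof (cases "y > 0")
      case True
      then have "(l < ln y \<and> ln y < u) \<longleftrightarrow> (exp l \<le> y \<and> y \<le> exp u)"
        using that by (metis exp_less_cancel_iff exp_ln order_le_less)
      then show ?thesis
        using True by (auto simp: indicator_def)
    next
      case False
      then show ?thesis
        by (auto simp: indicator_def) (meson exp_gt_zero less_le_trans)+
    qed
    show "AE y in lborel. indicator {0<..} y * ennreal (1 / y) * indicator (ln -` {l<..<u}) y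
        = ennreal (1 / y) * indicator {exp l..exp u} y"
      using AE_lborel_singleton[of "exp l"] AE_lborel_singleton[of "exp u"] by eventually_elim (rule eq)
  qed
  also have "\<dots> = ennreal (ln (exp u) - ln (exp l))"
  proof (rule nn_integral_FTC_Icc)
    fix y assume "y \<in> {exp l..exp u}"
    then have "y > 0"
      by (auto intro: less_le_trans[OF exp_gt_zero])
    then show "DERIV ln y :> 1 / y" "0 \<le> 1 / y"
      by (auto intro!: derivative_eq_intros)
  qed (use le in auto)
  also have "\<dots> = (\<Prod>b\<in>Basis. (u - l) \<bullet> b)"
    by simp
  finally show "emeasure ?M (box l u)
    = (\<Prod>b\<in>Basis. (u - l) \<bullet> b)" .
qed simp

lemma nn_integral_exp:
  assumes [measurable]: "F \<in> borel_measurable borel"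
  shows "(\<integral>\<^sup>+r. F (exp r) \<partial>lborel) = (\<integral>\<^sup>+y. indicator {0<..} y * ennreal (1 / y) * F (y::real) \<partial>lborel)"
proof -
  have "(\<integral>\<^sup>+r. F (exp r) \<partial>lborel) = (\<integral>\<^sup>+y. indicator {0<..} y * ennreal (1 / y) * F (exp (ln y)) \<partial>lborel)"
    by (subst lborel_eq_distr_ln, subst nn_integral_distr, simp, simp, subst nn_integral_density) auto
  also have "\<dots> = (\<integral>\<^sup>+y. indicator {0<..} y * ennreal (1 / y) * F y \<partial>lborel)"
    by (rule nn_integral_cong) (auto simp: indicator_def)
  finally show ?thesis .
qed

text \<open>
  The integral for $dx\,dy/y^2$ in the coordinates $z = e^r(\xi + i)$, in which the measure becomes
  $d\xi\,dr$ (\<open>hyp_integral_eq_lborel\<close>). Translations, scalings and the inversion become shears, translations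
  and reflections, and their invariance follows from one-dimensional affine
  substitutions instead of a change of variables in the plane.
\<close>

definition hyp_integral :: "(complex \<Rightarrow> ennreal) \<Rightarrow> ennreal" where
  "hyp_integral f = (\<integral>\<^sup>+r. \<integral>\<^sup>+\<xi>. f (of_real (exp r) * Complex \<xi> 1) \<partial>lborel \<partial>lborel)"

lemma hyp_integral_cong:
  assumes "\<And>z. z \<in> hplane \<Longrightarrow> f z = g z"
  shows "hyp_integral f = hyp_integral g"
  unfolding hyp_integral_def by (intro nn_integral_cong assms) (simp add: hplane_def)

lemma hyp_integral_eq_lborel:
  assumes [measurable]: "f \<in> borel_measurable borel" and 0: "\<And>z. z \<notin> hplane \<Longrightarrow> f z = 0"
  shows "hyp_integral f = (\<integral>\<^sup>+z. ennreal (1 / (Im z)\<^sup>2) * f z \<partial>lborel)"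
proof -
  define F where "F y = (\<integral>\<^sup>+\<xi>. f (of_real y * Complex \<xi> 1) \<partial>lborel)" for y :: real
  have [measurable]: "F \<in> borel_measurable borel"
    unfolding F_def by measurable
  have "(\<integral>\<^sup>+x. ennreal (1 / y\<^sup>2) * f (Complex x y) \<partial>lborel) = indicator {0<..} y * ennreal (1 / y) * F y"
    for y
  proof (cases "y > 0")
    case True
    have "(\<integral>\<^sup>+x. ennreal (1 / y\<^sup>2) * f (Complex x y) \<partial>lborel)
        = ennreal (1 / y\<^sup>2) * (\<integral>\<^sup>+x. f (Complex x y) \<partial>lborel)"
      by (rule nn_integral_cmult) measurable
    also have "(\<integral>\<^sup>+x. f (Complex x y) \<partial>lborel) = \<bar>y\<bar> * (\<integral>\<^sup>+\<xi>. f (Complex (0 + y * \<xi>) y) \<partial>lborel)"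
      by (rule nn_integral_real_affine) (use True in auto)
    also have "(\<integral>\<^sup>+\<xi>. f (Complex (0 + y * \<xi>) y) \<partial>lborel) = F y"
      unfolding F_def by (intro nn_integral_cong arg_cong[of _ _ f]) (simp add: complex_eq_iff)
    finally show ?thesis
      using True by (simp add: mult.assoc[symmetric] ennreal_mult[symmetric] power2_eq_square)
  next
    case False
    then show ?thesis
      by (simp add: 0 hplane_def)
  qed
  then have "(\<integral>\<^sup>+y. \<integral>\<^sup>+x. ennreal (1 / y\<^sup>2) * f (Complex x y) \<partial>lborel \<partial>lborel)
      = (\<integral>\<^sup>+r. F (exp r) \<partial>lborel)"
    by (simp add: nn_integral_exp)
  then show ?thesis
    by (subst nn_integral_complex(2)) (simp_all add: hyp_integral_def F_def)
qed

lemma hyp_integral_translate: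
  assumes [measurable]: "f \<in> borel_measurable borel"
  shows "hyp_integral (\<lambda>z. f (z + of_real b)) = hyp_integral f"
proof -
  have "(\<integral>\<^sup>+\<xi>. f (of_real (exp r) * Complex \<xi> 1) \<partial>lborel)
      = (\<integral>\<^sup>+\<xi>. f (of_real (exp r) * Complex \<xi> 1 + of_real b) \<partial>lborel)" for r
  proof -
    have "(\<integral>\<^sup>+\<xi>. f (of_real (exp r) * Complex \<xi> 1) \<partial>lborel)
        = ennreal \<bar>1\<bar> * (\<integral>\<^sup>+\<xi>. f (of_real (exp r) * Complex (b * exp (- r) + 1 * \<xi>) 1) \<partial>lborel)"
      by (rule nn_integral_real_affine) auto
    moreover have "of_real (exp r) * Complex (b * exp (- r) + 1 * \<xi>) 1
      = of_real (exp r) * Complex \<xi> 1 + of_real b" for \<xi>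
      by (simp add: complex_eq_iff exp_minus field_simps)
    ultimately show ?thesis by simp
  qed
  then show ?thesis
    by (simp add: hyp_integral_def)
qed

lemma hyp_integral_scale:
  assumes [measurable]: "f \<in> borel_measurable borel" and k: "k > 0"
  shows "hyp_integral (\<lambda>z. f (of_real k * z)) = hyp_integral f"
proof -
  have "hyp_integral f
    = ennreal \<bar>1\<bar> * (\<integral>\<^sup>+r. \<integral>\<^sup>+\<xi>. f (of_real (exp (ln k + 1 * r)) * Complex \<xi> 1) \<partial>lborel \<partial>lborel)"
    unfolding hyp_integral_def by (rule nn_integral_real_affine) auto
  also have "\<dots> = hyp_integral (\<lambda>z. f (of_real k * z))"
    using k by (simp add: hyp_integral_def exp_add mult.assoc)
  finally show ?thesis by simp
qed

text \<open>
  With $z = e^r(\xi+i)$, the point $-1/z$ has the coordinates $-\xi$ and $-r-\ln(1+\xi^2)$: for fixed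
  $\xi$ a reflection in $r$.
\<close>

lemma hyp_integral_inversion:
  assumes [measurable]: "f \<in> borel_measurable borel"
  shows "hyp_integral (\<lambda>z. f (- 1 / z)) = hyp_integral f"
proof -
  define G where "G \<xi> = (\<integral>\<^sup>+r. f (of_real (exp r) * Complex \<xi> 1) \<partial>lborel)" for \<xi>
  have [measurable]: "G \<in> borel_measurable borel"
    unfolding G_def by measurable
  have swap: "hyp_integral g = (\<integral>\<^sup>+\<xi>. \<integral>\<^sup>+r. g (of_real (exp r) * Complex \<xi> 1) \<partial>lborel \<partial>lborel)"
    if [measurable]: "g \<in> borel_measurable borel" for g
    unfolding hyp_integral_def by (rule lborel_pair.Fubini') measurable
  have "(\<integral>\<^sup>+r. f (- 1 / (of_real (exp r) * Complex \<xi> 1)) \<partial>lborel) = G (- \<xi>)" for \<xi>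
  proof -
    have pos: "1 + \<xi>\<^sup>2 > 0"
      by (rule add_pos_nonneg) auto
    have "G (- \<xi>)
      = ennreal \<bar>- 1\<bar> * (\<integral>\<^sup>+r. f (of_real (exp (- ln (1 + \<xi>\<^sup>2) + - 1 * r)) * Complex (- \<xi>) 1) \<partial>lborel)"
      unfolding G_def by (rule nn_integral_real_affine) auto
    moreover have "of_real (exp (- ln (1 + \<xi>\<^sup>2) + - 1 * r)) * Complex (- \<xi>) 1
      = - 1 / (of_real (exp r) * Complex \<xi> 1)" for r
    proof -
      have "Complex (- \<xi>) 1 * Complex \<xi> 1 = - of_real (1 + \<xi>\<^sup>2)"
        by (simp add: complex_eq_iff power2_eq_square)
      then have B: "Complex (- \<xi>) 1 = - of_real (1 + \<xi>\<^sup>2) / Complex \<xi> 1"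
        by (subst eq_divide_eq) (simp add: complex_eq_iff)
      have "Complex \<xi> 1 \<noteq> 0" "complex_of_real (1 + \<xi>\<^sup>2) \<noteq> 0"
        using pos by (auto simp: complex_eq_iff)
      moreover have "complex_of_real (exp (- ln (1 + \<xi>\<^sup>2) + - 1 * r))
        = 1 / (of_real (1 + \<xi>\<^sup>2) * of_real (exp r))"
      proof -
        have "exp (- ln (1 + \<xi>\<^sup>2) + - 1 * r) = 1 / ((1 + \<xi>\<^sup>2) * exp r)"
          using pos by (simp add: exp_minus exp_diff divide_inverse)
        then show ?thesis
          by (simp only: of_real_divide of_real_mult of_real_1)
      qed
      ultimately show ?thesis
        by (simp only: B) (simp add: mult_ac del: of_real_add of_real_power)
    qed
    ultimately show ?thesis by (simp only:) simp
  qed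
  then have "hyp_integral (\<lambda>z. f (- 1 / z)) = (\<integral>\<^sup>+\<xi>. G (- \<xi>) \<partial>lborel)"
    by (subst swap) simp_all
  also have "(\<integral>\<^sup>+\<xi>. G \<xi> \<partial>lborel) = ennreal \<bar>- 1\<bar> * (\<integral>\<^sup>+\<xi>. G (0 + - 1 * \<xi>) \<partial>lborel)"
    by (rule nn_integral_real_affine) auto
  then have "(\<integral>\<^sup>+\<xi>. G (- \<xi>) \<partial>lborel) = (\<integral>\<^sup>+\<xi>. G \<xi> \<partial>lborel)"
    by simp
  also have "\<dots> = hyp_integral f"
    by (subst swap) (simp_all add: G_def[abs_def])
  finally show ?thesis .
qed

text \<open>
  For $c \ne 0$ a Moebius map is
  $\frac ac + \frac1{c^2}\cdot\frac{-1}{z + d/c}$, a composition of translations, a scaling and the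
  inversion; for \<open>c = 0\<close> it is affine.
\<close>

lemma hyp_integral_act:
  assumes [measurable]: "f \<in> borel_measurable borel"
  shows "hyp_integral (\<lambda>z. f (act g z)) = hyp_integral f"
proof -
  obtain a b c d where g: "a * d - b * c = 1" "g = psl a b c d" by (rule psl_cases)
  show ?thesis
  proof (cases "c = 0")
    case True
    then have "a * d = 1"
      using g(1) by simp
    then have d: "d = 1 / a" "a \<noteq> 0"
      by (auto simp: eq_divide_eq mult.commute)
    have "act g z = of_real (a\<^sup>2) * z + of_real (a * b)" for z
      using act_psl[OF g(1), of z] d(2) by (simp add: g(2) True d(1) power2_eq_square field_simps)
    then have "hyp_integral (\<lambda>z. f (act g z)) = hyp_integral (\<lambda>z. f (of_real (a\<^sup>2) * z + of_real (a * b)))"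
      by (simp only:)
    also have "\<dots> = hyp_integral (\<lambda>z. f (z + of_real (a * b)))"
      by (rule hyp_integral_scale) (use d in auto)
    also have "\<dots> = hyp_integral f"
      by (rule hyp_integral_translate) simp
    finally show ?thesis .
  next
    case False
    have "act g z = of_real (1 / c\<^sup>2) * (- 1 / (z + of_real (d / c))) + of_real (a / c)" if "z \<in> hplane" for z
    proof -
      have nz: "of_real c * z + of_real d \<noteq> 0"
        using linear_form_nz[OF g(1)] that by (simp add: hplane_def)
      have e: "(of_real a * z + of_real b) * of_real c - of_real a * (of_real c * z + of_real d)
        = (- 1 :: complex)"
        using arg_cong[OF g(1), of complex_of_real] by (simp add: algebra_simps)
      have "act g z - of_real (a / c) = - 1 / ((of_real c * z + of_real d) * of_real c)"
        unfolding g(2) act_psl[OF g(1)] of_real_divide using nz False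
        by (subst diff_frac_eq) (simp_all only: of_real_eq_0_iff e not_False_eq_True)
      also have "(of_real c * z + of_real d) * of_real c = of_real (c\<^sup>2) * (z + of_real (d / c))"
        using False by (simp add: power2_eq_square field_simps)
      finally show ?thesis
        by (simp add: algebra_simps)
    qed
    then have "hyp_integral (\<lambda>z. f (act g z)) =
        hyp_integral (\<lambda>z. f (of_real (1 / c\<^sup>2) * (- 1 / (z + of_real (d / c))) + of_real (a / c)))"
      by (intro hyp_integral_cong) (simp only:)
    also have "\<dots> = hyp_integral (\<lambda>z. f (of_real (1 / c\<^sup>2) * (- 1 / z) + of_real (a / c)))"
      by (rule hyp_integral_translate) measurable
    also have "\<dots> = hyp_integral (\<lambda>z. f (of_real (1 / c\<^sup>2) * z + of_real (a / c)))"
      by (rule hyp_integral_inversion) measurable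
    also have "\<dots> = hyp_integral (\<lambda>z. f (z + of_real (a / c)))"
      by (rule hyp_integral_scale) (use False in auto)
    also have "\<dots> = hyp_integral f"
      by (rule hyp_integral_translate) simp
    finally show ?thesis .
  qed
qed

lemma harea_eq_nn_integral:
  assumes [measurable]: "S \<in> sets borel"
  shows "harea S = enn2real (\<integral>\<^sup>+z. ennreal (1 / (Im z)\<^sup>2) * indicator S z \<partial>lborel)"
proof -
  have "harea S = enn2real (\<integral>\<^sup>+z. ennreal (indicator S z *\<^sub>R (1 / (Im z)\<^sup>2)) \<partial>lborel)"
    unfolding harea_def set_lebesgue_integral_def
    by (rule integral_eq_nn_integral) auto
  also have "(\<lambda>z. ennreal (indicator S z *\<^sub>R (1 / (Im z)\<^sup>2))) = (\<lambda>z. ennreal (1 / (Im z)\<^sup>2) * indicator S z)"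
    by (auto simp: indicator_def)
  finally show ?thesis .
qed

lemma harea_eq_hyp_integral:
  assumes "S \<in> sets borel" "S \<subseteq> hplane"
  shows "harea S = enn2real (hyp_integral (indicator S))"
  unfolding harea_eq_nn_integral[OF assms(1)]
  by (subst hyp_integral_eq_lborel) (use assms in \<open>auto simp: indicator_def\<close>)

lemma borel_measurable_act [measurable]: "act g \<in> borel_measurable borel"
proof -
  obtain a b c d where g: "a * d - b * c = 1" "g = psl a b c d" by (rule psl_cases)
  show ?thesis
    unfolding g(2) act_psl[OF g(1), abs_def] by measurable
qed

lemma hplane_borel [measurable]: "hplane \<in> sets borel"
  by (simp add: hplane_def open_halfspace_Im_gt)

lemma harea_act:
  assumes S: "S \<in> sets borel" "S \<subseteq> hplane" and T: "T \<subseteq> hplane"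
    and eq: "\<And>z. z \<in> hplane \<Longrightarrow> act g z \<in> S \<longleftrightarrow> z \<in> T"
  shows "harea T = harea S"
proof -
  have "T = act g -` S \<inter> hplane"
    using eq T by auto
  moreover have "act g -` S \<in> sets borel"
    using measurable_sets_borel[OF borel_measurable_act S(1)] by simp
  ultimately have Tb: "T \<in> sets borel"
    by simp
  have "hyp_integral (indicator T) = hyp_integral (\<lambda>z. indicator S (act g z))"
    by (rule hyp_integral_cong) (simp add: eq indicator_def)
  also have "\<dots> = hyp_integral (indicator S)"
    by (rule hyp_integral_act) (use S(1) in auto)
  finally show ?thesis
    by (simp add: harea_eq_hyp_integral S T Tb)
qed

section \<open>Area of triangles with vertices in the plane\<close>

text \<open>
  The map $z \mapsto (\mathrm{Re}\,z, |z|^2)$ is a Klein model of the plane, in which geodesics are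
  straight; the condition says that the image of \<open>z\<close> lies on the segment between the images of \<open>A\<close> and
  \<open>B\<close>.
\<close>

definition klein_between :: "complex \<Rightarrow> complex \<Rightarrow> complex \<Rightarrow> bool" where
  "klein_between A z B \<longleftrightarrow> (\<exists>\<tau>\<in>{0..1}. Re z = (1 - \<tau>) * Re A + \<tau> * Re B \<and>
    (cmod z)\<^sup>2 = (1 - \<tau>) * (cmod A)\<^sup>2 + \<tau> * (cmod B)\<^sup>2)"

text \<open>
  Isometries act projectively in the Klein model: $|cz+d|^2 (1, \mathrm{Re}\,gz, |gz|^2)$ is linear in
  $(1, \mathrm{Re}\,z, |z|^2)$. A convex combination is therefore taken to another one, with weights
  rescaled by the factors \<open>J\<close>.
\<close>

lemma klein_between_act:
  assumes H: "A \<in> hplane" "z \<in> hplane" "B \<in> hplane" and "klein_between A z B"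
  shows "klein_between (act g A) (act g z) (act g B)"
proof -
  obtain \<tau> where \<tau>: "0 \<le> \<tau>" "\<tau> \<le> 1" "Re z = (1 - \<tau>) * Re A + \<tau> * Re B"
    "(cmod z)\<^sup>2 = (1 - \<tau>) * (cmod A)\<^sup>2 + \<tau> * (cmod B)\<^sup>2"
    using assms(4) by (auto simp: klein_between_def)
  obtain a b c d where g: "a * d - b * c = 1" "g = psl a b c d" by (rule psl_cases)
  define J where "J w = c\<^sup>2 * (cmod w)\<^sup>2 + 2 * c * d * Re w + d\<^sup>2" for w
  have J: "J w = (cmod (of_real c * w + of_real d))\<^sup>2" for w
    unfolding J_def cmod_power2 by (simp add: power2_eq_square algebra_simps)
  have Jpos: "J w > 0" if "w \<in> hplane" for w
    unfolding J using linear_form_nz[OF g(1)] that by (simp add: hplane_def)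
  have Re: "Re (act g w) = (a * c * (cmod w)\<^sup>2 + (a * d + b * c) * Re w + b * d) / J w" for w
    unfolding g(2) act_psl[OF g(1)] Re_divide J cmod_power2
    by (simp add: power2_eq_square algebra_simps)
  have cmod: "(cmod (act g w))\<^sup>2 = (a\<^sup>2 * (cmod w)\<^sup>2 + 2 * a * b * Re w + b\<^sup>2) / J w" for w
    unfolding g(2) act_psl[OF g(1)] J norm_divide power_divide cmod_power2
    by (simp add: power2_eq_square algebra_simps)
  \<comment> \<open>The weight of \<open>B\<close> after normalising the homogeneous coordinates.\<close>
  define \<mu> where "\<mu> = \<tau> * J B / J z"
  have Jz: "J z = (1 - \<tau>) * J A + \<tau> * J B"
    unfolding J_def \<tau>(3,4) by (simp add: algebra_simps)
  have \<mu>': "1 - \<mu> = (1 - \<tau>) * J A / J z"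
    using Jpos[OF H(2)] by (simp add: \<mu>_def Jz field_simps)
  have *: "(1 - \<mu>) * (X / J A) + \<mu> * (Y / J B) = ((1 - \<tau>) * X + \<tau> * Y) / J z" for X Y
    unfolding \<mu>' unfolding \<mu>_def using Jpos[OF H(1)] Jpos[OF H(3)] by (simp add: add_divide_distrib)
  show ?thesis
    unfolding klein_between_def
  proof (intro bexI[of _ \<mu>] conjI)
    show "\<mu> \<in> {0..1}"
    proof -
      have "0 \<le> \<mu>" "0 \<le> 1 - \<mu>"
        unfolding \<mu>' unfolding \<mu>_def
        using \<tau>(1,2) Jpos[OF H(1)] Jpos[OF H(2)] Jpos[OF H(3)] by simp_all
      then show ?thesis by simp
    qed
    show "Re (act g z) = (1 - \<mu>) * Re (act g A) + \<mu> * Re (act g B)"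
      unfolding Re * by (simp add: \<tau>(3,4) algebra_simps)
    show "(cmod (act g z))\<^sup>2 = (1 - \<mu>) * (cmod (act g A))\<^sup>2 + \<mu> * (cmod (act g B))\<^sup>2"
      unfolding cmod * by (simp add: \<tau>(3,4) algebra_simps)
  qed
qed

lemma klein_between_act_iff:
  assumes H: "A \<in> hplane" "z \<in> hplane" "B \<in> hplane"
  shows "klein_between (act g A) (act g z) (act g B) \<longleftrightarrow> klein_between A z B"
proof -
  obtain h where h: "h * g = 1"
    using psl2r_inverse[of g] by blast
  show ?thesis
    using klein_between_act[of A z B g] klein_between_act[of "act g A" "act g z" "act g B" h] H
      act_inverse[OF h]
    by auto
qed

lemma klein_between_imaginary_axis:
  assumes "L \<ge> 0" "z \<in> hplane"
  shows "klein_between (Complex 0 1) z (Complex 0 (exp L)) \<longleftrightarrow> (\<exists>r\<in>{0..L}. z = Complex 0 (exp r))"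
proof
  assume "klein_between (Complex 0 1) z (Complex 0 (exp L))"
  then obtain \<tau> where \<tau>: "0 \<le> \<tau>" "\<tau> \<le> 1" "Re z = 0" "(Im z)\<^sup>2 = (1 - \<tau>) + \<tau> * (exp L)\<^sup>2"
    by (auto simp: klein_between_def cmod_power2)
  have z: "Im z > 0"
    using assms(2) by (simp add: hplane_def)
  have E: "1 \<le> (exp L)\<^sup>2"
    using assms(1) by (simp add: one_le_power)
  have "(1 - \<tau>) * 1 + \<tau> * 1 \<le> (1 - \<tau>) * 1 + \<tau> * (exp L)\<^sup>2"
    using \<tau>(1) E by (intro add_left_mono mult_left_mono) auto
  then have "1\<^sup>2 \<le> (Im z)\<^sup>2"
    by (simp add: \<tau>(4))
  moreover have "(1 - \<tau>) * 1 + \<tau> * (exp L)\<^sup>2 \<le> (1 - \<tau>) * (exp L)\<^sup>2 + \<tau> * (exp L)\<^sup>2"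
    using \<tau>(2) E by (intro add_right_mono mult_left_mono) auto
  then have "(Im z)\<^sup>2 \<le> (exp L)\<^sup>2"
    by (simp add: \<tau>(4) algebra_simps)
  ultimately have "1 \<le> Im z" "Im z \<le> exp L"
    using z power2_le_imp_le[of 1 "Im z"] power2_le_imp_le[of "Im z" "exp L"] by auto
  moreover have "ln (Im z) \<le> ln (exp L)"
    using z \<open>Im z \<le> exp L\<close> by (subst ln_le_cancel_iff) auto
  ultimately have "ln (Im z) \<in> {0..L}" "z = Complex 0 (exp (ln (Im z)))"
    using z \<tau>(3) by (auto simp: complex_eq_iff)
  then show "\<exists>r\<in>{0..L}. z = Complex 0 (exp r)" ..
next
  assume "\<exists>r\<in>{0..L}. z = Complex 0 (exp r)"
  then obtain r where r: "0 \<le> r" "r \<le> L" "z = Complex 0 (exp r)"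
    by auto
  have *: "1 \<le> (exp r)\<^sup>2" "(exp r)\<^sup>2 \<le> (exp L)\<^sup>2"
    using r by (simp_all add: one_le_power)
  show "klein_between (Complex 0 1) z (Complex 0 (exp L))"
  proof (cases "L = 0")
    case True
    then show ?thesis
      using r unfolding klein_between_def by (intro bexI[of _ 0]) auto
  next
    case False
    then have pos: "(exp L)\<^sup>2 - 1 > 0"
      using assms(1) by (simp add: one_less_power)
    \<comment> \<open>The barycentric coordinate of \<open>z\<close>, since heights enter the Klein model squared.\<close>
    define t where "t = ((exp r)\<^sup>2 - 1) / ((exp L)\<^sup>2 - 1)"
    have "t * ((exp L)\<^sup>2 - 1) = (exp r)\<^sup>2 - 1"
      using pos by (simp add: t_def)
    then have "(exp r)\<^sup>2 = (1 - t) + t * (exp L)\<^sup>2"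
      by (simp add: algebra_simps)
    moreover have "t \<in> {0..1}"
      using pos * by (simp add: t_def)
    ultimately show ?thesis
      unfolding klein_between_def using r(3) by (intro bexI[of _ t]) (auto simp: cmod_power2)
  qed
qed

text \<open>
  Any geodesic through \<open>A\<close> and \<open>B\<close> has to agree with \<open>gline g\<close> between them, because its points have the
  right distances from \<open>A\<close> and \<open>B\<close>.
\<close>

lemma hsegment_gline:
  assumes AB: "A \<in> hplane" "B \<in> hplane" and g: "gline g 0 = A" "gline g (hdist A B) = B"
  shows "P \<in> hsegment (Pt A) (Pt B) \<longleftrightarrow> (\<exists>r\<in>{0..hdist A B}. P = Pt (gline g r))"
proof
  assume "P \<in> hsegment (Pt A) (Pt B)"
  then obtain h s r t where *: "s \<le> r" "r \<le> t" "line_point h s = Pt A" "P = line_point h r"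
    "line_point h t = Pt B"
    unfolding hsegment_iff by metis
  obtain s' where s: "s = ereal s'" "gline h s' = A"
    using line_point_eq_Pt_hplane[OF *(3) AB(1)] .
  obtain t' where t: "t = ereal t'" "gline h t' = B"
    using line_point_eq_Pt_hplane[OF *(5) AB(2)] .
  obtain r' where r: "r = ereal r'" "s' \<le> r'" "r' \<le> t'"
    using *(1,2) s t by (cases r) auto
  have L: "hdist A B = t' - s'"
    using hdist_gline[of h s' t'] s t r by simp
  have "gline h r' = gline g (r' - s')"
  proof (cases "hdist A B = 0")
    case True
    then show ?thesis
      using L r s g by simp
  next
    case False
    show ?thesis
    proof (rule hplane_point_determined[OF _ False])
      show "hdist (gline g 0) (gline h r') = \<bar>r' - s'\<bar>"
        unfolding g s(2)[symmetric] hdist_gline by simp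
      show "hdist (gline g (hdist A B)) (gline h r') = \<bar>hdist A B - (r' - s')\<bar>"
      proof -
        have "gline g (hdist A B) = gline h t'"
          using g(2) t(2) by simp
        then show ?thesis
          by (simp add: hdist_gline L)
      qed
    qed simp
  qed
  then show "\<exists>r\<in>{0..hdist A B}. P = Pt (gline g r)"
    using r L *(4) by (intro bexI[of _ "r' - s'"]) auto
next
  assume "\<exists>r\<in>{0..hdist A B}. P = Pt (gline g r)"
  then obtain r where "r \<in> {0..hdist A B}" "P = Pt (gline g r)" ..
  then show "P \<in> hsegment (Pt A) (Pt B)"
    unfolding hsegment_iff using g
    by (intro exI[of _ g] exI[of _ 0] exI[of _ "ereal r"] exI[of _ "ereal (hdist A B)"]) auto
qed

lemma hsegment_iff_klein_between:
  assumes AB: "A \<in> hplane" "B \<in> hplane"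
  shows "Pt z \<in> hsegment (Pt A) (Pt B) \<longleftrightarrow> z \<in> hplane \<and> klein_between A z B"
proof -
  obtain g where g: "gline g 0 = A" "gline g (hdist A B) = B"
    using gline_through[OF AB] .
  have "Pt z \<in> hsegment (Pt A) (Pt B) \<longleftrightarrow> (\<exists>r\<in>{0..hdist A B}. z = gline g r)"
    by (simp add: hsegment_gline[OF AB g])
  also have "\<dots> \<longleftrightarrow> z \<in> hplane \<and> klein_between A z B"
  proof (cases "z \<in> hplane")
    case True
    then obtain w where w: "w \<in> hplane" "act g w = z"
      using act_surj by blast
    have "klein_between A z B \<longleftrightarrow> klein_between (Complex 0 1) w (Complex 0 (exp (hdist A B)))"
      using klein_between_act_iff[of "Complex 0 1" w "Complex 0 (exp (hdist A B))" g] w g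
      by (simp add: gline_def)
    then show ?thesis
      using w(1) hdist_nonneg[OF AB] by (simp add: klein_between_imaginary_axis gline_def flip: w(2))
  qed auto
  finally show ?thesis .
qed

lemma nn_integral_inverse_square:
  assumes "0 < h" "h \<le> k"
  shows "(\<integral>\<^sup>+y. ennreal (1 / y\<^sup>2) * indicator {h..k} y \<partial>lborel) = ennreal (1 / h - 1 / k)"
proof -
  have "(\<integral>\<^sup>+y. ennreal (1 / y\<^sup>2) * indicator {h..k} y \<partial>lborel) = (- 1 / k) - (- 1 / h)"
    by (rule nn_integral_FTC_Icc)
      (use assms in \<open>auto intro!: derivative_eq_intros simp: power2_eq_square\<close>)
  then show ?thesis by simp
qed

lemma harea_between_graphs:
  assumes ab: "a \<le> b"
    and h: "\<And>x. x \<in> {a..b} \<Longrightarrow> 0 < h x" "\<And>x. x \<in> {a..b} \<Longrightarrow> h x \<le> k x"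
    and [measurable]: "h \<in> borel_measurable borel" "k \<in> borel_measurable borel"
    and G: "\<And>x. x \<in> {a..b} \<Longrightarrow> DERIV G x :> 1 / h x"
    and K: "\<And>x. x \<in> {a..b} \<Longrightarrow> DERIV K x :> 1 / k x"
  shows "harea {z. a \<le> Re z \<and> Re z \<le> b \<and> h (Re z) \<le> Im z \<and> Im z \<le> k (Re z)}
    = (G b - K b) - (G a - K a)" (is "harea ?S = _")
proof -
  have [measurable]: "?S \<in> sets borel"
    by measurable
  have "(\<integral>\<^sup>+z. ennreal (1 / (Im z)\<^sup>2) * indicator ?S z \<partial>lborel)
      = (\<integral>\<^sup>+x. \<integral>\<^sup>+y. ennreal (1 / y\<^sup>2) * indicator ?S (Complex x y) \<partial>lborel \<partial>lborel)"
    by (subst nn_integral_complex(1)) simp_all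
  also have "\<dots> = (\<integral>\<^sup>+x. ennreal (1 / h x - 1 / k x) * indicator {a..b} x \<partial>lborel)"
  proof (rule nn_integral_cong)
    fix x
    show "(\<integral>\<^sup>+y. ennreal (1 / y\<^sup>2) * indicator ?S (Complex x y) \<partial>lborel)
        = ennreal (1 / h x - 1 / k x) * indicator {a..b} x"
    proof (cases "x \<in> {a..b}")
      case True
      have "indicator ?S (Complex x y) = (indicator {h x..k x} y :: ennreal)" for y
        using True by (simp add: indicator_def)
      then show ?thesis
        using nn_integral_inverse_square[OF h[OF True]] True by simp
    next
      case False
      have "indicator ?S (Complex x y) = (0 :: ennreal)" for y
        using False by (auto simp: indicator_def)
      then show ?thesis
        using False by simp
    qed
  qed
  also have "\<dots> = ennreal ((G b - K b) - (G a - K a))"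
  proof (rule nn_integral_FTC_Icc)
    fix x assume x: "x \<in> {a..b}"
    show "DERIV (\<lambda>x. G x - K x) x :> 1 / h x - 1 / k x"
      by (intro DERIV_diff G K x)
    show "0 \<le> 1 / h x - 1 / k x"
      using h[OF x] by (simp add: frac_le)
  qed (use ab in auto)
  finally have "harea ?S = enn2real (ennreal ((G b - K b) - (G a - K a)))"
    by (simp add: harea_eq_nn_integral)
  moreover have "(\<lambda>x. G x - K x) a \<le> (\<lambda>x. G x - K x) b"
  proof (rule DERIV_nonneg_imp_nondecreasing[OF ab])
    fix x assume "a \<le> x" "x \<le> b"
    then have x: "x \<in> {a..b}" by simp
    then have "DERIV (\<lambda>x. G x - K x) x :> 1 / h x - 1 / k x" "0 \<le> 1 / h x - 1 / k x"
      using h[OF x] by (auto intro!: DERIV_diff G K simp: frac_le)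
    then show "\<exists>y. DERIV (\<lambda>x. G x - K x) x :> y \<and> 0 \<le> y" by blast
  qed
  ultimately show ?thesis by simp
qed

text \<open>
  The height of the geodesic whose points satisfy $|z|^2 = \alpha + \beta\,\mathrm{Re}\,z$, a line in the Klein
  model.
\<close>

definition chord :: "real \<Rightarrow> real \<Rightarrow> real \<Rightarrow> real" where
  "chord \<alpha> \<beta> x = sqrt (\<alpha> + \<beta> * x - x\<^sup>2)"

text \<open>
  Along a geodesic $dx/y$ is minus the differential of the direction: for $x = m + R\cos\varphi$ and
  $y = R\sin\varphi$ one has $dx/y = -d\varphi$.
\<close>

lemma DERIV_turning_chord:
  assumes pos: "\<alpha> + \<beta> * x0 - x0\<^sup>2 > 0" "\<alpha> + \<beta> * x - x\<^sup>2 > 0"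
  shows "DERIV (\<lambda>x. - turning (Complex x0 (chord \<alpha> \<beta> x0)) (Complex x (chord \<alpha> \<beta> x))) x :> 1 / chord \<alpha> \<beta> x"
proof -
  define h h0 where "h = chord \<alpha> \<beta> x" and "h0 = chord \<alpha> \<beta> x0"
  have h: "h > 0" "h0 > 0" "h\<^sup>2 = \<alpha> + \<beta> * x - x\<^sup>2" "h0\<^sup>2 = \<alpha> + \<beta> * x0 - x0\<^sup>2"
    using pos by (auto simp: h_def h0_def chord_def)
  let ?D = "\<lambda>h'. - (2 * ((- (h0 + h) - (x0 - x) * h') / (h0 + h)\<^sup>2 / (1 + ((x0 - x) / (h0 + h))\<^sup>2)))"
  define h' where "h' = (\<beta> / 2 - x) / h"
  have "DERIV (chord \<alpha> \<beta>) x :> h'"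
    unfolding chord_def[abs_def] h'_def h_def using pos(2)
    by (auto intro!: derivative_eq_intros simp: field_simps)
  then have "DERIV (\<lambda>x. (x0 - x) / (h0 + chord \<alpha> \<beta> x)) x :> (- (h0 + h) - (x0 - x) * h') / (h0 + h)\<^sup>2"
    using h(1,2) by (auto intro!: derivative_eq_intros simp: h_def[symmetric] power2_eq_square)
  from DERIV_minus[OF DERIV_cmult[OF DERIV_chain2[OF DERIV_arctan this], of 2]]
  have "DERIV (\<lambda>x. - (2 * arctan ((x0 - x) / (h0 + chord \<alpha> \<beta> x)))) x
      :> ?D h'"
    by (simp only: h_def[symmetric] divide_inverse mult_ac)
  moreover have "?D h' = 1 / h"
  proof -
    have pos: "h0 + h > 0" "(h0 + h)\<^sup>2 + (x0 - x)\<^sup>2 > 0"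
      using h by (auto intro: add_pos_nonneg)
    have "(h0 + h)\<^sup>2 * (1 + ((x0 - x) / (h0 + h))\<^sup>2) = (h0 + h)\<^sup>2 + (x0 - x)\<^sup>2"
      using pos by (simp add: power_divide distrib_left)
    then have "?D h'
       = 2 * ((h0 + h) + (x0 - x) * h') / ((h0 + h)\<^sup>2 + (x0 - x)\<^sup>2)"
      by (simp add: divide_divide_eq_left minus_divide_left) 
    also have "\<dots> = 1 / h"
    proof -
      have "h * h' = \<beta> / 2 - x"
        using h by (simp add: h'_def)
      moreover have "2 * ((h0 + h) + (x0 - x) * h') * h = 2 * h0 * h + 2 * h\<^sup>2 + (x0 - x) * (2 * (h * h'))"
        by (simp add: algebra_simps power2_eq_square)
      ultimately have "2 * ((h0 + h) + (x0 - x) * h') * h = 2 * h0 * h + 2 * h\<^sup>2 + (x0 - x) * (\<beta> - 2 * x)"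
        by simp
      also have "\<dots> = (h0 + h)\<^sup>2 + (x0 - x)\<^sup>2"
        unfolding power2_sum h(3,4) by (simp add: algebra_simps power2_eq_square)
      finally show ?thesis
        using h(1) pos(2) by (subst frac_eq_eq) auto
    qed
    finally show ?thesis .
  qed
  ultimately show ?thesis
    by (simp add: turning_def h_def h0_def)
qed

text \<open>
  A chord of the Klein model stays inside the region $|z|^2 > (\mathrm{Re}\,z)^2$, by convexity of the
  square.
\<close>

lemma chord_above_boundary:
  assumes A: "A \<in> hplane" "Re A < 0" and x: "x \<in> {Re A..0}" and a: "a > 0"
  shows "0 < a + ((cmod A)\<^sup>2 - a) / Re A * x - x\<^sup>2"
proof -
  have y0: "Im A > 0"
    using A(1) by (simp add: hplane_def)
  define l where "l = x / Re A"
  have xl: "x = l * Re A"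
    using A(2) by (simp add: l_def)
  have l: "0 \<le> l" "l \<le> 1"
    using x A(2) by (auto simp: l_def divide_nonpos_neg divide_le_eq)
  have "((cmod A)\<^sup>2 - a) / Re A * x = ((cmod A)\<^sup>2 - a) * l"
    using A(2) by (simp add: l_def)
  then have "a + ((cmod A)\<^sup>2 - a) / Re A * x - x\<^sup>2 = (1 - l) * a + l * ((Im A)\<^sup>2 + (1 - l) * (Re A)\<^sup>2)"
    by (simp only:) (simp add: xl cmod_power2, simp add: power2_eq_square algebra_simps)
  also have "\<dots> > 0"
  proof (cases "l = 1")
    case False
    then show ?thesis
      using l a y0 by (intro add_pos_nonneg mult_pos_pos mult_nonneg_nonneg add_nonneg_nonneg) auto
  qed (use y0 in auto)
  finally show ?thesis .
qed

text \<open>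
  In the Klein model the join of \<open>A\<close> with a vertical segment is the Euclidean triangle between the two
  lines through \<open>A\<close>; a point of the triangle has the barycentric weight \<open>1 - Re z / Re A\<close> on the
  vertical side.
\<close>

lemma htriangle_left_of_axis:
  assumes A: "A \<in> hplane" "Re A < 0" and L: "L \<ge> 0"
  defines "u \<equiv> (cmod A)\<^sup>2"
  shows "htriangle (Pt A) (Pt (Complex 0 1)) (Pt (Complex 0 (exp L)))
    = {z. Re A \<le> Re z \<and> Re z \<le> 0 \<and> chord 1 ((u - 1) / Re A) (Re z) \<le> Im z
       \<and> Im z \<le> chord ((exp L)\<^sup>2) ((u - (exp L)\<^sup>2) / Re A) (Re z)}" (is "?T = ?S")
proof -
  have A': "Im A > 0"
    using A(1) by (simp add: hplane_def)
  have E: "1 \<le> (exp L)\<^sup>2"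
    using L by (simp add: one_le_power)
  have gl: "gline 1 s = Complex 0 (exp s)" for s
    by (simp add: gline_def)
  have IE: "Complex 0 1 \<in> hplane" "Complex 0 (exp L) \<in> hplane"
    by simp_all
  have dist: "hdist (Complex 0 1) (Complex 0 (exp L)) = L"
    using hdist_gline[of 1 0 L] L by (simp add: gl)
  have side: "Q \<in> hsegment (Pt (Complex 0 1)) (Pt (Complex 0 (exp L)))
    \<longleftrightarrow> (\<exists>r\<in>{0..L}. Q = Pt (Complex 0 (exp r)))" for Q
    using hsegment_gline[OF IE, of 1] by (simp add: gl dist)
  have T: "z \<in> ?T \<longleftrightarrow> z \<in> hplane \<and> (\<exists>r\<in>{0..L}. klein_between A z (Complex 0 (exp r)))" for z
    unfolding htriangle_def mem_Collect_eq Bex_def side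
    using hsegment_iff_klein_between[OF A(1)] by auto
  have kb: "(\<exists>r\<in>{0..L}. klein_between A z (Complex 0 (exp r))) \<longleftrightarrow> Re A \<le> Re z \<and> Re z \<le> 0 \<and>
      1 + (u - 1) / Re A * Re z \<le> (cmod z)\<^sup>2 \<and> (cmod z)\<^sup>2 \<le> (exp L)\<^sup>2 + (u - (exp L)\<^sup>2) / Re A * Re z" for z
  proof -
    \<comment> \<open>The weight of the vertical side at \<open>z\<close>.\<close>
    define l where "l = 1 - Re z / Re A"
    have l: "Re z = (1 - l) * Re A"
      using A(2) by (simp add: l_def)
    have bounds: "a + (u - a) / Re A * Re z = (1 - l) * u + l * a" for a
    proof -
      have "(u - a) / Re A * Re z = (u - a) * (1 - l)"
        using A(2) by (simp add: l_def)
      then show ?thesis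
        by (simp add: algebra_simps)
    qed
    have range: "Re A \<le> Re z \<and> Re z \<le> 0 \<longleftrightarrow> 0 \<le> l \<and> l \<le> 1"
      using A(2) unfolding l_def by (auto simp: divide_le_eq zero_le_divide_iff)
    show ?thesis
      unfolding bounds
    proof
      assume "\<exists>r\<in>{0..L}. klein_between A z (Complex 0 (exp r))"
      then obtain r m where r: "0 \<le> r" "r \<le> L" and m: "0 \<le> m" "m \<le> 1" "Re z = (1 - m) * Re A"
        "(cmod z)\<^sup>2 = (1 - m) * u + m * (exp r)\<^sup>2"
        by (auto simp: klein_between_def u_def cmod_power2)
      have "m = l"
        using m(3) l A(2) by simp
      moreover have "1 \<le> (exp r)\<^sup>2" "(exp r)\<^sup>2 \<le> (exp L)\<^sup>2"
        using r by (simp_all add: one_le_power)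
      ultimately show "Re A \<le> Re z \<and> Re z \<le> 0 \<and> (1 - l) * u + l * 1 \<le> (cmod z)\<^sup>2 \<and>
          (cmod z)\<^sup>2 \<le> (1 - l) * u + l * (exp L)\<^sup>2"
        using m range unfolding m(4) by (auto intro!: mult_left_mono simp del: mult_1_right)
    next
      assume R: "Re A \<le> Re z \<and> Re z \<le> 0 \<and> (1 - l) * u + l * 1 \<le> (cmod z)\<^sup>2 \<and>
          (cmod z)\<^sup>2 \<le> (1 - l) * u + l * (exp L)\<^sup>2"
      then have l01: "0 \<le> l" "l \<le> 1"
        using range by auto
      have "\<exists>q. 1 \<le> q \<and> q \<le> (exp L)\<^sup>2 \<and> (cmod z)\<^sup>2 = (1 - l) * u + l * q"
      proof (cases "l = 0")
        case True
        then show ?thesis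
          using R E by (intro exI[of _ 1]) auto
      next
        case False
        define k where "k = (1 - l) * u"
        have "l > 0"
          using False l01 by simp
        then show ?thesis
          using R unfolding k_def[symmetric]
          by (intro exI[of _ "((cmod z)\<^sup>2 - k) / l"]) (auto simp: divide_le_eq le_divide_eq mult.commute)
      qed
      then obtain q where q: "1 \<le> q" "q \<le> (exp L)\<^sup>2" "(cmod z)\<^sup>2 = (1 - l) * u + l * q"
        by blast
      define r where "r = ln q / 2"
      have e: "(exp r)\<^sup>2 = q"
        using q(1) by (simp add: r_def flip: exp_double)
      have "r \<ge> 0"
        using q(1) by (simp add: r_def)
      moreover have "exp r \<le> exp L"
        using q(2) power2_le_imp_le[of "exp r" "exp L"] by (simp add: e del: exp_le_cancel_iff)
      ultimately have "r \<in> {0..L}"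
        by simp
      moreover have "klein_between A z (Complex 0 (exp r))"
        unfolding klein_between_def using l01 l q(3)
        by (intro bexI[of _ l]) (auto simp: u_def cmod_power2 e)
      ultimately show "\<exists>r\<in>{0..L}. klein_between A z (Complex 0 (exp r))" ..
    qed
  qed
  have lower: "chord \<alpha> \<beta> (Re z) \<le> Im z \<longleftrightarrow> \<alpha> + \<beta> * Re z \<le> (cmod z)\<^sup>2"
    and upper: "Im z \<le> chord \<alpha> \<beta> (Re z) \<longleftrightarrow> (cmod z)\<^sup>2 \<le> \<alpha> + \<beta> * Re z" if "Im z > 0" for z \<alpha> \<beta>
  proof -
    have "chord \<alpha> \<beta> (Re z) \<le> Im z \<longleftrightarrow> \<alpha> + \<beta> * Re z - (Re z)\<^sup>2 \<le> (Im z)\<^sup>2"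
      using that real_sqrt_le_iff[of "\<alpha> + \<beta> * Re z - (Re z)\<^sup>2" "(Im z)\<^sup>2"] by (simp add: chord_def)
    then show "chord \<alpha> \<beta> (Re z) \<le> Im z \<longleftrightarrow> \<alpha> + \<beta> * Re z \<le> (cmod z)\<^sup>2"
      unfolding cmod_power2 by linarith
    have "Im z \<le> chord \<alpha> \<beta> (Re z) \<longleftrightarrow> (Im z)\<^sup>2 \<le> \<alpha> + \<beta> * Re z - (Re z)\<^sup>2"
      using that real_sqrt_le_iff[of "(Im z)\<^sup>2" "\<alpha> + \<beta> * Re z - (Re z)\<^sup>2"] by (simp add: chord_def)
    then show "Im z \<le> chord \<alpha> \<beta> (Re z) \<longleftrightarrow> (cmod z)\<^sup>2 \<le> \<alpha> + \<beta> * Re z"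
      unfolding cmod_power2 by linarith
  qed
  have imp: "Im z > 0" if "z \<in> ?S" for z
  proof -
    have "0 < chord 1 ((u - 1) / Re A) (Re z)"
      using chord_above_boundary[OF A, of "Re z" 1] that by (simp add: chord_def u_def)
    then show ?thesis
      using that by simp
  qed
  have "z \<in> ?T \<longleftrightarrow> z \<in> ?S" for z
  proof (cases "Im z > 0")
    case True
    then have "z \<in> hplane"
      by (simp add: hplane_def)
    then show ?thesis
      unfolding T kb mem_Collect_eq lower[OF True] upper[OF True] by simp
  next
    case False
    then show ?thesis
      using T[of z] imp[of z] unfolding hplane_def by blast
  qed
  then show ?thesis by blast
qed

text \<open>
  With the side \<open>BC\<close> on the imaginary axis and \<open>A\<close> to its left, the area is the integral of $dx/y$ over
  the lower side minus the integral over the upper one, hence a difference of turnings. The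
  side \<open>BC\<close> itself does not turn.
\<close>

lemma harea_htriangle_turning_sum:
  assumes H: "A \<in> hplane" "B \<in> hplane" "C \<in> hplane" and neg: "turning_sum A B C < 0"
  shows "harea (htriangle (Pt A) (Pt B) (Pt C)) = - turning_sum A B C"
proof -
  define L where "L = hdist B C"
  obtain g where g: "gline g 0 = B" "gline g L = C"
    using gline_through[OF H(2,3)] unfolding L_def .
  obtain D where D: "D \<in> hplane" "act g D = A"
    using act_surj[OF H(1)] .
  define I E where "I = Complex 0 1" and "E = Complex 0 (exp L)"
  have IE: "I \<in> hplane" "E \<in> hplane" "act g I = B" "act g E = C"
    using g by (simp_all add: I_def E_def gline_def)
  have turning_sum: "turning_sum A B C = turning_sum D I E"
    using turning_sum_act[OF D(1) IE(1,2), of g] D IE by simp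
  have "B \<noteq> C"
    using neg turning_swap[of B A] by (auto simp: turning_sum_def)
  then have L: "L > 0"
    using g hdist_nonneg[OF H(2,3)] unfolding L_def by (metis order_le_less)
  have "turning_sum I E D < 0"
    using neg by (simp add: turning_sum turning_sum_rotate)
  then have x0: "Re D < 0"
    using L D(1) by (simp add: I_def E_def turning_sum_imaginary_axis)
  define u where "u = (cmod D)\<^sup>2"
  define \<alpha> where "\<alpha> = (exp L)\<^sup>2"
  define S where "S = htriangle (Pt D) (Pt I) (Pt E)"
  have S: "S = {z. Re D \<le> Re z \<and> Re z \<le> 0 \<and> chord 1 ((u - 1) / Re D) (Re z) \<le> Im z
       \<and> Im z \<le> chord \<alpha> ((u - \<alpha>) / Re D) (Re z)}"
    unfolding S_def I_def E_def u_def \<alpha>_def by (rule htriangle_left_of_axis) (use D(1) x0 L in auto)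
  have [measurable]: "chord a b \<in> borel_measurable borel" for a b
    unfolding chord_def[abs_def] by measurable
  have y0: "Im D > 0"
    using D(1) by (simp add: hplane_def)
  have pos: "a + (u - a) / Re D * x - x\<^sup>2 > 0" if "x \<in> {Re D..0}" "a > 0" for a x
    unfolding u_def by (rule chord_above_boundary[OF D(1) x0 that])
  have chord_vertex: "Complex (Re D) (chord a ((u - a) / Re D) (Re D)) = D" for a
    using x0 y0 by (simp add: chord_def u_def cmod_power2 complex_eq_iff)
  have \<alpha>: "\<alpha> \<ge> 1" "\<alpha> > 0"
    using L by (auto simp: \<alpha>_def one_le_power)
  define G where "G a x = - turning D (Complex x (chord a ((u - a) / Re D) x))" for a x
  have G: "DERIV (G a) x :> 1 / chord a ((u - a) / Re D) x" if "x \<in> {Re D..0}" "a > 0" for a x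
    using DERIV_turning_chord[OF pos[of "Re D" a] pos[OF that]] x0 that(2)
    unfolding G_def[abs_def] chord_vertex by simp
  have "harea S = (G 1 0 - G \<alpha> 0) - (G 1 (Re D) - G \<alpha> (Re D))"
    unfolding S
  proof (rule harea_between_graphs)
    fix x assume x: "x \<in> {Re D..0}"
    show "0 < chord 1 ((u - 1) / Re D) x"
      using pos[OF x, of 1] by (simp add: chord_def)
    have "0 \<le> (\<alpha> - 1) * (1 - x / Re D)"
      using \<alpha> x x0 by (intro mult_nonneg_nonneg) (auto simp: divide_le_eq)
    then show "chord 1 ((u - 1) / Re D) x \<le> chord \<alpha> ((u - \<alpha>) / Re D) x"
      unfolding chord_def by (simp add: algebra_simps diff_divide_distrib)
  qed (use x0 G \<alpha> in auto)
  also have "\<dots> = - turning_sum D I E"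
  proof -
    have "G 1 0 = - turning D I" "G \<alpha> 0 = - turning D E"
      by (simp_all add: G_def chord_def I_def E_def \<alpha>_def)
    moreover have "G 1 (Re D) = 0" "G \<alpha> (Re D) = 0"
      by (simp_all add: G_def chord_vertex)
    moreover have "turning I E = 0"
      by (simp add: turning_def I_def E_def)
    ultimately show ?thesis
      using turning_swap[of E D] by (simp add: turning_sum_def)
  qed
  finally have "harea S = - turning_sum A B C"
    by (simp add: turning_sum)
  moreover have "harea (htriangle (Pt A) (Pt B) (Pt C)) = harea S"
  proof -
    obtain h where h: "h * g = 1"
      using psl2r_inverse[of g] by blast
    note inv = act_inverse[OF h]
    show ?thesis
    proof (rule harea_act)
      show "S \<in> sets borel"
        unfolding S by measurable
      show "S \<subseteq> hplane"
        unfolding S_def by (rule htriangle_subset)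
      show "act h z \<in> S \<longleftrightarrow> z \<in> htriangle (Pt A) (Pt B) (Pt C)" if "z \<in> hplane" for z
        using htriangle_act_iff[OF that, of "Pt A" "Pt B" "Pt C" h] H inv[OF D(1)] inv[OF IE(1)] inv[OF IE(2)]
        by (simp add: S_def act_bar_Pt D(2) IE(3,4) hbar_eq)
    qed (rule htriangle_subset)
  qed
  ultimately show ?thesis by simp
qed

lemma signed_area_hplane:
  assumes "A \<in> hplane" "B \<in> hplane" "C \<in> hplane"
  shows "signed_area (Pt A) (Pt B) (Pt C) = - turning_sum A B C"
  unfolding signed_area_def anticlockwise_iff_turning_sum[OF assms]
    anticlockwise_iff_turning_sum[OF assms(1,3,2)]
  using harea_htriangle_turning_sum[OF assms] harea_htriangle_turning_sum[OF assms(1,3,2)]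
    turning_sum_swap[of A B C]
  by (auto simp: htriangle_swap)

section \<open>Turning along geodesics with an end at infinity\<close>

text \<open>
  The turning of the geodesic between two points at infinity: a half circle turns by $\pm\pi$, a
  vertical line not at all; for equal points the value is \<open>0\<close>.
\<close>

definition ideal_turning :: "sphere_pt \<Rightarrow> sphere_pt \<Rightarrow> real" where
  "ideal_turning P Q = (case P of Infty \<Rightarrow> 0 | Pt z \<Rightarrow>
    (case Q of Infty \<Rightarrow> 0 | Pt w \<Rightarrow> pi * sgn (Re z - Re w)))"

lemma ideal_turning_Infty [simp]: "ideal_turning Infty Q = 0" "ideal_turning P Infty = 0"
  by (auto simp: ideal_turning_def split: sphere_pt.split)

lemma abs_diff_quotient_le:
  fixes x y a b :: real
  assumes "0 < a" "0 < b"
  shows "\<bar>(x - y) / (a + b)\<bar> \<le> \<bar>x / a\<bar> + \<bar>y / b\<bar>" "\<bar>(x - y) / (a + b)\<bar> \<le> \<bar>x / a\<bar> + \<bar>y / a\<bar>"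
proof -
  have "\<bar>(x - y) / (a + b)\<bar> \<le> \<bar>x\<bar> / (a + b) + \<bar>y\<bar> / (a + b)"
    using assms by (simp add: divide_right_mono flip: add_divide_distrib)
  moreover have "\<bar>x\<bar> / (a + b) \<le> \<bar>x\<bar> / a" "\<bar>y\<bar> / (a + b) \<le> \<bar>y\<bar> / b" "\<bar>y\<bar> / (a + b) \<le> \<bar>y\<bar> / a"
    using assms by (auto intro!: divide_left_mono)
  ultimately show "\<bar>(x - y) / (a + b)\<bar> \<le> \<bar>x / a\<bar> + \<bar>y / b\<bar>" "\<bar>(x - y) / (a + b)\<bar> \<le> \<bar>x / a\<bar> + \<bar>y / a\<bar>"
    using assms by simp_all
qed

text \<open>
  The cases where the limit is \<open>0\<close> all come from bounding the tangent of half the turning by two quantities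
  that tend to \<open>0\<close>.
\<close>

lemma turning_tendsto_0:
  assumes "(X \<longlongrightarrow> 0) F" "(Y \<longlongrightarrow> 0) F"
    and "\<And>x. \<bar>(Re (f x) - Re (g x)) / (Im (f x) + Im (g x))\<bar> \<le> \<bar>X x\<bar> + \<bar>Y x\<bar>"
  shows "((\<lambda>x. turning (f x) (g x)) \<longlongrightarrow> 0) F"
proof -
  have "((\<lambda>x. \<bar>X x\<bar> + \<bar>Y x\<bar>) \<longlongrightarrow> \<bar>0\<bar> + \<bar>0\<bar>) F"
    by (intro tendsto_intros assms(1,2))
  then have "((\<lambda>x. \<bar>X x\<bar> + \<bar>Y x\<bar>) \<longlongrightarrow> 0) F"
    by simp
  then have "((\<lambda>x. (Re (f x) - Re (g x)) / (Im (f x) + Im (g x))) \<longlongrightarrow> 0) F"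
    by (rule Lim_null_comparison[OF always_eventually, rotated]) (use assms(3) in simp)
  then have "((\<lambda>x. 2 * arctan ((Re (f x) - Re (g x)) / (Im (f x) + Im (g x)))) \<longlongrightarrow> 2 * arctan 0) F"
    by (intro tendsto_intros)
  then show ?thesis
    by (simp add: turning_def)
qed

lemma turning_tendsto_Infty:
  assumes f: "approaches f Infty F" "\<And>x. f x \<in> hplane" and g: "approaches g Q F" "\<And>x. g x \<in> hplane"
  shows "((\<lambda>x. turning (f x) (g x)) \<longlongrightarrow> 0) F"
proof -
  have pos: "Im (f x) > 0" "Im (g x) > 0" for x
    using f(2)[of x] g(2)[of x] by (auto simp: hplane_def)
  have F: "((\<lambda>x. Re (f x) / Im (f x)) \<longlongrightarrow> 0) F" "filterlim (\<lambda>x. Im (f x)) at_top F"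
    using f(1) by (auto simp: approaches_def)
  show ?thesis
  proof (cases Q)
    case Infty
    then have "((\<lambda>x. Re (g x) / Im (g x)) \<longlongrightarrow> 0) F"
      using g(1) by (simp add: approaches_def)
    then show ?thesis
      by (rule turning_tendsto_0[OF F(1)]) (rule abs_diff_quotient_le(1)[OF pos])
  next
    case (Pt w)
    have "((\<lambda>x. Re (g x) / Im (f x)) \<longlongrightarrow> 0) F"
      by (rule tendsto_divide_0[OF approaches_imp_Re[OF g[unfolded Pt]]
        filterlim_at_top_imp_at_infinity[OF F(2)]])
    then show ?thesis
      by (rule turning_tendsto_0[OF F(1)]) (rule abs_diff_quotient_le(2)[OF pos])
  qed
qed

text \<open>
  The tangent of half the turning is the difference of the real parts over the sum of the heights. At
  distinct finite limits it diverges with the sign of the difference; in the other cases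
  perpendicular approach makes it tend to \<open>0\<close>.
\<close>

lemma turning_tendsto_ideal:
  assumes f: "approaches f P F" "\<And>x. f x \<in> hplane" and g: "approaches g Q F" "\<And>x. g x \<in> hplane"
  shows "((\<lambda>x. turning (f x) (g x)) \<longlongrightarrow> ideal_turning P Q) F"
proof (cases "P = Infty \<or> Q = Infty")
  case True
  then show ?thesis
  proof
    assume "P = Infty"
    then show ?thesis
      using turning_tendsto_Infty[OF _ f(2) g] f(1) by simp
  next
    assume "Q = Infty"
    then have "((\<lambda>x. - turning (g x) (f x)) \<longlongrightarrow> - 0) F"
      using turning_tendsto_Infty[OF _ g(2) f] g(1) by (intro tendsto_minus) simp
    then show ?thesis
      using \<open>Q = Infty\<close> by (simp flip: turning_swap)
  qed
next
  case False
  then obtain z w where PQ: "P = Pt z" "Q = Pt w"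
    using sphere_pt.exhaust by metis
  have pos: "Im (f x) > 0" "Im (g x) > 0" for x
    using f(2)[of x] g(2)[of x] by (auto simp: hplane_def)
  define R where "R x = (Re (f x) - Re (g x)) / (Im (f x) + Im (g x))" for x
  show ?thesis
  proof (cases "Re z = Re w")
    case True
    have "((\<lambda>x. (Re (f x) - Re z) / Im (f x)) \<longlongrightarrow> 0) F" "((\<lambda>x. (Re (g x) - Re w) / Im (g x)) \<longlongrightarrow> 0) F"
      using f(1) g(1) by (auto simp: PQ approaches_def)
    moreover have "\<bar>R x\<bar> \<le> \<bar>(Re (f x) - Re z) / Im (f x)\<bar> + \<bar>(Re (g x) - Re w) / Im (g x)\<bar>" for x
      using abs_diff_quotient_le(1)[OF pos(1)[of x] pos(2)[of x], of "Re (f x) - Re z" "Re (g x) - Re w"]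
        by (simp add: True R_def)
    ultimately show ?thesis
      using turning_tendsto_0[of _ F _ f g] by (simp add: R_def PQ True ideal_turning_def)
  next
    case False
    have num: "((\<lambda>x. Re (f x) - Re (g x)) \<longlongrightarrow> Re z - Re w) F"
      by (intro tendsto_diff approaches_imp_Re[OF f[unfolded PQ]] approaches_imp_Re[OF g[unfolded PQ]])
    have "((\<lambda>x. Im (f x) + Im (g x)) \<longlongrightarrow> 0 + 0) F"
      using f(1) g(1) by (intro tendsto_add) (auto simp: PQ approaches_def)
    then have den: "filterlim (\<lambda>x. inverse (Im (f x) + Im (g x))) at_top F"
      using pos by (intro filterlim_inverse_at_top) (auto intro!: always_eventually add_pos_pos)
    have R: "R = (\<lambda>x. (Re (f x) - Re (g x)) * inverse (Im (f x) + Im (g x)))"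
      by (simp add: R_def divide_inverse fun_eq_iff)
    have "((\<lambda>x. arctan (R x)) \<longlongrightarrow> pi / 2 * sgn (Re z - Re w)) F"
    proof (cases "Re z > Re w")
      case True
      then have "filterlim R at_top F"
        unfolding R by (intro filterlim_tendsto_pos_mult_at_top[OF num _ den]) simp
      from filterlim_compose[OF tendsto_arctan_at_top this] show ?thesis
        using True by simp
    next
      case less: False
      then have "filterlim R at_bot F"
        unfolding R using False by (intro filterlim_tendsto_neg_mult_at_bot[OF num _ den]) simp
      from filterlim_compose[OF tendsto_arctan_at_bot this] show ?thesis
        using less False by simp
    qed
    then have "((\<lambda>x. 2 * arctan (R x)) \<longlongrightarrow> 2 * (pi / 2 * sgn (Re z - Re w))) F"
      by (intro tendsto_mult tendsto_const)
    then show ?thesis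
      by (simp add: turning_def R_def PQ ideal_turning_def)
  qed
qed

lemma turning_tendsto_from_point:
  assumes y: "y \<in> hplane" and g: "approaches g Q F" "\<And>x. g x \<in> hplane"
  shows "((\<lambda>x. turning y (g x)) \<longlongrightarrow>
    (case Q of Infty \<Rightarrow> 0 | Pt w \<Rightarrow> 2 * arctan ((Re y - Re w) / Im y))) F"
proof (cases Q)
  case (Pt w)
  have "((\<lambda>x. Im y + Im (g x)) \<longlongrightarrow> Im y + 0) F"
    using g(1) by (intro tendsto_add tendsto_const) (auto simp: Pt approaches_def)
  then have "((\<lambda>x. 2 * arctan ((Re y - Re (g x)) / (Im y + Im (g x)))) \<longlongrightarrow> 2 * arctan ((Re y - Re w) / Im y)) F"
    using y approaches_imp_Re[OF g[unfolded Pt]]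
    by (intro tendsto_mult tendsto_arctan tendsto_divide tendsto_diff tendsto_const) (auto simp: hplane_def)
  then show ?thesis
    by (simp add: Pt turning_def)
next
  case Infty
  have pos: "Im y > 0" "Im (g x) > 0" for x
    using y g(2)[of x] by (auto simp: hplane_def)
  have G: "((\<lambda>x. Re (g x) / Im (g x)) \<longlongrightarrow> 0) F" "filterlim (\<lambda>x. Im (g x)) at_top F"
    using g(1) by (auto simp: Infty approaches_def)
  have "((\<lambda>x. turning (g x) y) \<longlongrightarrow> 0) F"
    by (rule turning_tendsto_0[OF G(1) tendsto_divide_at_top[OF G(2)]])
      (rule abs_diff_quotient_le(2)[OF pos(2,1)])
  then have "((\<lambda>x. - turning (g x) y) \<longlongrightarrow> - 0) F"
    by (rule tendsto_minus)
  then show ?thesis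
    by (simp add: Infty flip: turning_swap)
qed

section \<open>The twist at infinity\<close>

lemma conjugate_exists:
  fixes m g :: psl2r
  obtains g' where "g * m = m * g'"
proof -
  obtain m' where "m' * m = 1" "m * m' = 1"
    by (rule psl2r_inverse)
  then have "m * (m' * g * m) = g * m"
    by (metis mult.assoc mult.left_neutral)
  then show ?thesis
    using that by metis
qed

text \<open>
  The twist at a point of the geodesic differs from its value at a fixed point by turnings around a
  quadrilateral. Transported by the inverse of \<open>m\<close>, the moving vertex \<open>x\<close> goes straight up, the turnings
  at its sides converge, and the limits depend on the geodesic only through its endpoint.
\<close>

lemma twist_tendsto:
  obtains r where "\<And>h. act_Infty h = act_Infty m \<Longrightarrow> ((\<lambda>s. twist a (gline h s)) \<longlongrightarrow> r) at_top"
proof -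
  obtain g where g: "proj a * m = m * g"
    using conjugate_exists[of "proj a" m] by blast
  have i: "\<i> \<in> hplane"
    by (simp add: hplane_def)
  define y where "y = act g \<i>"
  have y: "y \<in> hplane"
    using i by (simp add: y_def)
  have turning_sum_eq: "twist a (act m x) = twist a (act m \<i>) + (turning \<i> y + turning y (act g x)
      + turning (act g x) x + turning x \<i>)" if x: "x \<in> hplane" for x
  proof -
    have am: "act (proj a) (act m w) = act m (act g w)" if "w \<in> hplane" for w
      using that g by (metis act_mult)
    have "twist a (act m x) = twist a (act m \<i>)
       + (turning_sum (act m \<i>) (act m y) (act m (act g x)) + turning_sum (act m \<i>) (act m (act g x)) (act m
         x))"
      using twist_diff[of "act m \<i>" "act m x" a] x i turning_swap[of "act m \<i>" "act m (act g x)"]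
      by (simp add: am turning_sum_def y_def)
    also have "\<dots> = twist a (act m \<i>) + (turning_sum \<i> y (act g x) + turning_sum \<i> (act g x) x)"
      using x y i by (simp add: turning_sum_act)
    finally show ?thesis
      using turning_swap[of \<i> "act g x"] by (simp add: turning_sum_def)
  qed
  define l where "l = (case act_Infty g of Infty \<Rightarrow> 0 | Pt w \<Rightarrow> 2 * arctan ((Re y - Re w) / Im y))"
  \<comment> \<open>The third and fourth turnings are those of the sides at \<open>x\<close>, which tend to \<open>0\<close>.\<close>
  let ?r = "twist a (act m \<i>) + (turning \<i> y + l + 0 + - 0)"
  show ?thesis
  proof (rule that[of ?r])
    fix h assume h: "act_Infty h = act_Infty m"
    obtain m' where m': "m' * m = 1" "m * m' = 1"
      by (rule psl2r_inverse)
    define k where "k = m' * h"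
    have mk: "m * k = h"
      by (simp add: k_def m'(2) flip: mult.assoc)
    have k_inf: "act_Infty k = Infty"
    proof -
      have "act_Infty k = act_Infty (m' * m)"
        unfolding k_def act_bar_act_Infty[symmetric] h ..
      then show ?thesis
        by (simp add: m'(1) psl_one act_Infty_psl)
    qed
    obtain b c d e where kk: "b * e - c * d = 1" "k = psl b c d e" by (rule psl_cases)
    have "d = 0"
      using k_inf by (simp add: kk(2) act_Infty_psl[OF kk(1)] split: if_splits)
    define x where "x s = gline k s" for s
    have xH: "x s \<in> hplane" for s
      by (simp add: x_def)
    have x: "approaches x Infty at_top"
      unfolding x_def using gline_approaches[of k] by (simp add: k_inf)
    have Re_x: "Re (x s) = Re (x 0)" for s
      unfolding x_def kk(2) gline_psl_Re[OF kk(1)] by (simp add: \<open>d = 0\<close>)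
    have "approaches (\<lambda>s. act g (x s)) (act_Infty g) at_top"
      by (rule act_approaches[OF xH Re_x]) (use x in \<open>simp add: approaches_def\<close>)
    note gx = this act_in_hplane[OF xH]
    let ?f = "\<lambda>s. twist a (act m \<i>) + (turning \<i> y + turning y (act g (x s))
      + turning (act g (x s)) (x s) + - turning \<i> (x s))"
    have "(?f \<longlongrightarrow> ?r) at_top"
      using turning_tendsto_from_point[OF y gx] turning_tendsto_from_point[OF i x xH]
        turning_tendsto_ideal[OF gx x xH]
      by (intro tendsto_intros) (simp_all add: l_def)
    moreover have "twist a (gline h s) = ?f s" for s
      using turning_sum_eq[OF xH, of s] by (simp add: x_def flip: turning_swap gline_mult mk)
    ultimately show "((\<lambda>s. twist a (gline h s)) \<longlongrightarrow> ?r) at_top"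
      by (simp only:)
  qed
qed

lemma twist_tendsto_Tw: "((\<lambda>s. twist a (gline m s)) \<longlongrightarrow> Tw a (act_Infty m)) at_top"
proof -
  obtain r where r: "\<And>h. act_Infty h = act_Infty m \<Longrightarrow> ((\<lambda>s. twist a (gline h s)) \<longlongrightarrow> r) at_top"
    using twist_tendsto[where m = m and a = a] by blast
  have "twist_inf a (act_Infty m) = r"
    unfolding twist_inf_def
  proof (rule the_equality)
    show "\<forall>\<gamma>. geodesic_line \<gamma> \<and> passes \<gamma> \<infinity> (act_Infty m) \<longrightarrow> ((\<lambda>s. twist a (\<gamma> s)) \<longlongrightarrow> r) at_top"
      using r by (auto simp: geodesic_line_iff passes_gline)
  next
    fix r' assume "\<forall>\<gamma>. geodesic_line \<gamma> \<and> passes \<gamma> \<infinity> (act_Infty m) \<longrightarrow> ((\<lambda>s. twist a (\<gamma> s)) \<longlongrightarrow> r') at_top"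
    then have "((\<lambda>s. twist a (gline m s)) \<longlongrightarrow> r') at_top"
      by (auto simp: geodesic_line_gline passes_gline)
    then show "r' = r"
      using tendsto_unique[OF _ _ r[OF refl]] by simp
  qed
  then show ?thesis
    using r[OF refl] by (simp add: Tw_def act_Infty_circle)
qed

text \<open>
  Along the geodesic \<open>gline m\<close> the defect is a turning sum, which is transported by the inverse of \<open>m\<close>. Its
  vertices then tend to \<open>Infty\<close> and to the images of \<open>Infty\<close> under the conjugates \<open>g\<close> and \<open>h\<close>, and
  the two sides at \<open>Infty\<close> contribute \<open>0\<close>.
\<close>

lemma Tw_mult_ideal:
  assumes b: "proj b * m = m * g" and c: "proj b * proj a * m = m * h"
  shows "Tw (b * a) (act_Infty m) = Tw b (act_Infty m) + Tw a (act_Infty m)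
    + ideal_turning (act_Infty g) (act_Infty h)"
proof -
  define w where "w s = Complex 0 (exp s)" for s
  have wH: "w s \<in> hplane" for s
    by (simp add: w_def)
  have w: "w = gline 1"
    by (simp add: w_def gline_def fun_eq_iff)
  have w_lim: "approaches w Infty at_top"
    using gline_approaches[of 1] unfolding w by (simp add: psl_one act_Infty_psl)
  have "approaches (\<lambda>s. act k (w s)) (act_Infty k) at_top" for k
    using gline_approaches[of k] by (simp add: gline_def[abs_def] w_def)
  note gw = this[of g] act_in_hplane[OF wH, of g] and hw = this[of h] act_in_hplane[OF wH, of h]
  have "((\<lambda>s. twist b (gline m s) + twist a (gline m s) + turning_sum (w s) (act g (w s)) (act h (w s)))
    \<longlongrightarrow> Tw b (act_Infty m) + Tw a (act_Infty m) + (ideal_turning Infty (act_Infty g)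
      + ideal_turning (act_Infty g) (act_Infty h) + ideal_turning (act_Infty h) Infty)) at_top"
    unfolding turning_sum_def
    by (intro tendsto_add twist_tendsto_Tw turning_tendsto_ideal w_lim wH gw hw)
  moreover have "twist (b * a) (gline m s) = twist b (gline m s) + twist a (gline m s)
      + turning_sum (w s) (act g (w s)) (act h (w s))" for s
  proof -
    have "act (proj b) (act m (w s)) = act m (act g (w s))"
      "act (proj b * proj a) (act m (w s)) = act m (act h (w s))"
      using b c wH[of s] by (metis act_mult)+
    then show ?thesis
      using twist_mult[of "act m (w s)" b a] wH[of s] turning_sum_act[of "w s" "act g (w s)" "act h (w s)" m]
      by (simp add: gline_def w_def)
  qed
  ultimately have "((\<lambda>s. twist (b * a) (gline m s)) \<longlongrightarrow>
      Tw b (act_Infty m) + Tw a (act_Infty m) + ideal_turning (act_Infty g) (act_Infty h)) at_top"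
    by simp
  from tendsto_unique[OF _ twist_tendsto_Tw this] show ?thesis
    by simp
qed

section \<open>Area of ideal triangles\<close>

abbreviation RPt :: "real \<Rightarrow> sphere_pt" where
  "RPt x \<equiv> Pt (of_real x)"

lemma psl_times_half_turn:
  assumes "a * d - b * c = 1"
  shows "psl a b c d * half_turn = psl b (- a) d (- c)"
  unfolding half_turn_def using assms by (subst psl_mult) auto

text \<open>
  A geodesic that comes from \<open>Infty\<close> is a vertical line, run downwards.
\<close>

lemma gline_vertical:
  assumes "line_point g (-\<infinity>) = Infty"
  obtains q k where "k > 0" "act_Infty g = RPt q" "\<And>s. gline g s = Complex q (k * exp (- s))"
    "\<And>z. Re z \<noteq> 0 \<Longrightarrow> act_bar g (Pt z) = Pt (of_real q - of_real k / z)"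
proof -
  obtain a b c d where g: "a * d - b * c = 1" "g = psl a b c d" by (rule psl_cases)
  have det: "b * - c - - a * d = 1"
    using g(1) by simp
  have d: "d = 0"
    using assms by (simp add: g(2) psl_times_half_turn[OF g(1)] act_Infty_psl[OF det] split: if_splits)
  have "b * c = - 1"
    using g(1) d by simp
  then have c: "c \<noteq> 0" "b = - 1 / c"
    by (auto simp: eq_divide_eq simp del: divide_minus_left)
  have act: "act g z = of_real (a / c) - of_real (1 / c\<^sup>2) / z" if "z \<noteq> 0" for z
  proof -
    have "act g z = (of_real a * z + of_real b) / (of_real c * z)"
      using act_psl[OF g(1), of z] by (simp add: g(2) d)
    then show ?thesis
      using that c(1) by (simp add: c(2) field_simps power2_eq_square)
  qed
  have pole: "pole g z \<longleftrightarrow> z = 0" for z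
    using pole_psl[OF g(1), of z] c(1) by (simp add: g(2) d)
  show ?thesis
  proof (rule that[of "1 / c\<^sup>2" "a / c"])
    show "act_Infty g = RPt (a / c)"
      using act_Infty_psl[OF g(1)] c(1) by (simp add: g(2))
    show "gline g s = Complex (a / c) (1 / c\<^sup>2 * exp (- s))" for s
    proof -
      have "Complex 0 (exp s) \<noteq> 0"
        by (simp add: complex_eq_iff)
      then show ?thesis
        by (simp add: gline_def act complex_eq_iff Re_divide Im_divide power2_eq_square exp_minus
          inverse_eq_divide)
    qed
    show "act_bar g (Pt z) = Pt (of_real (a / c) - of_real (1 / c\<^sup>2) / z)" if "Re z \<noteq> 0" for z
    proof -
      have "z \<noteq> 0" using that by auto
      then show ?thesis
        by (simp add: act_bar_def pole act)
    qed
  qed (use c in auto)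
qed

lemma vertical_gline:
  obtains g where "line_point g (-\<infinity>) = Infty" "act_Infty g = RPt q" "\<And>s. gline g s = Complex q (exp (- s))"
    "\<And>z. Re z \<noteq> 0 \<Longrightarrow> act_bar g (Pt z) = Pt (of_real q - 1 / z)"
proof -
  define g where "g = psl q (- 1) 1 0"
  have det: "q * 0 - (- 1) * 1 = (1::real)" "(- 1) * - 1 - - q * 0 = (1::real)"
    by simp_all
  show ?thesis
  proof (rule that[of g])
    show "line_point g (-\<infinity>) = Infty"
      unfolding g_def line_point_simps psl_times_half_turn[OF det(1)] act_Infty_psl[OF det(2)] by simp
    show "act_Infty g = RPt q"
      unfolding g_def act_Infty_psl[OF det(1)] by simp
    show "gline g s = Complex q (exp (- s))" for s
      unfolding gline_def g_def act_psl[OF det(1)]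
      by (simp add: complex_eq_iff Re_divide Im_divide power2_eq_square exp_minus field_simps)
    show "act_bar g (Pt z) = Pt (of_real q - 1 / z)" if "Re z \<noteq> 0" for z
    proof -
      have "z \<noteq> 0" using that by auto
      then show ?thesis
        unfolding act_bar_def g_def by (simp add: pole_psl[OF det(1)] act_psl[OF det(1)] field_simps)
    qed
  qed
qed

lemma line_point_Infty_cases:
  assumes "line_point g s = Infty"
  shows "s = \<infinity> \<or> s = -\<infinity>"
  using assms by (cases s) auto

lemma line_point_circle_cases:
  assumes "line_point g s \<in> circle_inf"
  shows "s = \<infinity> \<or> s = -\<infinity>"
  using assms circle_inf_not_hplane[of "gline g (real_of_ereal s)"] by (cases s) auto

text \<open>
  Seen along a downward vertical geodesic, the left side is the one of larger real parts.
\<close>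

lemma anticlockwise_Infty_iff:
  assumes PQ: "P \<in> circle_inf" "Q \<in> circle_inf"
  shows "anticlockwise Infty P Q \<longleftrightarrow> (\<exists>q r. P = RPt q \<and> Q = RPt r \<and> q < r)"
proof
  assume "anticlockwise Infty P Q"
  then obtain g s t z where *: "s < t" "line_point g s = Infty" "P = line_point g t" "0 \<le> Im z" "Re z < 0"
    "Q = act_bar g (Pt z)"
    unfolding anticlockwise_iff by metis
  have s: "s = -\<infinity>"
    using line_point_Infty_cases[OF *(2)] *(1) by auto
  have t: "t = \<infinity>"
    using line_point_circle_cases[of g t] PQ(1) *(1,3) s by auto
  obtain q k where g: "k > 0" "act_Infty g = RPt q" "act_bar g (Pt z) = Pt (of_real q - of_real k / z)"
    using gline_vertical[OF *(2)[unfolded s]] *(5) by (metis less_irrefl)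
  have "Im z = 0"
  proof (rule ccontr)
    assume "Im z \<noteq> 0"
    then have "z \<in> hplane"
      using *(4) by (simp add: hplane_def)
    then show False
      using *(6) PQ(2) act_bar_Pt circle_inf_not_hplane[of "act g z"] by auto
  qed
  then have z: "z = of_real (Re z)"
    by (simp add: complex_eq_iff)
  have "Q = RPt (q - k / Re z)"
    unfolding *(6) g(3) by (subst z) simp
  moreover have "q < q - k / Re z"
    using g(1) *(5) by (simp add: divide_pos_neg)
  ultimately show "\<exists>q r. P = RPt q \<and> Q = RPt r \<and> q < r"
    using *(3) g(2) t by (intro exI[of _ q] exI[of _ "q - k / Re z"]) auto
next
  assume "\<exists>q r. P = RPt q \<and> Q = RPt r \<and> q < r"
  then obtain q r where qr: "P = RPt q" "Q = RPt r" "q < r"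
    by blast
  obtain g where g: "line_point g (-\<infinity>) = Infty" "act_Infty g = RPt q"
    "\<And>z. Re z \<noteq> 0 \<Longrightarrow> act_bar g (Pt z) = Pt (of_real q - 1 / z)"
    using vertical_gline[of q] by metis
  \<comment> \<open>The preimage of \<open>r\<close> under \<open>g\<close>, which lies to the left of the imaginary axis.\<close>
  define z where "z = complex_of_real (- (1 / (r - q)))"
  have "1 / z = of_real (q - r)"
    using qr(3) by (simp add: z_def divide_simps flip: of_real_diff)
  moreover have "Re z < 0" "Im z = 0"
    using qr(3) by (simp_all add: z_def)
  ultimately show "anticlockwise Infty P Q"
    unfolding anticlockwise_iff
    by (intro exI[of _ g] exI[of _ "-\<infinity>"] exI[of _ "\<infinity>"] exI[of _ z])
      (use g qr in auto)
qed

lemma hsegment_Infty_iff: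
  assumes z: "z \<in> hplane" and w: "Im w \<ge> 0"
  shows "Pt z \<in> hsegment Infty (Pt w) \<longleftrightarrow> Re z = Re w \<and> Im w \<le> Im z"
proof
  assume "Pt z \<in> hsegment Infty (Pt w)"
  then obtain g s r t where *: "s \<le> r" "r \<le> t" "line_point g s = Infty" "line_point g r = Pt z"
    "line_point g t = Pt w"
    unfolding hsegment_iff by metis
  have s: "s = -\<infinity>"
    using line_point_Infty_cases[OF *(3)] *(1,2,3,5) by auto
  obtain q k where g: "k > 0" "act_Infty g = RPt q" "\<And>s. gline g s = Complex q (k * exp (- s))"
    using gline_vertical[OF *(3)[unfolded s]] by metis
  obtain r' where r: "r = ereal r'" "gline g r' = z"
    using line_point_eq_Pt_hplane[OF *(4) z] .
  show "Re z = Re w \<and> Im w \<le> Im z"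
  proof (cases t)
    case (real t')
    then have "w = Complex q (k * exp (- t'))" "r' \<le> t'"
      using *(2,5) r g(3)[of t'] by auto
    then show ?thesis
      using g(1,3) by (simp flip: r(2))
  next
    case PInf
    then have "w = of_real q"
      using *(5) g(2) by simp
    then show ?thesis
      using g(1,3) by (simp flip: r(2))
  qed (use *(2) r in auto)
next
  assume *: "Re z = Re w \<and> Im w \<le> Im z"
  have zp: "Im z > 0"
    using z by (simp add: hplane_def)
  obtain g where g: "line_point g (-\<infinity>) = Infty" "act_Infty g = RPt (Re w)"
    "\<And>s. gline g s = Complex (Re w) (exp (- s))"
    using vertical_gline[of "Re w"] by metis
  have gl: "gline g (- ln (Im v)) = v" if "Im v > 0" "Re v = Re w" for v
    using that by (simp add: g(3) complex_eq_iff)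
  define t where "t = (if Im w = 0 then \<infinity> else ereal (- ln (Im w)))"
  have "line_point g t = Pt w"
    using g(2) gl[of w] w by (auto simp: t_def complex_eq_iff)
  moreover have "ereal (- ln (Im z)) \<le> t"
    using * zp w by (auto simp: t_def)
  moreover have "line_point g (ereal (- ln (Im z))) = Pt z"
    using gl[of z] zp * by simp
  ultimately show "Pt z \<in> hsegment Infty (Pt w)"
    unfolding hsegment_iff using g(1)
    by (intro exI[of _ g] exI[of _ "-\<infinity>"] exI[of _ "ereal (- ln (Im z))"] exI[of _ t]) simp
qed

text \<open>
  The geodesic between two reals is the half circle over them; the entries of its matrix satisfy
  \<open>a = r * c\<close> and \<open>b = q * d\<close>.
\<close>

lemma hsegment_reals_imp:
  assumes "q < r" and P: "P \<in> hsegment (RPt q) (RPt r)"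
  obtains w where "P = Pt w" "q \<le> Re w" "Re w \<le> r" "Im w \<ge> 0" "(Im w)\<^sup>2 = (Re w - q) * (r - Re w)"
proof -
  obtain g s l t where *: "s \<le> l" "l \<le> t" "line_point g s = RPt q" "P = line_point g l"
    "line_point g t = RPt r"
    using P unfolding hsegment_iff by metis
  have "RPt x \<in> circle_inf" for x
    by (simp add: circle_inf_def)
  then have "s \<in> {\<infinity>, -\<infinity>}" "t \<in> {\<infinity>, -\<infinity>}"
    using line_point_circle_cases[of g s] line_point_circle_cases[of g t] *(3,5) by auto
  moreover have "s \<noteq> t"
    using *(3,5) assms(1) by auto
  ultimately have st: "s = -\<infinity>" "t = \<infinity>"
    using *(1,2) by auto
  obtain a b c d where g: "a * d - b * c = 1" "g = psl a b c d" by (rule psl_cases)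
  have det: "b * - c - - a * d = 1"
    using g(1) by simp
  have "c \<noteq> 0" "a / c = r"
    using *(5) by (auto simp: st g(2) act_Infty_psl[OF g(1)] simp del: of_real_divide split: if_splits)
  then have c: "c \<noteq> 0" "a = r * c"
    by auto
  have "d \<noteq> 0" "b / d = q"
    using *(3)
      by (auto simp: st g(2) psl_times_half_turn[OF g(1)] act_Infty_psl[OF det] simp del: of_real_divide
        split: if_splits)
  then have d: "d \<noteq> 0" "b = q * d"
    by auto
  have cd: "(r - q) * (c * d) = 1"
    using g(1) unfolding c(2) d(2) by (simp add: algebra_simps)
  show ?thesis
  proof (cases l)
    case (real l')
    define T J where "T = exp (2 * l')" and "J = c\<^sup>2 * T + d\<^sup>2"
    have J: "J > 0" "T > 0"
      using c d by (auto simp: J_def T_def intro: add_pos_nonneg)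
    define w where "w = gline g l'"
    have Re: "Re w = (r * c\<^sup>2 * T + q * d\<^sup>2) / J"
      unfolding w_def g(2) gline_psl_Re[OF g(1)] unfolding c(2) d(2) J_def T_def
        by (simp add: power2_eq_square mult_ac)
    have "Re w - q = (r - q) * c\<^sup>2 * T / J" "r - Re w = (r - q) * d\<^sup>2 / J"
      using J(1) unfolding Re by (simp_all add: J_def field_simps)
    note Re_diff = this
    have Im: "Im w = exp l' / J"
    proof -
      have "Im w = exp l' / (cmod (of_real c * Complex 0 (exp l') + of_real d))\<^sup>2"
        unfolding w_def g(2) gline_def by (subst Im_act_psl[OF g(1)]) auto
      also have "(cmod (of_real c * Complex 0 (exp l') + of_real d))\<^sup>2 = J"
        by (simp add: cmod_power2 J_def T_def power_mult_distrib flip: exp_double)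
      finally show ?thesis .
    qed
    show ?thesis
    proof (rule that[of w])
      show "P = Pt w"
        using *(4) by (simp add: real w_def)
      have "0 \<le> Re w - q" "0 \<le> r - Re w"
        unfolding Re_diff using J assms(1) by simp_all
      then show "q \<le> Re w" "Re w \<le> r"
        by simp_all
      show "Im w \<ge> 0"
        using J by (simp add: Im)
      have "(Re w - q) * (r - Re w) = ((r - q) * (c * d))\<^sup>2 * T / J\<^sup>2"
        unfolding Re_diff by (simp add: power2_eq_square)
      also have "\<dots> = (Im w)\<^sup>2"
        unfolding cd Im by (simp add: T_def power_divide exp_double)
      finally show "(Im w)\<^sup>2 = (Re w - q) * (r - Re w)" ..
    qed
  next
    case PInf
    then show ?thesis
      using *(4,5) st assms(1) by (intro that[of "of_real r"]) auto
  next
    case MInf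
    then show ?thesis
      using *(3,4) st assms(1) by (intro that[of "of_real q"]) auto
  qed
qed

lemma hsegment_reals_over:
  assumes "q < r" "q \<le> x" "x \<le> r"
  obtains w where "Pt w \<in> hsegment (RPt q) (RPt r)" "Re w = x"
proof -
  define k where "k = 1 / sqrt (r - q)"
  have k: "k > 0" "(r - q) * (k * k) = 1"
    using assms(1) by (auto simp: k_def)
  have det: "(r * k) * k - (q * k) * k = 1" "(q * k) * - k - - (r * k) * k = 1"
    using k(2) by (simp_all add: algebra_simps)
  \<comment> \<open>Takes \<open>0\<close> to \<open>q\<close> and \<open>Infty\<close> to \<open>r\<close>; the factor \<open>k\<close> makes the determinant \<open>1\<close>.\<close>
  define g where "g = psl (r * k) (q * k) k k"
  have ends: "line_point g (-\<infinity>) = RPt q" "line_point g \<infinity> = RPt r"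
    using k(1)
      unfolding g_def line_point_simps psl_times_half_turn[OF det(1)] act_Infty_psl[OF det(2)]
        act_Infty_psl[OF det(1)]
    by simp_all
  have on: "line_point g l \<in> hsegment (RPt q) (RPt r)" for l
    unfolding hsegment_iff using ends
    by (intro exI[of _ g] exI[of _ "-\<infinity>"] exI[of _ l] exI[of _ "\<infinity>"]) simp
  consider "x = q" | "x = r" | "q < x" "x < r"
    using assms by linarith
  then show ?thesis
  proof cases
    case 1
    then show ?thesis
      using on[of "-\<infinity>"] ends by (intro that[of "of_real q"]) simp_all
  next
    case 2
    then show ?thesis
      using on[of "\<infinity>"] ends by (intro that[of "of_real r"]) simp_all
  next
    case 3
    \<comment> \<open>The time at which the half circle lies over \<open>x\<close>.\<close>
    define l where "l = ln ((x - q) / (r - x)) / 2"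
    have T: "exp (2 * l) = (x - q) / (r - x)"
      using 3 by (simp add: l_def)
    have "Re (gline g l) = (r * exp (2 * l) + q) * k\<^sup>2 / ((exp (2 * l) + 1) * k\<^sup>2)"
      unfolding g_def gline_psl_Re[OF det(1)] by (simp add: power2_eq_square algebra_simps)
    also have "\<dots> = (r * exp (2 * l) + q) / (exp (2 * l) + 1)"
      using k(1) by simp
    also have "r * exp (2 * l) + q = x * (r - q) / (r - x)"
      unfolding T using 3 by (simp add: field_simps)
    also have "exp (2 * l) + 1 = (r - q) / (r - x)"
      unfolding T using 3 by (simp add: field_simps)
    also have "x * (r - q) / (r - x) / ((r - q) / (r - x)) = x * (r - q) / (r - q)"
      using 3 by simp
    also have "\<dots> = x"
      using assms(1) by simp
    finally have "Re (gline g l) = x" .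
    then show ?thesis
      using on[of "ereal l"] by (intro that[of "gline g l"]) simp_all
  qed
qed

lemma htriangle_Infty:
  assumes "q < r"
  shows "htriangle Infty (RPt q) (RPt r)
    = {z. 0 < Im z \<and> q \<le> Re z \<and> Re z \<le> r \<and> (Re z - q) * (r - Re z) \<le> (Im z)\<^sup>2}" (is "?T = ?S")
proof (intro equalityI subsetI)
  fix z assume "z \<in> ?T"
  then obtain P where P: "z \<in> hplane" "P \<in> hsegment (RPt q) (RPt r)" "Pt z \<in> hsegment Infty P"
    by (auto simp: htriangle_def)
  obtain w where w: "P = Pt w" "q \<le> Re w" "Re w \<le> r" "Im w \<ge> 0" "(Im w)\<^sup>2 = (Re w - q) * (r - Re w)"
    using hsegment_reals_imp[OF assms P(2)] .
  have "Re z = Re w" "Im w \<le> Im z"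
    using P(3) hsegment_Infty_iff[OF P(1) w(4)] by (auto simp: w(1))
  then show "z \<in> ?S"
    using w P(1) by (simp add: hplane_def flip: w(5))
next
  fix z assume z: "z \<in> ?S"
  obtain w where w: "Pt w \<in> hsegment (RPt q) (RPt r)" "Re w = Re z"
    using hsegment_reals_over[OF assms, of "Re z"] z by auto
  then have "Im w \<ge> 0" "(Im w)\<^sup>2 = (Re z - q) * (r - Re z)"
    using hsegment_reals_imp[OF assms w(1)] by (metis sphere_pt.inject)+
  moreover from this have "Im w \<le> Im z"
    using z by (intro power2_le_imp_le[of "Im w"]) auto
  ultimately have "Pt z \<in> hsegment Infty (Pt w)"
    using z w(2) by (subst hsegment_Infty_iff) (auto simp: hplane_def)
  then show "z \<in> ?T"
    using z w(1) by (auto simp: htriangle_def hplane_def)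
qed

lemma nn_integral_inverse_square_atLeast:
  assumes "0 < h"
  shows "(\<integral>\<^sup>+y. ennreal (1 / y\<^sup>2) * indicator {h..} y \<partial>lborel) = ennreal (1 / h)"
proof -
  have "(\<integral>\<^sup>+y. ennreal (1 / y\<^sup>2) * indicator {h..} y \<partial>lborel) = 0 - (- 1 / h)"
  proof (rule nn_integral_FTC_atLeast)
    show "((\<lambda>y::real. - 1 / y) \<longlongrightarrow> 0) at_top"
      by (rule tendsto_divide_at_top) (rule filterlim_ident)
  qed (use assms in \<open>auto intro!: derivative_eq_intros simp: power2_eq_square\<close>)
  then show ?thesis by simp
qed

text \<open>
  The integrand is unbounded at both ends. The antiderivative, an arc sine, is continuous there and
  increases by $\pi$.
\<close>

lemma nn_integral_semicircle:
  assumes "q < r"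
  shows "(\<integral>\<^sup>+x. ennreal (1 / sqrt ((x - q) * (r - x))) * indicator {q<..<r} x \<partial>lborel) = ennreal pi"
proof -
  define m R where "m = (q + r) / 2" and "R = (r - q) / 2"
  have R: "R > 0" "q = m - R" "r = m + R"
    using assms by (auto simp: m_def R_def field_simps)
  define f where "f x = 1 / sqrt ((x - q) * (r - x))" for x
  define G where "G x = arcsin ((x - m) / R)" for x
  have pos: "(x - q) * (r - x) > 0" if "q < x" "x < r" for x
    using that by simp
  have G: "DERIV G x :> f x" if x: "q < x" "x < r" for x
  proof -
    have b: "- 1 < (x - m) / R" "(x - m) / R < 1"
      using x R by (auto simp: less_divide_eq divide_less_eq)
    have "(x - q) * (r - x) = R\<^sup>2 - (x - m)\<^sup>2"
      unfolding R(2,3) by (simp add: power2_eq_square algebra_simps)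
    also have "\<dots> = R\<^sup>2 * (1 - ((x - m) / R)\<^sup>2)"
      using R(1) by (simp add: right_diff_distrib power_divide)
    finally have "sqrt ((x - q) * (r - x)) = sqrt (R\<^sup>2 * (1 - ((x - m) / R)\<^sup>2))"
      by simp
    also have "\<dots> = R * sqrt (1 - ((x - m) / R)\<^sup>2)"
      using R(1) by (simp add: real_sqrt_mult)
    finally have "f x = inverse (sqrt (1 - ((x - m) / R)\<^sup>2)) * (1 / R)"
      by (simp add: f_def divide_inverse)
    moreover have "DERIV (\<lambda>x. (x - m) / R) x :> 1 / R"
      using R(1) by (auto intro!: derivative_eq_intros)
    from DERIV_chain2[OF DERIV_arcsin[OF b] this]
    have "DERIV G x :> inverse (sqrt (1 - ((x - m) / R)\<^sup>2)) * (1 / R)"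
      by (simp add: G_def[abs_def])
    ultimately show ?thesis by simp
  qed
  have contG: "continuous_on {q..r} G"
    unfolding G_def using R by (intro continuous_intros) (auto simp: le_divide_eq divide_le_eq)
  have G_ends: "G q = - (pi / 2)" "G r = pi / 2"
    using R by (simp_all add: G_def)
  have lim: "((G \<circ> real_of_ereal) \<longlongrightarrow> - (pi / 2)) (at_right (ereal q))"
    "((G \<circ> real_of_ereal) \<longlongrightarrow> pi / 2) (at_left (ereal r))"
  proof -
    have "(G \<longlongrightarrow> G q) (at q within {q..r})" "(G \<longlongrightarrow> G r) (at r within {q..r})"
      using contG assms by (auto simp: continuous_on_def)
    then have "(G \<longlongrightarrow> G q) (at_right q)" "(G \<longlongrightarrow> G r) (at_left r)"
      using assms at_within_Icc_at_right[of q r] at_within_Icc_at_left[of q r] by auto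
    then show "((G \<circ> real_of_ereal) \<longlongrightarrow> - (pi / 2)) (at_right (ereal q))"
      "((G \<circ> real_of_ereal) \<longlongrightarrow> pi / 2) (at_left (ereal r))"
      by (simp_all add: ereal_tendsto_simps G_ends)
  qed
  have cont: "isCont f x" if "q < x" "x < r" for x
    unfolding f_def using pos[OF that] by (intro continuous_intros) auto
  have nonneg: "0 \<le> f x" if "q < x" "x < r" for x
    using pos[OF that] by (simp add: f_def)
  have "AE x in lborel. ereal q < ereal x \<longrightarrow> ereal x < ereal r \<longrightarrow> 0 \<le> f x"
    using nonneg by simp
  note FTC = interval_integral_FTC_nonneg[of "ereal q" "ereal r" G f, OF _ _ _ this lim]
  have int: "set_integrable lborel (einterval q r) f" "(LBINT x=ereal q..ereal r. f x) = pi / 2 - - (pi / 2)"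
    by (rule FTC; use assms G cont in simp)+
  have ei: "einterval q r = {q<..<r}"
    by auto
  have "(\<integral>\<^sup>+x. ennreal (f x) * indicator {q<..<r} x \<partial>lborel)
    = (\<integral>\<^sup>+x. ennreal (indicator {q<..<r} x *\<^sub>R f x) \<partial>lborel)"
    by (intro nn_integral_cong) (auto simp: indicator_def)
  also have "\<dots> = ennreal (LINT x|lborel. indicator {q<..<r} x *\<^sub>R f x)"
    using int(1) nonneg unfolding ei set_integrable_def
    by (intro nn_integral_eq_integral) (auto simp: indicator_def)
  also have "(LINT x|lborel. indicator {q<..<r} x *\<^sub>R f x) = pi"
    using int(2) assms by (simp add: interval_lebesgue_integral_def set_lebesgue_integral_def)
  finally show ?thesis
    by (simp add: f_def)
qed

lemma harea_htriangle_Infty: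
  assumes "q < r"
  shows "htriangle Infty (RPt q) (RPt r) \<in> sets borel" (is "?T \<in> _")
    "harea (htriangle Infty (RPt q) (RPt r)) = pi"
proof -
  show [measurable]: "?T \<in> sets borel"
    unfolding htriangle_Infty[OF assms] by measurable
  have "(\<integral>\<^sup>+z. ennreal (1 / (Im z)\<^sup>2) * indicator ?T z \<partial>lborel)
      = (\<integral>\<^sup>+x. \<integral>\<^sup>+y. ennreal (1 / y\<^sup>2) * indicator ?T (Complex x y) \<partial>lborel \<partial>lborel)"
    by (subst nn_integral_complex(1)) simp_all
  also have "\<dots> = (\<integral>\<^sup>+x. ennreal (1 / sqrt ((x - q) * (r - x))) * indicator {q<..<r} x \<partial>lborel)"
  proof (rule nn_integral_cong_AE)
    have eq: "(\<integral>\<^sup>+y. ennreal (1 / y\<^sup>2) * indicator ?T (Complex x y) \<partial>lborel)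
        = ennreal (1 / sqrt ((x - q) * (r - x))) * indicator {q<..<r} x" if "x \<noteq> q" "x \<noteq> r" for x
    proof (cases "x \<in> {q<..<r}")
      case True
      define h where "h = sqrt ((x - q) * (r - x))"
      have h: "h > 0" "h\<^sup>2 = (x - q) * (r - x)"
        using True by (auto simp: h_def)
      have "indicator ?T (Complex x y) = (indicator {h..} y :: ennreal)" for y
      proof -
        have "h \<le> y \<longleftrightarrow> 0 < y \<and> h\<^sup>2 \<le> y\<^sup>2"
          using h(1) power2_le_imp_le[of h y] power_mono[of h y 2] by auto
        then show ?thesis
          using True unfolding htriangle_Infty[OF assms] h(2) by (simp add: indicator_def)
      qed
      then show ?thesis
        using nn_integral_inverse_square_atLeast[OF h(1)] True by (simp add: h_def)
    next
      case False
      then have "indicator ?T (Complex x y) = (0 :: ennreal)" for y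
        using that unfolding htriangle_Infty[OF assms] by (auto simp: indicator_def)
      then show ?thesis
        using False by simp
    qed
    show "AE x in lborel. (\<integral>\<^sup>+y. ennreal (1 / y\<^sup>2) * indicator ?T (Complex x y) \<partial>lborel)
        = ennreal (1 / sqrt ((x - q) * (r - x))) * indicator {q<..<r} x"
      using AE_lborel_singleton[of q] AE_lborel_singleton[of r] by eventually_elim (rule eq)
  qed
  also have "\<dots> = ennreal pi"
    by (rule nn_integral_semicircle[OF assms])
  finally show "harea ?T = pi"
    by (simp add: harea_eq_nn_integral)
qed

text \<open>
  Orientation and area are invariant, so \<open>m\<close> can be removed. What remains is the region above a half
  circle, or a degenerate triangle.
\<close>

lemma signed_area_Infty:
  assumes PQ: "P \<in> circle_inf" "Q \<in> circle_inf"
  shows "signed_area (act_bar m Infty) (act_bar m P) (act_bar m Q) = - ideal_turning P Q"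
proof -
  have H: "Infty \<in> hbar" "P \<in> hbar" "Q \<in> hbar"
    using PQ by (auto simp: hbar_eq circle_inf_def)
  obtain m' where m': "m' * m = 1"
    using psl2r_inverse[of m] by blast
  let ?V = "\<lambda>x. act_bar m (RPt x)"
  have area: "harea (htriangle (act_bar m Infty) (?V q) (?V r)) = pi"
    if "q < r" for q r
  proof -
    have H': "Infty \<in> hbar" "RPt x \<in> hbar" for x
      by (auto simp: hbar_def)
    have "harea (htriangle (act_bar m Infty) (?V q) (?V r))
        = harea (htriangle Infty (RPt q) (RPt r))"
    proof (rule harea_act)
      fix z assume "z \<in> hplane"
      then show "act m' z \<in> htriangle Infty (RPt q) (RPt r) \<longleftrightarrow>
          z \<in> htriangle (act_bar m Infty) (?V q) (?V r)"
        using htriangle_act_iff[of z "act_bar m Infty" "?V q" "?V r" m']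
          H' m' by (simp add: act_bar_inverse)
    qed (rule harea_htriangle_Infty[OF that] htriangle_subset)+
    then show ?thesis
      by (simp add: harea_htriangle_Infty[OF that])
  qed
  show ?thesis
  proof (cases "\<exists>q r. P = RPt q \<and> Q = RPt r")
    case True
    then obtain q r where "P = RPt q" "Q = RPt r"
      by blast
    then show ?thesis
      unfolding signed_area_def anticlockwise_act_iff[OF H] anticlockwise_act_iff[OF H(1,3,2)]
        anticlockwise_Infty_iff[OF PQ] anticlockwise_Infty_iff[OF PQ(2,1)]
      using area[of q r] area[of r q] htriangle_swap[of "act_bar m Infty" "act_bar m P" "act_bar m Q"]
      by (auto simp: ideal_turning_def sgn_if)
  next
    case False
    then have "ideal_turning P Q = 0"
      using PQ by (auto simp: ideal_turning_def circle_inf_def complex_eq_iff split: sphere_pt.splits)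
    moreover have "\<not> anticlockwise Infty P Q" "\<not> anticlockwise Infty Q P"
      unfolding anticlockwise_Infty_iff[OF PQ] anticlockwise_Infty_iff[OF PQ(2,1)] using False by auto
    ultimately show ?thesis
      unfolding signed_area_def anticlockwise_act_iff[OF H] anticlockwise_act_iff[OF H(1,3,2)] by simp
  qed
qed

section \<open>The cocycle formula\<close>

theorem lemma3p5:
  fixes \<alpha> \<beta> :: upsl2r and p :: sphere_pt
  assumes "p \<in> hbar"
  shows "Tw (\<beta> * \<alpha>) p = Tw \<beta> p + Tw \<alpha> p
    - signed_area p (act_bar (proj \<beta>) p) (act_bar (proj \<beta> * proj \<alpha>) p)"
proof (cases "p \<in> circle_inf")
  case True
  then obtain m where m: "p = act_Infty m"
    by (rule circle_inf_cases)
  obtain g where g: "proj \<beta> * m = m * g"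
    using conjugate_exists[of "proj \<beta>" m] by blast
  obtain h where h: "proj \<beta> * proj \<alpha> * m = m * h"
    using conjugate_exists[of "proj \<beta> * proj \<alpha>" m] by blast
  have "act_bar m Infty = p"
  proof -
    have "act_Infty 1 = Infty"
      by (simp add: psl_one act_Infty_psl)
    then show ?thesis
      using act_bar_act_Infty[of m 1] by (simp add: m)
  qed
  moreover have "act_bar m (act_Infty g) = act_bar (proj \<beta>) p"
    by (simp add: m act_bar_act_Infty g)
  moreover have "act_bar m (act_Infty h) = act_bar (proj \<beta> * proj \<alpha>) p"
    by (simp add: m act_bar_act_Infty h)
  ultimately have "signed_area p (act_bar (proj \<beta>) p) (act_bar (proj \<beta> * proj \<alpha>) p)
      = - ideal_turning (act_Infty g) (act_Infty h)"
    using signed_area_Infty[OF act_Infty_circle[of g] act_Infty_circle[of h], of m] by simp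
  then show ?thesis
    using Tw_mult_ideal[OF g h] by (simp add: m)
next
  case False
  then obtain y where y: "y \<in> hplane" "p = Pt y"
    using assms by (auto simp: hbar_eq)
  then show ?thesis
    using False twist_mult[OF y(1), of \<beta> \<alpha>]
      signed_area_hplane[of y "act (proj \<beta>) y" "act (proj \<beta> * proj \<alpha>) y"]
    by (simp add: Tw_def act_bar_Pt)
qed

end
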